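(* Let $\mathsf A$ be a category fibred in abelian categories over a category $\mathsf C$ and let $\mathsf D\subseteq\mathsf X\subseteq\mathsf A$ be inclusion morphisms of categories fibred in additive categories over $\mathsf C$. Fix an object $T$ in $\mathsf C$. Assume BC1 and BC2 for $(\mathsf A,\mathsf X)$ and $T$, and AB1 and AB2 for the triple of categories $(\mathsf A(T),\mathsf X(T),\mathsf D(T))$. Then any object $N$ in $\hat{\mathsf X}^{\mathrm{fl}}(T)$ admits an $\mathsf X(T)$-approximation and a $\hat{\mathsf D}(T)$-hull $$0\to L\to M\to N\to 0\qquad\text{and}\qquad 0\to N\to L'\to M'\to 0$$ with $M$ and $M'$ in $\mathsf X(T)$ and $L$ and $L'$ in $\hat{\mathsf D}^{\mathrm{fl}}(T)$, which are preserved (as short exact sequences) by any base change.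
   Context: Fibred categories. Let $p:\mathsf F\to\mathsf C$ be a functor. The fibre $\mathsf F(T)$ over an object $T$ of $\mathsf C$ consists of the objects over $T$ and the arrows $\phi$ with $p(\phi)=\mathrm{id}_T$. An arrow $\phi_1:\xi\to\xi_1$ in $\mathsf F$ is cocartesian if for every arrow $\phi_2:\xi\to\xi_2$ and every $f_{21}:p(\xi_1)\to p(\xi_2)$ with $f_{21}p(\phi_1)=p(\phi_2)$ there is a unique $\phi_{21}:\xi_1\to\xi_2$ with $p(\phi_{21})=f_{21}$ and $\phi_{21}\phi_1=\phi_2$. $\mathsf F$ is fibred over $\mathsf C$ if for every $f:T\to T'$ in $\mathsf C$ and every $\xi$ over $T$ there is a cocartesian arrow $\xi\to\xi'$ over $f$; then $\xi'$ is called a base change of $\xi$ by $f$. $\mathsf F$ is fibred in additive (abelian) categories if it is fibred, all fibres are additive (abelian), for all $\xi_1,\xi_2$ and $f:p(\xi_1)\to p(\xi_2)$ the set $\mathrm{Hom}_f(\xi_1,\xi_2)$ of arrows over $f$ is an abelian group, and composition is bilinear on these groups. A morphism of such is a functor over $\mathsf C$ that preserves cocartesian arrows and is additive on the groups $\mathrm{Hom}_f$; an inclusion morphism is a morphism which is an inclusion of categories. Subcategories are full and essential (closed under isomorphism). Base change of the objects of a complex or diagram in a fibre extends uniquely to a base change of the complex or diagram. Axioms. For an abelian category $\mathsf A$ with additive subcategories $\mathsf D\subseteq\mathsf X\subseteq\mathsf A$: (AB1) $\mathsf X$ is closed under direct summands and extensions in $\mathsf A$. (AB2) For each $M$ in $\mathsf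 X$ there is a short exact sequence $0\to M\to D\to M'\to 0$ with $D$ in $\mathsf D$ and $M'$ in $\mathsf X$. For fibred $\mathsf X\subseteq\mathsf A$ over $\mathsf C$ and an object $T$ of $\mathsf C$: (BC1) If $\alpha$ is an epimorphism in $\mathsf A(T)$ and $f:T\to T'$ is an arrow in $\mathsf C$, then any base change of $\alpha$ by $f$ is an epimorphism in $\mathsf A(T')$. (BC2) If $0\to A\to B\to M\to 0$ is exact in $\mathsf A(T)$ with $M$ in $\mathsf X(T)$ and $f:T\to T'$ is an arrow in $\mathsf C$, then any base change of this sequence by $f$ is exact in $\mathsf A(T')$. Approximations. For $\mathsf D\subseteq\mathsf X\subseteq\mathsf A$ with $\mathsf A$ abelian, $\hat{\mathsf D}$ is the subcategory of objects with a finite resolution by objects of $\mathsf D$. An $\mathsf X$-approximation of $N$ is a short exact sequence $0\to L\to M\to N\to 0$ with $M$ in $\mathsf X$, $L$ in $\hat{\mathsf D}$; a $\hat{\mathsf D}$-hull of $N$ is a short exact sequence $0\to N\to L'\to M'\to0$ with $L'$ in $\hat{\mathsf D}$, $M'$ in $\mathsf X$. $\hat{\mathsf X}^{\mathrm{fl}}(T)$ (respectively $\hat{\mathsf D}^{\mathrm{fl}}(T)$) is the subcategory of $\mathsf A(T)$ of objects having a finite resolution by objects of $\mathsf X(T)$ (respectively $\mathsf D(T)$) which is preserved as a resolution by any base change. *)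

theory Defs
  imports "HOL-Algebra.Group"
begin

section \<open>Categories and functors\<close>

record ('o, 'a) cat =
  Obj :: "'o set"
  Arr :: "'a set"
  Dom :: "'a \<Rightarrow> 'o"
  Cod :: "'a \<Rightarrow> 'o"
  Ident :: "'o \<Rightarrow> 'a"
  Cmp :: "'a \<Rightarrow> 'a \<Rightarrow> 'a" (infixl \<open>\<cdot>\<index>\<close> 70)

definition Hom :: "('o, 'a, 'm) cat_scheme \<Rightarrow> 'o \<Rightarrow> 'o \<Rightarrow> 'a set" where
  "Hom C x y = {a \<in> Arr C. Dom C a = x \<and> Cod C a = y}"

locale category =
  fixes C :: "('o, 'a, 'm) cat_scheme" (structure)
  assumes Dom_closed: "a \<in> Arr C \<Longrightarrow> Dom C a \<in> Obj C"
    and Cod_closed: "a \<in> Arr C \<Longrightarrow> Cod C a \<in> Obj C"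
    and Ident_Hom: "x \<in> Obj C \<Longrightarrow> Ident C x \<in> Hom C x x"
    and Cmp_Hom: "\<lbrakk>a \<in> Hom C x y; b \<in> Hom C y z\<rbrakk> \<Longrightarrow> b \<cdot> a \<in> Hom C x z"
    and Cmp_Ident_right: "a \<in> Hom C x y \<Longrightarrow> a \<cdot> Ident C x = a"
    and Cmp_Ident_left: "a \<in> Hom C x y \<Longrightarrow> Ident C y \<cdot> a = a"
    and Cmp_assoc: "\<lbrakk>a \<in> Hom C w x; b \<in> Hom C x y; c \<in> Hom C y z\<rbrakk>
                      \<Longrightarrow> (c \<cdot> b) \<cdot> a = c \<cdot> (b \<cdot> a)"

definition cat_functor ::
  "('o, 'a, 'm) cat_scheme \<Rightarrow> ('p, 'b, 'n) cat_scheme \<Rightarrow> ('o \<Rightarrow> 'p) \<Rightarrow> ('a \<Rightarrow> 'b) \<Rightarrow> bool" where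
  "cat_functor C E Fo Fa \<longleftrightarrow>
     (\<forall>x \<in> Obj C. Fo x \<in> Obj E) \<and>
     (\<forall>a \<in> Arr C. Fa a \<in> Hom E (Fo (Dom C a)) (Fo (Cod C a))) \<and>
     (\<forall>x \<in> Obj C. Fa (Ident C x) = Ident E (Fo x)) \<and>
     (\<forall>a \<in> Arr C. \<forall>b \<in> Arr C. Cod C a = Dom C b \<longrightarrow>
        Fa (b \<cdot>\<^bsub>C\<^esub> a) = Fa b \<cdot>\<^bsub>E\<^esub> Fa a)"

definition iso_arrow :: "('o, 'a, 'm) cat_scheme \<Rightarrow> 'a \<Rightarrow> bool" where
  "iso_arrow C a \<longleftrightarrow> a \<in> Arr C \<and>
     (\<exists>b \<in> Hom C (Cod C a) (Dom C a).
        b \<cdot>\<^bsub>C\<^esub> a = Ident C (Dom C a) \<and> a \<cdot>\<^bsub>C\<^esub> b = Ident C (Cod C a))"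

definition mono_arrow :: "('o, 'a, 'm) cat_scheme \<Rightarrow> 'a \<Rightarrow> bool" where
  "mono_arrow C a \<longleftrightarrow> a \<in> Arr C \<and>
     (\<forall>x \<in> Obj C. \<forall>u \<in> Hom C x (Dom C a). \<forall>v \<in> Hom C x (Dom C a).
        a \<cdot>\<^bsub>C\<^esub> u = a \<cdot>\<^bsub>C\<^esub> v \<longrightarrow> u = v)"

definition epi_arrow :: "('o, 'a, 'm) cat_scheme \<Rightarrow> 'a \<Rightarrow> bool" where
  "epi_arrow C a \<longleftrightarrow> a \<in> Arr C \<and>
     (\<forall>x \<in> Obj C. \<forall>u \<in> Hom C (Cod C a) x. \<forall>v \<in> Hom C (Cod C a) x.
        u \<cdot>\<^bsub>C\<^esub> a = v \<cdot>\<^bsub>C\<^esub> a \<longrightarrow> u = v)"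

definition zero_object :: "('o, 'a, 'm) cat_scheme \<Rightarrow> 'o \<Rightarrow> bool" where
  "zero_object C z \<longleftrightarrow> z \<in> Obj C \<and>
     (\<forall>x \<in> Obj C. (\<exists>!a. a \<in> Hom C x z) \<and> (\<exists>!a. a \<in> Hom C z x))"


section \<open>Additive and abelian categories\<close>

text \<open>The abelian groups of arrows are groups of HOL-Algebra, hence written multiplicatively:
  \<open>x \<otimes> y\<close> is the sum of two parallel arrows and \<open>\<one>\<close> is the zero arrow.\<close>

record ('o, 'a) gcat = "('o, 'a) cat" +
  HomGrp :: "'o \<Rightarrow> 'o \<Rightarrow> 'a monoid"

abbreviation zero_arrow :: "('o, 'a, 'm) gcat_scheme \<Rightarrow> 'o \<Rightarrow> 'o \<Rightarrow> 'a" where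
  "zero_arrow A x y \<equiv> \<one>\<^bsub>HomGrp A x y\<^esub>"

definition preadditive :: "('o, 'a, 'm) gcat_scheme \<Rightarrow> bool" where
  "preadditive A \<longleftrightarrow> category A \<and>
     (\<forall>x \<in> Obj A. \<forall>y \<in> Obj A.
        comm_group (HomGrp A x y) \<and> carrier (HomGrp A x y) = Hom A x y) \<and>
     (\<forall>x \<in> Obj A. \<forall>y \<in> Obj A. \<forall>z \<in> Obj A.
        (\<forall>b \<in> Hom A y z. (\<lambda>a. b \<cdot>\<^bsub>A\<^esub> a) \<in> hom (HomGrp A x y) (HomGrp A x z)) \<and>
        (\<forall>a \<in> Hom A x y. (\<lambda>b. b \<cdot>\<^bsub>A\<^esub> a) \<in> hom (HomGrp A y z) (HomGrp A x z)))"

definition biproduct ::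
  "('o, 'a, 'm) gcat_scheme \<Rightarrow> 'o \<Rightarrow> 'o \<Rightarrow> 'o \<Rightarrow> 'a \<Rightarrow> 'a \<Rightarrow> 'a \<Rightarrow> 'a \<Rightarrow> bool" where
  "biproduct A x y s i\<^sub>1 i\<^sub>2 p\<^sub>1 p\<^sub>2 \<longleftrightarrow>
     x \<in> Obj A \<and> y \<in> Obj A \<and> s \<in> Obj A \<and>
     i\<^sub>1 \<in> Hom A x s \<and> i\<^sub>2 \<in> Hom A y s \<and> p\<^sub>1 \<in> Hom A s x \<and> p\<^sub>2 \<in> Hom A s y \<and>
     p\<^sub>1 \<cdot>\<^bsub>A\<^esub> i\<^sub>1 = Ident A x \<and> p\<^sub>2 \<cdot>\<^bsub>A\<^esub> i\<^sub>2 = Ident A y \<and>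
     p\<^sub>2 \<cdot>\<^bsub>A\<^esub> i\<^sub>1 = zero_arrow A x y \<and> p\<^sub>1 \<cdot>\<^bsub>A\<^esub> i\<^sub>2 = zero_arrow A y x \<and>
     (i\<^sub>1 \<cdot>\<^bsub>A\<^esub> p\<^sub>1) \<otimes>\<^bsub>HomGrp A s s\<^esub> (i\<^sub>2 \<cdot>\<^bsub>A\<^esub> p\<^sub>2) = Ident A s"

definition additive_category :: "('o, 'a, 'm) gcat_scheme \<Rightarrow> bool" where
  "additive_category A \<longleftrightarrow> preadditive A \<and> (\<exists>z. zero_object A z) \<and>
     (\<forall>x \<in> Obj A. \<forall>y \<in> Obj A. \<exists>s i\<^sub>1 i\<^sub>2 p\<^sub>1 p\<^sub>2. biproduct A x y s i\<^sub>1 i\<^sub>2 p\<^sub>1 p\<^sub>2)"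

definition is_kernel :: "('o, 'a, 'm) gcat_scheme \<Rightarrow> 'a \<Rightarrow> 'a \<Rightarrow> bool" where
  "is_kernel A a k \<longleftrightarrow> a \<in> Arr A \<and> k \<in> Arr A \<and> Cod A k = Dom A a \<and>
     a \<cdot>\<^bsub>A\<^esub> k = zero_arrow A (Dom A k) (Cod A a) \<and>
     (\<forall>h \<in> Arr A. Cod A h = Dom A a \<and> a \<cdot>\<^bsub>A\<^esub> h = zero_arrow A (Dom A h) (Cod A a) \<longrightarrow>
        (\<exists>!u. u \<in> Hom A (Dom A h) (Dom A k) \<and> k \<cdot>\<^bsub>A\<^esub> u = h))"

definition is_cokernel :: "('o, 'a, 'm) gcat_scheme \<Rightarrow> 'a \<Rightarrow> 'a \<Rightarrow> bool" where
  "is_cokernel A a c \<longleftrightarrow> a \<in> Arr A \<and> c \<in> Arr A \<and> Dom A c = Cod A a \<and>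
     c \<cdot>\<^bsub>A\<^esub> a = zero_arrow A (Dom A a) (Cod A c) \<and>
     (\<forall>h \<in> Arr A. Dom A h = Cod A a \<and> h \<cdot>\<^bsub>A\<^esub> a = zero_arrow A (Dom A a) (Cod A h) \<longrightarrow>
        (\<exists>!u. u \<in> Hom A (Cod A c) (Cod A h) \<and> u \<cdot>\<^bsub>A\<^esub> c = h))"

definition abelian_category :: "('o, 'a, 'm) gcat_scheme \<Rightarrow> bool" where
  "abelian_category A \<longleftrightarrow> additive_category A \<and>
     (\<forall>a \<in> Arr A. (\<exists>k. is_kernel A a k) \<and> (\<exists>c. is_cokernel A a c)) \<and>
     (\<forall>a. mono_arrow A a \<longrightarrow> (\<exists>b. is_kernel A b a)) \<and>
     (\<forall>a. epi_arrow A a \<longrightarrow> (\<exists>b. is_cokernel A b a))"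

text \<open>An image is a kernel of a cokernel.\<close>

definition is_image :: "('o, 'a, 'm) gcat_scheme \<Rightarrow> 'a \<Rightarrow> 'a \<Rightarrow> bool" where
  "is_image A a m \<longleftrightarrow> (\<exists>c. is_cokernel A a c \<and> is_kernel A c m)"

definition exact_pair :: "('o, 'a, 'm) gcat_scheme \<Rightarrow> 'a \<Rightarrow> 'a \<Rightarrow> bool" where
  "exact_pair A a b \<longleftrightarrow> a \<in> Arr A \<and> b \<in> Arr A \<and> Cod A a = Dom A b \<and>
     (\<exists>m. is_image A a m \<and> is_kernel A b m)"


section \<open>Exact sequences and resolutions\<close>

text \<open>A list \<open>[d\<^sub>n, \<dots>, d\<^sub>0]\<close> stands for the diagram
  \<open>x\<^sub>n \<rightarrow> \<dots> \<rightarrow> x\<^sub>0 \<rightarrow> x\<^sub>-\<^sub>1\<close> with \<open>d\<^sub>i : x\<^sub>i \<rightarrow> x\<^sub>i\<^sub>-\<^sub>1\<close>.\<close>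

definition chain :: "('o, 'a, 'm) cat_scheme \<Rightarrow> 'a list \<Rightarrow> bool" where
  "chain C as \<longleftrightarrow> as \<noteq> [] \<and> set as \<subseteq> Arr C \<and>
     (\<forall>i. Suc i < length as \<longrightarrow> Cod C (as ! i) = Dom C (as ! Suc i))"

text \<open>Exactness of \<open>0 \<rightarrow> x\<^sub>n \<rightarrow> \<dots> \<rightarrow> x\<^sub>0 \<rightarrow> x\<^sub>-\<^sub>1 \<rightarrow> 0\<close>, including
  exactness at both ends.\<close>

definition exact_sequence :: "('o, 'a, 'm) gcat_scheme \<Rightarrow> 'a list \<Rightarrow> bool" where
  "exact_sequence A as \<longleftrightarrow> chain A as \<and> mono_arrow A (hd as) \<and> epi_arrow A (last as) \<and>
     (\<forall>i. Suc i < length as \<longrightarrow> exact_pair A (as ! i) (as ! Suc i))"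

abbreviation short_exact :: "('o, 'a, 'm) gcat_scheme \<Rightarrow> 'a \<Rightarrow> 'a \<Rightarrow> bool" where
  "short_exact A i p \<equiv> exact_sequence A [i, p]"

definition resolution ::
  "('o, 'a, 'm) gcat_scheme \<Rightarrow> ('o, 'a, 'n) cat_scheme \<Rightarrow> 'a list \<Rightarrow> 'o \<Rightarrow> bool" where
  "resolution A X as N \<longleftrightarrow>
     exact_sequence A as \<and> Cod A (last as) = N \<and> (\<forall>a \<in> set as. Dom A a \<in> Obj X)"

definition hat :: "('o, 'a, 'm) gcat_scheme \<Rightarrow> ('o, 'a, 'n) cat_scheme \<Rightarrow> 'o set" where
  "hat A X = {N \<in> Obj A. \<exists>as. resolution A X as N}"

definition AB1 :: "('o, 'a, 'm) gcat_scheme \<Rightarrow> ('o, 'a, 'n) cat_scheme \<Rightarrow> bool" where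
  "AB1 A X \<longleftrightarrow>
     (\<forall>x y s i\<^sub>1 i\<^sub>2 p\<^sub>1 p\<^sub>2. biproduct A x y s i\<^sub>1 i\<^sub>2 p\<^sub>1 p\<^sub>2 \<and> s \<in> Obj X \<longrightarrow> x \<in> Obj X) \<and>
     (\<forall>i p. short_exact A i p \<and> Dom A i \<in> Obj X \<and> Cod A p \<in> Obj X \<longrightarrow> Cod A i \<in> Obj X)"

definition AB2 ::
  "('o, 'a, 'm) gcat_scheme \<Rightarrow> ('o, 'a, 'n) cat_scheme \<Rightarrow> ('o, 'a, 'k) cat_scheme \<Rightarrow> bool" where
  "AB2 A X D \<longleftrightarrow>
     (\<forall>M \<in> Obj X. \<exists>i p. short_exact A i p \<and>
        Dom A i = M \<and> Cod A i \<in> Obj D \<and> Cod A p \<in> Obj X)"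

text \<open>The pair \<open>i, p\<close> is an \<open>X\<close>-approximation
  \<open>0 \<rightarrow> L \<rightarrow> M \<rightarrow> N \<rightarrow> 0\<close> of \<open>N\<close>,
  respectively a hull \<open>0 \<rightarrow> N \<rightarrow> L' \<rightarrow> M' \<rightarrow> 0\<close> of \<open>N\<close>.\<close>

definition approximation ::
  "('o, 'a, 'm) gcat_scheme \<Rightarrow> ('o, 'a, 'n) cat_scheme \<Rightarrow> ('o, 'a, 'k) cat_scheme
     \<Rightarrow> 'o \<Rightarrow> 'a \<Rightarrow> 'a \<Rightarrow> bool" where
  "approximation A X D N i p \<longleftrightarrow> short_exact A i p \<and>
     Dom A i \<in> hat A D \<and> Cod A i \<in> Obj X \<and> Cod A p = N"

definition hull ::
  "('o, 'a, 'm) gcat_scheme \<Rightarrow> ('o, 'a, 'n) cat_scheme \<Rightarrow> ('o, 'a, 'k) cat_scheme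
     \<Rightarrow> 'o \<Rightarrow> 'a \<Rightarrow> 'a \<Rightarrow> bool" where
  "hull A X D N i p \<longleftrightarrow> short_exact A i p \<and>
     Dom A i = N \<and> Cod A i \<in> hat A D \<and> Cod A p \<in> Obj X"


section \<open>Fibred categories\<close>

text \<open>A category with a projection (\<open>PObj\<close>, \<open>PArr\<close>) to a base category, and an
  abelian group structure \<open>HomOver F x y f\<close> on the arrows from \<open>x\<close> to \<open>y\<close> over \<open>f\<close>.\<close>

record ('o, 'a, 't, 'b) fcat = "('o, 'a) cat" +
  PObj :: "'o \<Rightarrow> 't"
  PArr :: "'a \<Rightarrow> 'b"
  HomOver :: "'o \<Rightarrow> 'o \<Rightarrow> 'b \<Rightarrow> 'a monoid"

definition fibre :: "('t, 'b) cat \<Rightarrow> ('o, 'a, 't, 'b) fcat \<Rightarrow> 't \<Rightarrow> ('o, 'a) gcat" where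
  "fibre C F T =
     \<lparr>Obj = {x \<in> Obj F. PObj F x = T}, Arr = {a \<in> Arr F. PArr F a = Ident C T},
      Dom = Dom F, Cod = Cod F, Ident = Ident F, Cmp = Cmp F,
      HomGrp = (\<lambda>x y. HomOver F x y (Ident C T))\<rparr>"

definition cocartesian :: "('t, 'b) cat \<Rightarrow> ('o, 'a, 't, 'b) fcat \<Rightarrow> 'a \<Rightarrow> bool" where
  "cocartesian C F a\<^sub>1 \<longleftrightarrow> a\<^sub>1 \<in> Arr F \<and>
     (\<forall>a\<^sub>2 \<in> Arr F. Dom F a\<^sub>2 = Dom F a\<^sub>1 \<longrightarrow>
        (\<forall>f \<in> Hom C (PObj F (Cod F a\<^sub>1)) (PObj F (Cod F a\<^sub>2)).
           f \<cdot>\<^bsub>C\<^esub> PArr F a\<^sub>1 = PArr F a\<^sub>2 \<longrightarrow>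
           (\<exists>!u. u \<in> Hom F (Cod F a\<^sub>1) (Cod F a\<^sub>2) \<and> PArr F u = f \<and> u \<cdot>\<^bsub>F\<^esub> a\<^sub>1 = a\<^sub>2)))"

definition fibred :: "('t, 'b) cat \<Rightarrow> ('o, 'a, 't, 'b) fcat \<Rightarrow> bool" where
  "fibred C F \<longleftrightarrow> category C \<and> category F \<and> cat_functor F C (PObj F) (PArr F) \<and>
     (\<forall>f \<in> Arr C. \<forall>x \<in> Obj F. PObj F x = Dom C f \<longrightarrow>
        (\<exists>a. cocartesian C F a \<and> Dom F a = x \<and> PArr F a = f))"

definition bilinear_Hom :: "('t, 'b) cat \<Rightarrow> ('o, 'a, 't, 'b) fcat \<Rightarrow> bool" where
  "bilinear_Hom C F \<longleftrightarrow>
     (\<forall>x \<in> Obj F. \<forall>y \<in> Obj F. \<forall>f \<in> Hom C (PObj F x) (PObj F y).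
        comm_group (HomOver F x y f) \<and>
        carrier (HomOver F x y f) = {a \<in> Hom F x y. PArr F a = f}) \<and>
     (\<forall>x \<in> Obj F. \<forall>y \<in> Obj F. \<forall>z \<in> Obj F.
      \<forall>f \<in> Hom C (PObj F x) (PObj F y). \<forall>g \<in> Hom C (PObj F y) (PObj F z).
        (\<forall>b \<in> carrier (HomOver F y z g).
           (\<lambda>a. b \<cdot>\<^bsub>F\<^esub> a) \<in> hom (HomOver F x y f) (HomOver F x z (g \<cdot>\<^bsub>C\<^esub> f))) \<and>
        (\<forall>a \<in> carrier (HomOver F x y f).
           (\<lambda>b. b \<cdot>\<^bsub>F\<^esub> a) \<in> hom (HomOver F y z g) (HomOver F x z (g \<cdot>\<^bsub>C\<^esub> f))))"

definition fibred_additive :: "('t, 'b) cat \<Rightarrow> ('o, 'a, 't, 'b) fcat \<Rightarrow> bool" where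
  "fibred_additive C F \<longleftrightarrow> fibred C F \<and> bilinear_Hom C F \<and>
     (\<forall>T \<in> Obj C. additive_category (fibre C F T))"

definition fibred_abelian :: "('t, 'b) cat \<Rightarrow> ('o, 'a, 't, 'b) fcat \<Rightarrow> bool" where
  "fibred_abelian C F \<longleftrightarrow> fibred C F \<and> bilinear_Hom C F \<and>
     (\<forall>T \<in> Obj C. abelian_category (fibre C F T))"

definition fibred_morphism ::
  "('t, 'b) cat \<Rightarrow> ('o, 'a, 't, 'b) fcat \<Rightarrow> ('p, 'c, 't, 'b) fcat
     \<Rightarrow> ('o \<Rightarrow> 'p) \<Rightarrow> ('a \<Rightarrow> 'c) \<Rightarrow> bool" where
  "fibred_morphism C F G Ho Ha \<longleftrightarrow>
     cat_functor F G Ho Ha \<and>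
     (\<forall>x \<in> Obj F. PObj G (Ho x) = PObj F x) \<and>
     (\<forall>a \<in> Arr F. PArr G (Ha a) = PArr F a) \<and>
     (\<forall>a. cocartesian C F a \<longrightarrow> cocartesian C G (Ha a)) \<and>
     (\<forall>x \<in> Obj F. \<forall>y \<in> Obj F. \<forall>f \<in> Hom C (PObj F x) (PObj F y).
        Ha \<in> hom (HomOver F x y f) (HomOver G (Ho x) (Ho y) f))"

text \<open>Subcategories are full and closed under isomorphism.  The identity maps being a functor
  from \<open>X\<close> to \<open>A\<close> yields \<open>Obj X \<subseteq> Obj A\<close>, \<open>Hom X x y \<subseteq> Hom A x y\<close>
  and the agreement of identities and composition.\<close>

definition inclusion_morphism ::
  "('t, 'b) cat \<Rightarrow> ('o, 'a, 't, 'b) fcat \<Rightarrow> ('o, 'a, 't, 'b) fcat \<Rightarrow> bool" where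
  "inclusion_morphism C X A \<longleftrightarrow>
     fibred_morphism C X A (\<lambda>x. x) (\<lambda>a. a) \<and>
     (\<forall>x \<in> Obj X. \<forall>y \<in> Obj X. Hom A x y \<subseteq> Hom X x y) \<and>
     (\<forall>a. iso_arrow A a \<and> Dom A a \<in> Obj X \<longrightarrow> Cod A a \<in> Obj X)"


section \<open>Base change\<close>

text \<open>The diagram \<open>bs\<close> in the fibre over \<open>T'\<close> is a base change by \<open>f : T \<rightarrow> T'\<close> of the
  diagram \<open>as\<close> in the fibre over \<open>T\<close>.  The list \<open>cs\<close> consists of the cocartesian arrows
  exhibiting the objects of \<open>bs\<close> as base changes of the objects of \<open>as\<close>, so it is one
  longer than \<open>as\<close>.\<close>

definition base_change ::
  "('t, 'b) cat \<Rightarrow> ('o, 'a, 't, 'b) fcat \<Rightarrow> 'b \<Rightarrow> 'a list \<Rightarrow> 'a list \<Rightarrow> bool" where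
  "base_change C F f as bs \<longleftrightarrow>
     f \<in> Arr C \<and> chain (fibre C F (Dom C f)) as \<and> chain (fibre C F (Cod C f)) bs \<and>
     length bs = length as \<and>
     (\<exists>cs. length cs = Suc (length as) \<and>
        (\<forall>c \<in> set cs. cocartesian C F c \<and> PArr F c = f) \<and>
        (\<forall>i < length as.
           cs ! i \<in> Hom F (Dom F (as ! i)) (Dom F (bs ! i)) \<and>
           cs ! Suc i \<in> Hom F (Cod F (as ! i)) (Cod F (bs ! i)) \<and>
           bs ! i \<cdot>\<^bsub>F\<^esub> cs ! i = cs ! Suc i \<cdot>\<^bsub>F\<^esub> as ! i))"

definition BC1 :: "('t, 'b) cat \<Rightarrow> ('o, 'a, 't, 'b) fcat \<Rightarrow> 't \<Rightarrow> bool" where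
  "BC1 C A T \<longleftrightarrow>
     (\<forall>a. epi_arrow (fibre C A T) a \<longrightarrow>
        (\<forall>T' \<in> Obj C. \<forall>f \<in> Hom C T T'. \<forall>b. base_change C A f [a] [b] \<longrightarrow>
           epi_arrow (fibre C A T') b))"

text \<open>A diagram over \<open>T\<close> is preserved when all its base changes are exact.\<close>

definition preserved_exact ::
  "('t, 'b) cat \<Rightarrow> ('o, 'a, 't, 'b) fcat \<Rightarrow> 't \<Rightarrow> 'a list \<Rightarrow> bool" where
  "preserved_exact C A T as \<longleftrightarrow>
     (\<forall>T' \<in> Obj C. \<forall>f \<in> Hom C T T'. \<forall>bs. base_change C A f as bs \<longrightarrow>
        exact_sequence (fibre C A T') bs)"

definition BC2 ::
  "('t, 'b) cat \<Rightarrow> ('o, 'a, 't, 'b) fcat \<Rightarrow> ('o, 'a, 't, 'b) fcat \<Rightarrow> 't \<Rightarrow> bool" where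
  "BC2 C A X T \<longleftrightarrow>
     (\<forall>i p. short_exact (fibre C A T) i p \<and> Cod A p \<in> Obj (fibre C X T) \<longrightarrow>
        preserved_exact C A T [i, p])"

text \<open>The objects of \<open>A(T)\<close> with a finite resolution by objects of \<open>X(T)\<close> every base change of
  which is a resolution by objects of the respective fibre of \<open>X\<close>.\<close>

definition hat_fl ::
  "('t, 'b) cat \<Rightarrow> ('o, 'a, 't, 'b) fcat \<Rightarrow> ('o, 'a, 't, 'b) fcat \<Rightarrow> 't \<Rightarrow> 'o set" where
  "hat_fl C A X T =
     {N \<in> Obj (fibre C A T). \<exists>as.
        resolution (fibre C A T) (fibre C X T) as N \<and>
        (\<forall>T' \<in> Obj C. \<forall>f \<in> Hom C T T'. \<forall>bs. base_change C A f as bs \<longrightarrow>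
           resolution (fibre C A T') (fibre C X T') bs (Cod A (last bs)))}"

end

theory Submission imports Defs begin

text \<open>Everything rests on one diagram: a map of short exact sequences which is the identity on the
  cokernel and pushes \<open>i : x \<rightarrow> y\<close> out along \<open>a : x \<rightarrow> x'\<close>.  The middle arrow \<open>b : y \<rightarrow> y'\<close> then
  inherits the cokernel of \<open>a\<close> if \<open>a\<close> is mono and the kernel of \<open>a\<close> if \<open>a\<close> is epi.  A base change of the
  diagram is of the same form as soon as both rows stay exact, which BC2 guarantees when the
  cokernel lies in \<open>X\<close>; so the exactness of the new sequence is preserved as well.  BC1 lets
  one cut a preserved resolution into preserved short exact sequences, and one inducts on the
  length.  If the first syzygy \<open>K\<close> of \<open>N\<close> has a hull \<open>K \<rightarrow> L' \<rightarrow> M'\<close>, its pushout along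
  \<open>K \<rightarrow> M\<^sub>0\<close> is an approximation of \<open>N\<close>.  Given an approximation \<open>L \<rightarrow> M \<rightarrow> N\<close>, the pushout of
  the sequence of AB2 for \<open>M\<close> along \<open>M \<rightarrow> N\<close> is a hull of \<open>N\<close>.\<close>

section \<open>Short exact sequences in an abelian category\<close>

text \<open>BC2 speaks only of sequences that end in an object of \<open>X\<close>, whereas an
  approximation of \<open>N\<close> ends in \<open>N\<close>, and the sequence resolving a hull ends
  in the hull. Both are therefore obtained as columns of a diagram whose two rows end in the same
  object \<open>M'\<close> of \<open>X\<close>. The same diagrams give the memberships: the middle
  object of an approximation is an extension of \<open>M'\<close> by \<open>M\<^sub>0\<close>, hence
  in \<open>X\<close> by AB1, and the hull is a quotient of an object of \<open>D\<close> by
  \<open>L\<close>, so a preserved resolution of \<open>L\<close> grows by one term. Cutting a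
  resolution is not formal: after a base change the inclusion of a syzygy is not known to be mono.
  BC1 keeps the epi onto the syzygy, and exactness of the long sequence forces the rest. No cleavage
  is chosen, so base change is a relation; once the cocartesian arrows at the objects are fixed, it
  is single valued and respects composition and zero arrows.\<close>

lemma HomD:
  assumes "a \<in> Hom C x y"
  shows "a \<in> Arr C" "Dom C a = x" "Cod C a = y"
  using assms by (auto simp: Hom_def)

lemma (in category) Hom_Obj:
  assumes "a \<in> Hom C x y"
  shows "x \<in> Obj C" "y \<in> Obj C"
  using assms Dom_closed Cod_closed by (auto simp: Hom_def)

lemma Arr_Hom: "a \<in> Arr C \<Longrightarrow> a \<in> Hom C (Dom C a) (Cod C a)"
  by (simp add: Hom_def)

locale abelian =
  fixes A :: "('o, 'a, 'm) gcat_scheme" (structure)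
  assumes abelian: "abelian_category A"
begin

lemma preadd: "preadditive A"
  using abelian by (simp add: abelian_category_def additive_category_def)

sublocale category A
  using preadd by (simp add: preadditive_def)

abbreviation zero :: "'o \<Rightarrow> 'o \<Rightarrow> 'a" (\<open>\<zero>'(_,_')\<close>) where
  "\<zero>(x,y) \<equiv> zero_arrow A x y"

text \<open>Differences turn an equation of parallel arrows into the vanishing of one arrow, which
  is how monos and epis are tested below. The group is read off from the ends of the first argument,
  which keeps objects out of the notation.\<close>

definition sub :: "'a \<Rightarrow> 'a \<Rightarrow> 'a" (infixl \<open>\<ominus>\<ominus>\<close> 65) where
  "a \<ominus>\<ominus> b = a \<otimes>\<^bsub>HomGrp A (Dom A a) (Cod A a)\<^esub> inv\<^bsub>HomGrp A (Dom A a) (Cod A a)\<^esub> b"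

lemma HomGrp:
  assumes "x \<in> Obj A" "y \<in> Obj A"
  shows "comm_group (HomGrp A x y)" "group (HomGrp A x y)" "carrier (HomGrp A x y) = Hom A x y"
  using preadd assms by (auto simp: preadditive_def comm_group.axioms)

lemma comp_left_hom:
  assumes "b \<in> Hom A y z" "x \<in> Obj A"
  shows "group_hom (HomGrp A x y) (HomGrp A x z) (\<lambda>a. b \<cdot> a)"
  using preadd assms HomGrp Hom_Obj[OF assms(1)]
  by (auto simp: preadditive_def group_hom_def group_hom_axioms_def)

lemma comp_right_hom:
  assumes "a \<in> Hom A x y" "z \<in> Obj A"
  shows "group_hom (HomGrp A y z) (HomGrp A x z) (\<lambda>b. b \<cdot> a)"
  using preadd assms HomGrp Hom_Obj[OF assms(1)]
  by (auto simp: preadditive_def group_hom_def group_hom_axioms_def)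

lemma zero_Hom: "x \<in> Obj A \<Longrightarrow> y \<in> Obj A \<Longrightarrow> \<zero>(x,y) \<in> Hom A x y"
  using HomGrp[of x y] by (metis group.is_monoid monoid.one_closed)

lemma comp_zero: "b \<in> Hom A y z \<Longrightarrow> x \<in> Obj A \<Longrightarrow> b \<cdot> \<zero>(x,y) = \<zero>(x,z)"
  using group_hom.hom_one[OF comp_left_hom] by simp

lemma zero_comp: "a \<in> Hom A x y \<Longrightarrow> z \<in> Obj A \<Longrightarrow> \<zero>(y,z) \<cdot> a = \<zero>(x,z)"
  using group_hom.hom_one[OF comp_right_hom] by simp

lemma sub_Hom: "a \<in> Hom A x y \<Longrightarrow> b \<in> Hom A x y \<Longrightarrow> a \<ominus>\<ominus> b \<in> Hom A x y"
  using HomGrp[of x y] Hom_Obj[of a x y] unfolding sub_def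
  by (metis HomD(2,3) group.inv_closed group.is_monoid monoid.m_closed)

lemma sub_eq_zero_iff:
  assumes "a \<in> Hom A x y" "b \<in> Hom A x y"
  shows "a \<ominus>\<ominus> b = \<zero>(x,y) \<longleftrightarrow> a = b"
proof -
  interpret group "HomGrp A x y" using HomGrp Hom_Obj[OF assms(1)] by blast
  show ?thesis using assms HomGrp(3) Hom_Obj[OF assms(1)] HomD[OF assms(1)]
    by (simp add: sub_def) (metis inv_equality inv_inv inv_closed r_inv)
qed

lemma sub_zero:
  assumes "a \<in> Hom A x y" shows "a \<ominus>\<ominus> \<zero>(x,y) = a"
proof -
  interpret group "HomGrp A x y" using HomGrp Hom_Obj[OF assms(1)] by blast
  show ?thesis using assms HomGrp(3) Hom_Obj[OF assms(1)] HomD[OF assms(1)]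
    by (simp add: sub_def)
qed

lemma comp_sub:
  assumes "c \<in> Hom A y z" "a \<in> Hom A x y" "b \<in> Hom A x y"
  shows "c \<cdot> (a \<ominus>\<ominus> b) = c \<cdot> a \<ominus>\<ominus> c \<cdot> b"
proof -
  interpret group_hom "HomGrp A x y" "HomGrp A x z" "\<lambda>a. c \<cdot> a"
    using comp_left_hom[OF assms(1)] Hom_Obj[OF assms(2)] by blast
  have ab: "a \<in> carrier (HomGrp A x y)" "b \<in> carrier (HomGrp A x y)"
    using assms HomGrp(3) Hom_Obj[OF assms(2)] by auto
  show ?thesis
    using hom_mult[OF ab(1) G.inv_closed[OF ab(2)]] hom_inv[OF ab(2)]
      HomD[OF assms(2)] HomD[OF Cmp_Hom[OF assms(2,1)]]
    by (simp add: sub_def)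
qed

lemma sub_comp:
  assumes "c \<in> Hom A w x" "a \<in> Hom A x y" "b \<in> Hom A x y"
  shows "(a \<ominus>\<ominus> b) \<cdot> c = a \<cdot> c \<ominus>\<ominus> b \<cdot> c"
proof -
  interpret group_hom "HomGrp A x y" "HomGrp A w y" "\<lambda>a. a \<cdot> c"
    using comp_right_hom[OF assms(1)] Hom_Obj[OF assms(2)] by blast
  have ab: "a \<in> carrier (HomGrp A x y)" "b \<in> carrier (HomGrp A x y)"
    using assms HomGrp(3) Hom_Obj[OF assms(2)] by auto
  show ?thesis
    using hom_mult[OF ab(1) G.inv_closed[OF ab(2)]] hom_inv[OF ab(2)]
      HomD[OF assms(2)] HomD[OF Cmp_Hom[OF assms(1,2)]]
    by (simp add: sub_def)
qed

section \<open>Monos, epis, kernels and cokernels\<close>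

lemma mono_cancel:
  assumes "mono_arrow A a" "a \<in> Hom A x y" "u \<in> Hom A w x" "v \<in> Hom A w x" "a \<cdot> u = a \<cdot> v"
  shows "u = v"
  using assms Hom_Obj[OF assms(3)] HomD[OF assms(2)] unfolding mono_arrow_def by blast

lemma epi_cancel:
  assumes "epi_arrow A a" "a \<in> Hom A x y" "u \<in> Hom A y w" "v \<in> Hom A y w" "u \<cdot> a = v \<cdot> a"
  shows "u = v"
  using assms Hom_Obj[OF assms(3)] HomD[OF assms(2)] unfolding epi_arrow_def by blast

lemma mono_zero:
  assumes "mono_arrow A a" "a \<in> Hom A x y" "u \<in> Hom A w x" "a \<cdot> u = \<zero>(w,y)"
  shows "u = \<zero>(w,x)"
  using mono_cancel[OF assms(1,2,3) zero_Hom] assms(4) comp_zero[OF assms(2)]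
    Hom_Obj[OF assms(3)] by simp

lemma epi_zero:
  assumes "epi_arrow A a" "a \<in> Hom A x y" "u \<in> Hom A y w" "u \<cdot> a = \<zero>(x,w)"
  shows "u = \<zero>(y,w)"
  using epi_cancel[OF assms(1,2,3) zero_Hom] assms(4) zero_comp[OF assms(2)]
    Hom_Obj[OF assms(3)] by simp

lemma monoI:
  assumes a: "a \<in> Hom A x y"
    and z: "\<And>w u. u \<in> Hom A w x \<Longrightarrow> a \<cdot> u = \<zero>(w,y) \<Longrightarrow> u = \<zero>(w,x)"
  shows "mono_arrow A a"
  unfolding mono_arrow_def HomD[OF a]
proof (intro conjI ballI impI)
  fix w u v assume *: "u \<in> Hom A w x" "v \<in> Hom A w x" "a \<cdot> u = a \<cdot> v"
  then have "a \<cdot> (u \<ominus>\<ominus> v) = \<zero>(w,y)"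
    using comp_sub[OF a *(1,2)] sub_eq_zero_iff Cmp_Hom[OF _ a] by simp
  then show "u = v" using z sub_Hom sub_eq_zero_iff * by blast
qed (rule HomD[OF a])

lemma epiI:
  assumes a: "a \<in> Hom A x y"
    and z: "\<And>w u. u \<in> Hom A y w \<Longrightarrow> u \<cdot> a = \<zero>(x,w) \<Longrightarrow> u = \<zero>(y,w)"
  shows "epi_arrow A a"
  unfolding epi_arrow_def HomD[OF a]
proof (intro conjI ballI impI)
  fix w u v assume *: "u \<in> Hom A y w" "v \<in> Hom A y w" "u \<cdot> a = v \<cdot> a"
  then have "(u \<ominus>\<ominus> v) \<cdot> a = \<zero>(x,w)"
    using sub_comp[OF a *(1,2)] sub_eq_zero_iff Cmp_Hom[OF a] by simp
  then show "u = v" using z sub_Hom sub_eq_zero_iff * by blast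
qed (rule HomD[OF a])

lemma mono_comp_mono:
  assumes "mono_arrow A (b \<cdot> a)" "a \<in> Hom A x y" "b \<in> Hom A y z"
  shows "mono_arrow A a"
proof (rule monoI[OF assms(2)])
  fix w u assume u: "u \<in> Hom A w x" "a \<cdot> u = \<zero>(w,y)"
  then have "(b \<cdot> a) \<cdot> u = \<zero>(w,z)"
    using Cmp_assoc[OF u(1) assms(2,3)] comp_zero[OF assms(3)] Hom_Obj[OF u(1)] by simp
  then show "u = \<zero>(w,x)" using mono_zero[OF assms(1) Cmp_Hom[OF assms(2,3)] u(1)] by simp
qed

lemma epi_comp_epi:
  assumes "epi_arrow A (b \<cdot> a)" "a \<in> Hom A x y" "b \<in> Hom A y z"
  shows "epi_arrow A b"
proof (rule epiI[OF assms(3)])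
  fix w u assume u: "u \<in> Hom A z w" "u \<cdot> b = \<zero>(y,w)"
  then have "u \<cdot> (b \<cdot> a) = \<zero>(x,w)"
    using Cmp_assoc[OF assms(2,3) u(1)] zero_comp[OF assms(2)] Hom_Obj[OF u(1)] by simp
  then show "u = \<zero>(z,w)" using epi_zero[OF assms(1) Cmp_Hom[OF assms(2,3)] u(1)] by simp
qed

lemma comp_mono:
  assumes "mono_arrow A a" "mono_arrow A b" "a \<in> Hom A x y" "b \<in> Hom A y z"
  shows "mono_arrow A (b \<cdot> a)"
proof (rule monoI[OF Cmp_Hom[OF assms(3,4)]])
  fix w u assume u: "u \<in> Hom A w x" "b \<cdot> a \<cdot> u = \<zero>(w,z)"
  then have "a \<cdot> u = \<zero>(w,y)"
    using Cmp_assoc[OF u(1) assms(3,4)] mono_zero[OF assms(2,4) Cmp_Hom[OF u(1) assms(3)]] by simp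
  then show "u = \<zero>(w,x)" using mono_zero[OF assms(1,3) u(1)] by simp
qed

lemma is_kernelI:
  assumes "a \<in> Hom A y z" "k \<in> Hom A x y" "a \<cdot> k = \<zero>(x,z)" "mono_arrow A k"
    and "\<And>w h. h \<in> Hom A w y \<Longrightarrow> a \<cdot> h = \<zero>(w,z) \<Longrightarrow> \<exists>u \<in> Hom A w x. k \<cdot> u = h"
  shows "is_kernel A a k"
  unfolding is_kernel_def HomD[OF assms(1)] HomD[OF assms(2)]
proof (intro conjI ballI impI)
  fix h assume h: "h \<in> Arr A" "Cod A h = y \<and> a \<cdot> h = \<zero>(Dom A h,z)"
  then obtain u where "u \<in> Hom A (Dom A h) x" "k \<cdot> u = h"
    using assms(5) by (auto simp: Hom_def)
  then show "\<exists>!u. u \<in> Hom A (Dom A h) x \<and> k \<cdot> u = h"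
    using mono_cancel[OF assms(4,2)] by metis
qed (use assms HomD in \<open>auto simp: Hom_def\<close>)

lemma is_cokernelI:
  assumes "a \<in> Hom A x y" "c \<in> Hom A y z" "c \<cdot> a = \<zero>(x,z)" "epi_arrow A c"
    and "\<And>w h. h \<in> Hom A y w \<Longrightarrow> h \<cdot> a = \<zero>(x,w) \<Longrightarrow> \<exists>u \<in> Hom A z w. u \<cdot> c = h"
  shows "is_cokernel A a c"
  unfolding is_cokernel_def HomD[OF assms(1)] HomD[OF assms(2)]
proof (intro conjI ballI impI)
  fix h assume h: "h \<in> Arr A" "Dom A h = y \<and> h \<cdot> a = \<zero>(x,Cod A h)"
  then obtain u where "u \<in> Hom A z (Cod A h)" "u \<cdot> c = h"
    using assms(5) by (auto simp: Hom_def)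
  then show "\<exists>!u. u \<in> Hom A z (Cod A h) \<and> u \<cdot> c = h"
    using epi_cancel[OF assms(4,2)] by metis
qed (use assms HomD in \<open>auto simp: Hom_def\<close>)

lemma is_kernel_Hom:
  assumes "is_kernel A a k"
  shows "a \<in> Hom A (Cod A k) (Cod A a)" "k \<in> Hom A (Dom A k) (Cod A k)"
    "a \<cdot> k = \<zero>(Dom A k,Cod A a)"
  using assms by (auto simp: is_kernel_def Hom_def)

lemma is_cokernel_Hom:
  assumes "is_cokernel A a c"
  shows "a \<in> Hom A (Dom A a) (Cod A a)" "c \<in> Hom A (Cod A a) (Cod A c)"
    "c \<cdot> a = \<zero>(Dom A a,Cod A c)"
  using assms by (auto simp: is_cokernel_def Hom_def)

lemma is_kernel_lift:
  assumes "is_kernel A a k" "k \<in> Hom A x y" "h \<in> Hom A w y" "a \<cdot> h = \<zero>(w,Cod A a)"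
  obtains u where "u \<in> Hom A w x" "k \<cdot> u = h"
  using assms HomD[OF assms(2)] HomD[OF assms(3)] unfolding is_kernel_def by metis

lemma is_cokernel_desc:
  assumes "is_cokernel A a c" "c \<in> Hom A y z" "h \<in> Hom A y w" "h \<cdot> a = \<zero>(Dom A a,w)"
  obtains u where "u \<in> Hom A z w" "u \<cdot> c = h"
  using assms HomD[OF assms(2)] HomD[OF assms(3)] unfolding is_cokernel_def by metis

lemma is_kernel_mono:
  assumes "is_kernel A a k" shows "mono_arrow A k"
proof (rule monoI[OF is_kernel_Hom(2)[OF assms]])
  note k = is_kernel_Hom[OF assms]
  fix w u assume u: "u \<in> Hom A w (Dom A k)" "k \<cdot> u = \<zero>(w,Cod A k)"
  have w: "w \<in> Obj A" "Dom A k \<in> Obj A" using Hom_Obj[OF u(1)] by auto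
  have 0: "\<zero>(w,Cod A k) \<in> Hom A w (Cod A k)" using zero_Hom w Hom_Obj[OF k(1)] by blast
  have "a \<cdot> \<zero>(w,Cod A k) = \<zero>(w,Cod A a)" using comp_zero[OF k(1)] w by simp
  then have "\<exists>!u. u \<in> Hom A w (Dom A k) \<and> k \<cdot> u = \<zero>(w,Cod A k)"
    using assms HomD[OF 0] unfolding is_kernel_def by metis
  then show "u = \<zero>(w,Dom A k)" using u comp_zero[OF k(2)] zero_Hom w by blast
qed

lemma is_cokernel_epi:
  assumes "is_cokernel A a c" shows "epi_arrow A c"
proof (rule epiI[OF is_cokernel_Hom(2)[OF assms]])
  note c = is_cokernel_Hom[OF assms]
  fix w u assume u: "u \<in> Hom A (Cod A c) w" "u \<cdot> c = \<zero>(Cod A a,w)"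
  have w: "w \<in> Obj A" "Cod A c \<in> Obj A" using Hom_Obj[OF u(1)] by auto
  have 0: "\<zero>(Cod A a,w) \<in> Hom A (Cod A a) w" using zero_Hom w Hom_Obj[OF c(1)] by blast
  have "\<zero>(Cod A a,w) \<cdot> a = \<zero>(Dom A a,w)" using zero_comp[OF c(1)] w by simp
  then have "\<exists>!u. u \<in> Hom A (Cod A c) w \<and> u \<cdot> c = \<zero>(Cod A a,w)"
    using assms HomD[OF 0] unfolding is_cokernel_def by metis
  then show "u = \<zero>(Cod A c,w)" using u zero_comp[OF c(2)] zero_Hom w by blast
qed

text \<open>The mono \<open>a\<close> is a kernel of some \<open>b\<close>, and \<open>b\<close>
  factors through the cokernel \<open>c\<close>. So whatever \<open>c\<close> kills is killed by
  \<open>b\<close> and lifts along \<open>a\<close>.\<close>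

lemma mono_is_kernel_of_cokernel:
  assumes "mono_arrow A a" "is_cokernel A a c"
  shows "is_kernel A c a"
proof (rule is_kernelI[OF is_cokernel_Hom(2,1,3)[OF assms(2)] assms(1)])
  note c = is_cokernel_Hom[OF assms(2)]
  obtain b where b: "is_kernel A b a" using assms(1) abelian by (auto simp: abelian_category_def)
  note b' = is_kernel_Hom[OF b]
  obtain t where t: "t \<in> Hom A (Cod A c) (Cod A b)" "t \<cdot> c = b"
    using is_cokernel_desc[OF assms(2) c(2) b'(1,3)] .
  fix w h assume h: "h \<in> Hom A w (Cod A a)" "c \<cdot> h = \<zero>(w,Cod A c)"
  then have "b \<cdot> h = \<zero>(w,Cod A b)"
    using Cmp_assoc[OF h(1) c(2) t(1)] t(2) comp_zero[OF t(1)] Hom_Obj[OF h(1)] by simp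
  then show "\<exists>u\<in>Hom A w (Dom A a). a \<cdot> u = h"
    using is_kernel_lift[OF b b'(2) h(1)] by blast
qed

text \<open>Dually, \<open>a\<close> is a cokernel of some \<open>b\<close>, which factors through
  the kernel \<open>k\<close>; an arrow killing \<open>k\<close> kills \<open>b\<close> and descends
  along \<open>a\<close>.\<close>

lemma epi_is_cokernel_of_kernel:
  assumes "epi_arrow A a" "is_kernel A a k"
  shows "is_cokernel A k a"
proof (rule is_cokernelI[OF is_kernel_Hom(2,1,3)[OF assms(2)] assms(1)])
  note k = is_kernel_Hom[OF assms(2)]
  obtain b where b: "is_cokernel A b a" using assms(1) abelian by (auto simp: abelian_category_def)
  note b' = is_cokernel_Hom[OF b]
  have dom: "Dom A a = Cod A k" "Cod A b = Cod A k" using b assms(2)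
    by (auto simp: is_kernel_def is_cokernel_def)
  obtain t where t: "t \<in> Hom A (Dom A b) (Dom A k)" "k \<cdot> t = b"
    using is_kernel_lift[OF assms(2) k(2), of b "Dom A b"] b' dom by metis
  fix w h assume h: "h \<in> Hom A (Cod A k) w" "h \<cdot> k = \<zero>(Dom A k,w)"
  then have "h \<cdot> b = \<zero>(Dom A b,w)"
    using Cmp_assoc[OF t(1) k(2) h(1)] t(2) zero_comp[OF t(1)] Hom_Obj[OF h(1)] by simp
  then show "\<exists>u\<in>Hom A (Cod A a) w. u \<cdot> a = h"
    using is_cokernel_desc[OF b _ h(1)] b'(2) dom by metis
qed

lemma kernel_exists:
  assumes "a \<in> Hom A y z"
  obtains x k where "k \<in> Hom A x y" "is_kernel A a k"
  using assms abelian unfolding abelian_category_def is_kernel_def Hom_def by blast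

lemma cokernel_exists:
  assumes "a \<in> Hom A x y"
  obtains z c where "c \<in> Hom A y z" "is_cokernel A a c"
  using assms abelian unfolding abelian_category_def is_cokernel_def Hom_def by blast

text \<open>Removes the image from the definition of exactness: \<open>i\<close> and the image
  \<open>m\<close> are both kernels of the cokernel \<open>c\<close> of \<open>i\<close>, and
  \<open>m\<close> is also a kernel of \<open>p\<close>, so \<open>i\<close> is one too. The epi
  \<open>p\<close> is then the cokernel of its kernel.\<close>

lemma short_exact_iff: "short_exact A i p \<longleftrightarrow> is_kernel A p i \<and> is_cokernel A i p"
proof
  assume *: "short_exact A i p"
  then have i: "mono_arrow A i" and p: "epi_arrow A p" and "exact_pair A i p"
    by (auto simp: exact_sequence_def)
  then obtain c m where c: "is_cokernel A i c" "is_kernel A c m" "is_kernel A p m"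
    by (auto simp: exact_pair_def is_image_def)
  note ci = is_cokernel_Hom[OF c(1)] and cm = is_kernel_Hom[OF c(2)] and pm = is_kernel_Hom[OF c(3)]
  have cod: "Cod A m = Cod A i" using c by (auto simp: is_cokernel_def is_kernel_def)
  obtain e where e: "e \<in> Hom A (Dom A i) (Dom A m)" "m \<cdot> e = i"
    using is_kernel_lift[OF c(2) cm(2), of i "Dom A i"] ci cod by metis
  have "is_kernel A p i"
  proof (rule is_kernelI)
    show "p \<in> Hom A (Cod A i) (Cod A p)" using pm cod by simp
    show "i \<in> Hom A (Dom A i) (Cod A i)" using ci by simp
    show "p \<cdot> i = \<zero>(Dom A i,Cod A p)"
      using Cmp_assoc[OF e(1) pm(2,1)] e(2) zero_comp[OF e(1)] pm Hom_Obj[OF pm(1)] by simp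
    show "mono_arrow A i" by fact
    fix w h assume h: "h \<in> Hom A w (Cod A i)" "p \<cdot> h = \<zero>(w,Cod A p)"
    obtain u where u: "u \<in> Hom A w (Dom A m)" "m \<cdot> u = h"
      using is_kernel_lift[OF c(3) pm(2) _ h(2)] h cod by metis
    have "c \<cdot> h = \<zero>(w,Cod A c)"
      using Cmp_assoc[OF u(1) cm(2,1)] u(2) zero_comp[OF u(1)] cm Hom_Obj[OF cm(1)] by simp
    then show "\<exists>u\<in>Hom A w (Dom A i). i \<cdot> u = h"
      using is_kernel_lift[OF mono_is_kernel_of_cokernel[OF i c(1)] ci(1) h(1)] by metis
  qed
  then show "is_kernel A p i \<and> is_cokernel A i p"
    using epi_is_cokernel_of_kernel[OF p] by blast
next
  assume *: "is_kernel A p i \<and> is_cokernel A i p"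
  then show "short_exact A i p"
    using is_kernel_mono[of p i] is_cokernel_epi[of i p] is_kernel_Hom[of p i]
    unfolding exact_sequence_def exact_pair_def is_image_def chain_def
    by (auto simp: Hom_def less_Suc_eq)
qed

lemma short_exactD:
  assumes "short_exact A i p" "i \<in> Hom A x y" "p \<in> Hom A y z"
  shows "mono_arrow A i" "epi_arrow A p" "is_kernel A p i" "is_cokernel A i p" "p \<cdot> i = \<zero>(x,z)"
  using assms is_kernel_mono is_cokernel_epi is_kernel_Hom[of p i] HomD[OF assms(2)] HomD[OF assms(3)]
  by (auto simp: short_exact_iff)

lemma short_exact_Hom:
  assumes "short_exact A i p"
  shows "i \<in> Hom A (Dom A i) (Cod A i)" "p \<in> Hom A (Cod A i) (Cod A p)"
  using assms is_kernel_Hom[of p i] by (auto simp: short_exact_iff)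

lemma short_exact_lift:
  assumes "short_exact A i p" "i \<in> Hom A x y" "p \<in> Hom A y z" "h \<in> Hom A w y" "p \<cdot> h = \<zero>(w,z)"
  obtains u where "u \<in> Hom A w x" "i \<cdot> u = h"
  using is_kernel_lift[OF short_exactD(3)[OF assms(1-3)] assms(2,4)] assms(5) HomD[OF assms(3)]
  by metis

lemma short_exact_desc:
  assumes "short_exact A i p" "i \<in> Hom A x y" "p \<in> Hom A y z" "h \<in> Hom A y w" "h \<cdot> i = \<zero>(x,w)"
  obtains u where "u \<in> Hom A z w" "u \<cdot> p = h"
  using is_cokernel_desc[OF short_exactD(4)[OF assms(1-3)] assms(3,4)] assms(5) HomD[OF assms(2)]
  by metis

lemma short_exactI_mono:
  assumes "mono_arrow A i" "is_cokernel A i p" shows "short_exact A i p"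
  using assms mono_is_kernel_of_cokernel by (simp add: short_exact_iff)

lemma short_exactI_epi:
  assumes "epi_arrow A p" "is_kernel A p i" shows "short_exact A i p"
  using assms epi_is_cokernel_of_kernel by (simp add: short_exact_iff)

section \<open>Pushouts of short exact sequences\<close>

lemma sub_left_cancel:
  assumes "a \<in> Hom A x y" "b \<in> Hom A x y" "c \<in> Hom A x y" "c \<ominus>\<ominus> a = c \<ominus>\<ominus> b"
  shows "a = b"
proof -
  interpret group "HomGrp A x y" using HomGrp Hom_Obj[OF assms(1)] by blast
  have "a \<in> carrier (HomGrp A x y)" "b \<in> carrier (HomGrp A x y)" "c \<in> carrier (HomGrp A x y)"
    using assms HomGrp(3) Hom_Obj[OF assms(1)] by auto
  then show ?thesis
    using assms(4) HomD[OF assms(3)] by (simp add: sub_def) (metis inv_inv)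
qed

lemma biproduct_exists:
  assumes "x \<in> Obj A" "y \<in> Obj A"
  obtains s i\<^sub>1 i\<^sub>2 p\<^sub>1 p\<^sub>2 where "biproduct A x y s i\<^sub>1 i\<^sub>2 p\<^sub>1 p\<^sub>2"
  using abelian assms unfolding abelian_category_def additive_category_def by blast

text \<open>\<open>y'\<close> is the cokernel of the arrow \<open>f\<close> with components
  \<open>i\<close> and \<open>-a\<close> into the biproduct of \<open>y\<close> and
  \<open>x'\<close>. As \<open>i\<close> is mono, so is \<open>f\<close>, hence \<open>f\<close> is
  the kernel of its own cokernel; this is why \<open>i'\<close> is mono again. The arrow
  \<open>p'\<close> is induced by \<open>p\<close> on \<open>y\<close> and zero on
  \<open>x'\<close>.\<close>

lemma pushout_short_exact:
  assumes ses: "short_exact A i p" and i: "i \<in> Hom A x y" and p: "p \<in> Hom A y z"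
    and a: "a \<in> Hom A x x'"
  obtains y' i' p' b where "short_exact A i' p'" "i' \<in> Hom A x' y'" "p' \<in> Hom A y' z"
    "b \<in> Hom A y y'" "b \<cdot> i = i' \<cdot> a" "p' \<cdot> b = p"
proof -
  note E = short_exactD[OF ses i p]
  have obj: "x \<in> Obj A" "y \<in> Obj A" "z \<in> Obj A" "x' \<in> Obj A"
    using Hom_Obj[OF i] Hom_Obj[OF p] Hom_Obj[OF a] by auto
  obtain s i\<^sub>1 i\<^sub>2 p\<^sub>1 p\<^sub>2 where bp: "biproduct A y x' s i\<^sub>1 i\<^sub>2 p\<^sub>1 p\<^sub>2"
    using biproduct_exists obj by blast
  then have s: "s \<in> Obj A" "i\<^sub>1 \<in> Hom A y s" "i\<^sub>2 \<in> Hom A x' s" "p\<^sub>1 \<in> Hom A s y" "p\<^sub>2 \<in> Hom A s x'"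
    "p\<^sub>1 \<cdot> i\<^sub>1 = Ident A y" "p\<^sub>2 \<cdot> i\<^sub>2 = Ident A x'" "p\<^sub>2 \<cdot> i\<^sub>1 = \<zero>(y,x')" "p\<^sub>1 \<cdot> i\<^sub>2 = \<zero>(x',y)"
    by (auto simp: biproduct_def)
  define f where "f = i\<^sub>1 \<cdot> i \<ominus>\<ominus> i\<^sub>2 \<cdot> a"
  have ii: "i\<^sub>1 \<cdot> i \<in> Hom A x s" "i\<^sub>2 \<cdot> a \<in> Hom A x s"
    using Cmp_Hom i a s by auto
  have f: "f \<in> Hom A x s" unfolding f_def using sub_Hom ii by blast
  have p1f: "p\<^sub>1 \<cdot> f = i"
  proof -
    have "p\<^sub>1 \<cdot> f = i \<ominus>\<ominus> \<zero>(x,y)"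
      unfolding f_def comp_sub[OF s(4) ii]
      using Cmp_assoc[OF i s(2,4)] Cmp_assoc[OF a s(3,4)] s Cmp_Ident_left[OF i] zero_comp[OF a]
        obj by simp
    then show ?thesis using sub_zero[OF i] by simp
  qed
  have p2f: "\<zero>(x,x') \<ominus>\<ominus> a = p\<^sub>2 \<cdot> f"
    unfolding f_def comp_sub[OF s(5) ii]
    using Cmp_assoc[OF i s(2,5)] Cmp_assoc[OF a s(3,5)] s Cmp_Ident_left[OF a] zero_comp[OF i]
      obj by simp
  have fm: "mono_arrow A f" using mono_comp_mono[OF _ f s(4)] p1f E by simp
  obtain y' c where c: "c \<in> Hom A s y'" "is_cokernel A f c" using cokernel_exists[OF f] .
  have ce: "epi_arrow A c" and ck: "is_kernel A c f"
    using is_cokernel_epi mono_is_kernel_of_cokernel c fm by blast+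
  have cf: "c \<cdot> f = \<zero>(x,y')"
    using is_cokernel_Hom[OF c(2)] HomD[OF f] HomD[OF c(1)] by simp
  define b i' where "b = c \<cdot> i\<^sub>1" and "i' = c \<cdot> i\<^sub>2"
  have b: "b \<in> Hom A y y'" and i': "i' \<in> Hom A x' y'" unfolding b_def i'_def
    using Cmp_Hom s c by auto
  have y': "y' \<in> Obj A" using Hom_Obj[OF b] by simp
  have sq: "b \<cdot> i = i' \<cdot> a"
  proof -
    have "b \<cdot> i \<ominus>\<ominus> i' \<cdot> a = c \<cdot> f"
      unfolding f_def comp_sub[OF c(1) ii] b_def i'_def
      using Cmp_assoc[OF i s(2) c(1)] Cmp_assoc[OF a s(3) c(1)] by simp
    then show ?thesis using cf sub_eq_zero_iff[OF Cmp_Hom[OF i b] Cmp_Hom[OF a i']] by simp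
  qed
  have pf: "(p \<cdot> p\<^sub>1) \<cdot> f = \<zero>(x,z)"
    using Cmp_assoc[OF f s(4) p] p1f E by simp
  obtain p' where p': "p' \<in> Hom A y' z" "p' \<cdot> c = p \<cdot> p\<^sub>1"
    using is_cokernel_desc[OF c(2,1) Cmp_Hom[OF s(4) p]] pf HomD[OF f] by metis
  have p'b: "p' \<cdot> b = p" unfolding b_def
    using Cmp_assoc[OF s(2) c(1) p'(1)] p' Cmp_assoc[OF s(2) s(4) p] s Cmp_Ident_right[OF p] by simp
  have p'i': "p' \<cdot> i' = \<zero>(x',z)" unfolding i'_def
    using Cmp_assoc[OF s(3) c(1) p'(1)] p' Cmp_assoc[OF s(3) s(4) p] s comp_zero[OF p] obj by simp
  have "mono_arrow A i'"
  proof (rule monoI[OF i'])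
    fix w u assume u: "u \<in> Hom A w x'" "i' \<cdot> u = \<zero>(w,y')"
    have w: "w \<in> Obj A" using Hom_Obj[OF u(1)] by simp
    \<comment> \<open>Being killed by \<open>c\<close>, this arrow comes from some \<open>v\<close>
      along the kernel \<open>f\<close>. Its component in \<open>y\<close> is zero, so
      \<open>i \<cdot> v\<close> vanishes, and \<open>v\<close> with it.\<close>
    have "c \<cdot> (i\<^sub>2 \<cdot> u) = \<zero>(w,Cod A c)"
      using u Cmp_assoc[OF u(1) s(3) c(1)] i'_def HomD[OF c(1)] by simp
    then obtain v where v: "v \<in> Hom A w x" "f \<cdot> v = i\<^sub>2 \<cdot> u"
      using is_kernel_lift[OF ck f Cmp_Hom[OF u(1) s(3)]] by blast
    have "i \<cdot> v = \<zero>(w,y)"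
      using p1f Cmp_assoc[OF v(1) f s(4)] v Cmp_assoc[OF u(1) s(3,4)] s zero_comp[OF u(1)] obj by simp
    then have "v = \<zero>(w,x)" using mono_zero[OF E(1) i v(1)] by simp
    then have "i\<^sub>2 \<cdot> u = \<zero>(w,s)" using v comp_zero[OF f] w by simp
    then show "u = \<zero>(w,x')"
      using Cmp_assoc[OF u(1) s(3,5)] s Cmp_Ident_left[OF u(1)] comp_zero[OF s(5)] w by simp
  qed
  moreover have "is_cokernel A i' p'"
  proof (rule is_cokernelI[OF i' p'(1) p'i'])
    show "epi_arrow A p'" using epi_comp_epi[OF _ b p'(1)] p'b E by simp
    fix w h assume h: "h \<in> Hom A y' w" "h \<cdot> i' = \<zero>(x',w)"
    have w: "w \<in> Obj A" using Hom_Obj[OF h(1)] by simp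
    have "(h \<cdot> b) \<cdot> i = \<zero>(x,w)"
      using Cmp_assoc[OF i b h(1)] sq Cmp_assoc[OF a i' h(1)] h zero_comp[OF a] w by simp
    then obtain t where t: "t \<in> Hom A z w" "t \<cdot> p = h \<cdot> b"
      using short_exact_desc[OF ses i p Cmp_Hom[OF b h(1)]] by blast
    \<comment> \<open>\<open>d\<close> vanishes on \<open>b\<close> and on \<open>i'\<close>, so
      \<open>d \<cdot> c\<close> vanishes on both summands of the biproduct. Decomposing the
      identity of \<open>s\<close> gives \<open>d \<cdot> c = 0\<close>, and \<open>c\<close> is
      epi.\<close>
    define d where "d = t \<cdot> p' \<ominus>\<ominus> h"
    have tp: "t \<cdot> p' \<in> Hom A y' w" using Cmp_Hom p' t by blast
    have d: "d \<in> Hom A y' w" unfolding d_def using sub_Hom tp h by blast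
    have "d \<cdot> b = \<zero>(y,w)" unfolding d_def sub_comp[OF b tp h(1)]
      using Cmp_assoc[OF b p'(1) t(1)] p'b t sub_eq_zero_iff Cmp_Hom b h by simp
    moreover have "d \<cdot> i' = \<zero>(x',w)" unfolding d_def sub_comp[OF i' tp h(1)]
      using Cmp_assoc[OF i' p'(1) t(1)] p'i' comp_zero[OF t(1)] obj h sub_zero[OF zero_Hom] w by simp
    ultimately have db: "(d \<cdot> c) \<cdot> i\<^sub>1 = \<zero>(y,w)" "(d \<cdot> c) \<cdot> i\<^sub>2 = \<zero>(x',w)"
      using Cmp_assoc[OF s(2) c(1) d] Cmp_assoc[OF s(3) c(1) d] b_def i'_def by auto
    have dc: "d \<cdot> c \<in> Hom A s w" using Cmp_Hom c d by blast
    interpret h: group_hom "HomGrp A s s" "HomGrp A s w" "\<lambda>a. (d \<cdot> c) \<cdot> a"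
      using comp_left_hom[OF dc s(1)] .
    have ip: "i\<^sub>1 \<cdot> p\<^sub>1 \<in> Hom A s s" "i\<^sub>2 \<cdot> p\<^sub>2 \<in> Hom A s s"
      using Cmp_Hom s by auto
    have "d \<cdot> c = (d \<cdot> c) \<cdot> ((i\<^sub>1 \<cdot> p\<^sub>1) \<otimes>\<^bsub>HomGrp A s s\<^esub> (i\<^sub>2 \<cdot> p\<^sub>2))"
      using bp Cmp_Ident_right[OF dc] by (simp add: biproduct_def)
    also have "\<dots> = ((d \<cdot> c) \<cdot> (i\<^sub>1 \<cdot> p\<^sub>1)) \<otimes>\<^bsub>HomGrp A s w\<^esub> ((d \<cdot> c) \<cdot> (i\<^sub>2 \<cdot> p\<^sub>2))"
      using h.hom_mult ip HomGrp(3) s by simp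
    also have "\<dots> = \<zero>(s,w)"
      using Cmp_assoc[OF s(4) s(2) dc] Cmp_assoc[OF s(5) s(3) dc] db zero_comp[OF s(4)]
        zero_comp[OF s(5)] w h.H.l_one[OF h.H.one_closed] by simp
    finally have "d = \<zero>(y',w)" using epi_zero[OF ce c(1) d] by simp
    then have "t \<cdot> p' = h" using sub_eq_zero_iff[OF tp h(1)] d_def by simp
    then show "\<exists>u\<in>Hom A z w. u \<cdot> p' = h" using t by blast
  qed
  ultimately have "short_exact A i' p'" by (rule short_exactI_mono)
  then show ?thesis using that i' p'(1) b sq p'b by blast
qed

section \<open>Maps of short exact sequences with the identity on the cokernel\<close>

context
  fixes x y z x' y' i p i' p' a b
  assumes ses: "short_exact A i p" and i: "i \<in> Hom A x y" and p: "p \<in> Hom A y z"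
    and ses': "short_exact A i' p'" and i': "i' \<in> Hom A x' y'" and p': "p' \<in> Hom A y' z"
    and a: "a \<in> Hom A x x'" and b: "b \<in> Hom A y y'"
    and sq: "b \<cdot> i = i' \<cdot> a" and tri: "p' \<cdot> b = p"
begin

text \<open>The difference is killed by \<open>i'\<close>, so it is \<open>t \<cdot> p'\<close> for
  some \<open>t\<close>. Precomposing with \<open>b\<close> turns this into
  \<open>t \<cdot> p\<close>, which is zero, and \<open>p\<close> is epi.\<close>

lemma rows_joint_epi:
  assumes "u \<in> Hom A y' w" "v \<in> Hom A y' w" "u \<cdot> b = v \<cdot> b" "u \<cdot> i' = v \<cdot> i'"
  shows "u = v"
proof -
  note E = short_exactD[OF ses i p]
  define d where "d = u \<ominus>\<ominus> v"
  have d: "d \<in> Hom A y' w" unfolding d_def using sub_Hom assms by blast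
  have 0: "d \<cdot> b = \<zero>(y,w)" "d \<cdot> i' = \<zero>(x',w)"
    unfolding d_def sub_comp[OF b assms(1,2)] sub_comp[OF i' assms(1,2)]
    using assms Cmp_Hom b i' sub_eq_zero_iff by auto
  obtain t where t: "t \<in> Hom A z w" "t \<cdot> p' = d"
    using short_exact_desc[OF ses' i' p' d 0(2)] .
  have "t \<cdot> p = \<zero>(y,w)" using Cmp_assoc[OF b p' t(1)] tri t 0 by simp
  then have "t = \<zero>(z,w)" using epi_zero[OF E(2) p t(1)] by simp
  then have "d = \<zero>(y',w)" using t zero_comp[OF p'] Hom_Obj[OF d] by simp
  then show ?thesis using sub_eq_zero_iff assms d_def by simp
qed

text \<open>Since \<open>p = p' \<cdot> b\<close>, the equation forces
  \<open>p \<cdot> h = 0\<close>, so \<open>h\<close> lifts along \<open>i\<close>; cancelling the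
  mono \<open>i'\<close> gives the second equation.\<close>

lemma rows_pullback:
  assumes "h \<in> Hom A w y" "k \<in> Hom A w x'" "b \<cdot> h = i' \<cdot> k"
  obtains u where "u \<in> Hom A w x" "i \<cdot> u = h" "a \<cdot> u = k"
proof -
  note E = short_exactD[OF ses' i' p']
  have "p \<cdot> h = \<zero>(w,z)"
    using Cmp_assoc[OF assms(1) b p'] tri assms(3) Cmp_assoc[OF assms(2) i' p'] E
      zero_comp[OF assms(2)] Hom_Obj[OF p] by simp
  then obtain u where u: "u \<in> Hom A w x" "i \<cdot> u = h"
    using short_exact_lift[OF ses i p assms(1)] by blast
  have "i' \<cdot> (a \<cdot> u) = i' \<cdot> k"
    using Cmp_assoc[OF u(1) a i'] sq Cmp_assoc[OF u(1) i b] u assms by simp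
  then have "a \<cdot> u = k" using mono_cancel[OF E(1) i'] Cmp_Hom[OF u(1) a] assms(2) by blast
  then show ?thesis using that u by blast
qed

text \<open>The left square is a pushout in every such diagram, however it arose, so
  \<open>pushout_short_exact\<close> need not carry a universal property along. The arrow
  \<open>c\<close> from the biproduct with components \<open>b\<close> and \<open>-i'\<close> is epi
  by \<open>rows_joint_epi\<close>, and its kernel factors through \<open>x\<close> by
  \<open>rows_pullback\<close>. The arrow with components \<open>s\<close> and \<open>-v\<close>
  kills that kernel and descends along \<open>c\<close>.\<close>

lemma rows_pushout:
  assumes s: "s \<in> Hom A y w" and v: "v \<in> Hom A x' w" and "s \<cdot> i = v \<cdot> a"
  obtains t where "t \<in> Hom A y' w" "t \<cdot> b = s" "t \<cdot> i' = v"
proof -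
  have obj: "x \<in> Obj A" "y \<in> Obj A" "x' \<in> Obj A" "y' \<in> Obj A" "w \<in> Obj A"
    using Hom_Obj[OF i] Hom_Obj[OF i'] Hom_Obj[OF s] by auto
  obtain S i\<^sub>1 i\<^sub>2 p\<^sub>1 p\<^sub>2 where "biproduct A y x' S i\<^sub>1 i\<^sub>2 p\<^sub>1 p\<^sub>2"
    using biproduct_exists obj by blast
  then have S: "S \<in> Obj A" "i\<^sub>1 \<in> Hom A y S" "i\<^sub>2 \<in> Hom A x' S" "p\<^sub>1 \<in> Hom A S y" "p\<^sub>2 \<in> Hom A S x'"
    "p\<^sub>1 \<cdot> i\<^sub>1 = Ident A y" "p\<^sub>2 \<cdot> i\<^sub>2 = Ident A x'" "p\<^sub>2 \<cdot> i\<^sub>1 = \<zero>(y,x')" "p\<^sub>1 \<cdot> i\<^sub>2 = \<zero>(x',y)"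
    by (auto simp: biproduct_def)
  \<comment> \<open>The second component is \<open>-h\<close>, written as zero minus
    \<open>h\<close>. With this sign \<open>copair b i'\<close> kills exactly the pairs on which
    \<open>b\<close> and \<open>i'\<close> agree.\<close>
  define copair where "copair g h = g \<cdot> p\<^sub>1 \<ominus>\<ominus> h \<cdot> p\<^sub>2" for g h
  have copair: "copair g h \<in> Hom A S m" "copair g h \<cdot> i\<^sub>1 = g"
      "copair g h \<cdot> i\<^sub>2 = \<zero>(x',m) \<ominus>\<ominus> h"
    if g: "g \<in> Hom A y m" and h: "h \<in> Hom A x' m" for g h m
  proof -
    have gp: "g \<cdot> p\<^sub>1 \<in> Hom A S m" "h \<cdot> p\<^sub>2 \<in> Hom A S m"
      using Cmp_Hom S g h by auto
    show "copair g h \<in> Hom A S m" unfolding copair_def using sub_Hom gp by blast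
    show "copair g h \<cdot> i\<^sub>1 = g"
      unfolding copair_def sub_comp[OF S(2) gp]
      using Cmp_assoc[OF S(2,4) g] Cmp_assoc[OF S(2,5) h] S Cmp_Ident_right[OF g]
        comp_zero[OF h] obj sub_zero[OF g] by simp
    show "copair g h \<cdot> i\<^sub>2 = \<zero>(x',m) \<ominus>\<ominus> h"
      unfolding copair_def sub_comp[OF S(3) gp]
      using Cmp_assoc[OF S(3,4) g] Cmp_assoc[OF S(3,5) h] S Cmp_Ident_right[OF h]
        comp_zero[OF g] obj by simp
  qed
  define c where "c = copair b i'"
  have c: "c \<in> Hom A S y'" unfolding c_def using copair b i' by blast
  have ce: "epi_arrow A c"
  proof (rule epiI[OF c])
    fix m u assume u: "u \<in> Hom A y' m" "u \<cdot> c = \<zero>(S,m)"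
    have m: "m \<in> Obj A" using Hom_Obj[OF u(1)] by simp
    have "u \<cdot> b = \<zero>(y,m)"
      using Cmp_assoc[OF S(2) c u(1)] u c_def copair(2)[OF b i'] zero_comp[OF S(2)] m by simp
    moreover have "u \<cdot> (\<zero>(x',y') \<ominus>\<ominus> i') = \<zero>(x',m)"
      using Cmp_assoc[OF S(3) c u(1)] u c_def copair(3)[OF b i'] zero_comp[OF S(3)] m by simp
    then have "u \<cdot> i' = \<zero>(x',m)"
      using comp_sub[OF u(1) zero_Hom i'] comp_zero[OF u(1)] obj
        sub_eq_zero_iff[OF zero_Hom Cmp_Hom[OF i' u(1)]] m by simp
    ultimately show "u = \<zero>(y',m)"
      using rows_joint_epi[OF u(1) zero_Hom] zero_comp[OF b] zero_comp[OF i'] obj m by simp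
  qed
  obtain K k where k: "k \<in> Hom A K S" "is_kernel A c k" using kernel_exists[OF c] .
  have K: "K \<in> Obj A" using Hom_Obj[OF k(1)] by simp
  have ck: "c \<cdot> k = \<zero>(K,y')"
    using is_kernel_Hom[OF k(2)] HomD[OF k(1)] HomD[OF c] by simp
  have copair_k: "copair g h \<cdot> k = g \<cdot> (p\<^sub>1 \<cdot> k) \<ominus>\<ominus> h \<cdot> (p\<^sub>2 \<cdot> k)"
    if g: "g \<in> Hom A y m" and h: "h \<in> Hom A x' m" for g h m
    unfolding copair_def sub_comp[OF k(1) Cmp_Hom[OF S(4) g] Cmp_Hom[OF S(5) h]]
    using Cmp_assoc[OF k(1) S(4) g] Cmp_assoc[OF k(1) S(5) h] by simp
  have pk: "p\<^sub>1 \<cdot> k \<in> Hom A K y" "p\<^sub>2 \<cdot> k \<in> Hom A K x'"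
    using Cmp_Hom k S by auto
  have "b \<cdot> (p\<^sub>1 \<cdot> k) = i' \<cdot> (p\<^sub>2 \<cdot> k)"
    using copair_k[OF b i'] ck c_def sub_eq_zero_iff[OF Cmp_Hom[OF pk(1) b] Cmp_Hom[OF pk(2) i']]
    by simp
  then obtain u where u: "u \<in> Hom A K x" "i \<cdot> u = p\<^sub>1 \<cdot> k" "a \<cdot> u = p\<^sub>2 \<cdot> k"
    using rows_pullback[OF pk] by blast
  have "s \<cdot> (p\<^sub>1 \<cdot> k) = v \<cdot> (p\<^sub>2 \<cdot> k)"
    using Cmp_assoc[OF u(1) i s] Cmp_assoc[OF u(1) a v] u assms by simp
  then have "copair s v \<cdot> k = \<zero>(K,w)"
    using copair_k[OF s v] sub_eq_zero_iff[OF Cmp_Hom[OF pk(1) s] Cmp_Hom[OF pk(2) v]] by simp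
  then obtain t where t: "t \<in> Hom A y' w" "t \<cdot> c = copair s v"
    using is_cokernel_desc[OF epi_is_cokernel_of_kernel[OF ce k(2)] c copair(1)[OF s v]]
      HomD[OF k(1)] by metis
  have "t \<cdot> b = s"
    using Cmp_assoc[OF S(2) c t(1)] t copair(2)[OF b i'] copair(2)[OF s v] c_def by simp
  moreover have "t \<cdot> (\<zero>(x',y') \<ominus>\<ominus> i') = \<zero>(x',w) \<ominus>\<ominus> v"
    using Cmp_assoc[OF S(3) c t(1)] t copair(3)[OF b i'] copair(3)[OF s v] c_def by simp
  then have "t \<cdot> i' = v"
    using comp_sub[OF t(1) zero_Hom i'] comp_zero[OF t(1)] obj
      sub_left_cancel[OF Cmp_Hom[OF i' t(1)] v zero_Hom] by simp
  ultimately show ?thesis using that t by blast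
qed

text \<open>What \<open>b\<close> kills is, by \<open>rows_pullback\<close> against zero, of the
  form \<open>i \<cdot> v\<close> with \<open>a \<cdot> v = 0\<close>. An \<open>h\<close> killing
  \<open>b\<close> restricts along \<open>i'\<close> to an arrow killing \<open>a\<close>, which
  factors through \<open>q\<close>; the factorization extends to \<open>q'\<close> because
  \<open>b\<close> and \<open>i'\<close> are jointly epi.\<close>

lemma rows_short_exact_mono:
  assumes sa: "short_exact A a q" and q: "q \<in> Hom A x' n"
    and q': "q' \<in> Hom A y' n" "q' \<cdot> i' = q" "q' \<cdot> b = \<zero>(y,n)"
  shows "short_exact A b q'"
proof (rule short_exactI_mono)
  note E = short_exactD[OF sa a q]
  show "mono_arrow A b"
  proof (rule monoI[OF b])
    fix w u assume u: "u \<in> Hom A w y" "b \<cdot> u = \<zero>(w,y')"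
    have w: "w \<in> Obj A" "x' \<in> Obj A" using Hom_Obj[OF u(1)] Hom_Obj[OF a] by auto
    obtain v where v: "v \<in> Hom A w x" "i \<cdot> v = u" "a \<cdot> v = \<zero>(w,x')"
      using rows_pullback[OF u(1) zero_Hom] u w comp_zero[OF i'] by metis
    then show "u = \<zero>(w,y)" using mono_zero[OF E(1) a v(1)] comp_zero[OF i] w by simp
  qed
  show "is_cokernel A b q'"
  proof (rule is_cokernelI[OF b q'(1,3)])
    show "epi_arrow A q'" using epi_comp_epi[OF _ i' q'(1)] q' E by simp
    fix w h assume h: "h \<in> Hom A y' w" "h \<cdot> b = \<zero>(y,w)"
    have w: "w \<in> Obj A" using Hom_Obj[OF h(1)] by auto
    have "(h \<cdot> i') \<cdot> a = \<zero>(x,w)"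
      using Cmp_assoc[OF a i' h(1)] sq Cmp_assoc[OF i b h(1)] h zero_comp[OF i] w by simp
    then obtain t where t: "t \<in> Hom A n w" "t \<cdot> q = h \<cdot> i'"
      using short_exact_desc[OF sa a q Cmp_Hom[OF i' h(1)]] by blast
    have "t \<cdot> q' = h"
    proof (rule rows_joint_epi[OF Cmp_Hom[OF q'(1) t(1)] h(1)])
      show "t \<cdot> q' \<cdot> b = h \<cdot> b"
        using Cmp_assoc[OF b q'(1) t(1)] q' h comp_zero[OF t(1)] Hom_Obj[OF b] by simp
      show "t \<cdot> q' \<cdot> i' = h \<cdot> i'" using Cmp_assoc[OF i' q'(1) t(1)] q' t by simp
    qed
    then show "\<exists>u\<in>Hom A n w. u \<cdot> q' = h" using t by blast
  qed
qed

text \<open>By \<open>rows_pullback\<close> against zero, whatever \<open>b\<close> kills comes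
  along \<open>i\<close> from something that \<open>a\<close> kills, hence from \<open>k\<close>.
  That \<open>b\<close> is epi follows by testing on \<open>b\<close> and \<open>i'\<close>
  jointly.\<close>

lemma rows_short_exact_epi:
  assumes sa: "short_exact A k a" and k: "k \<in> Hom A m x"
  shows "short_exact A (i \<cdot> k) b"
proof (rule short_exactI_epi)
  note E = short_exactD[OF sa k a]
  show "epi_arrow A b"
  proof (rule epiI[OF b])
    fix w u assume u: "u \<in> Hom A y' w" "u \<cdot> b = \<zero>(y,w)"
    have w: "w \<in> Obj A" "y' \<in> Obj A" using Hom_Obj[OF u(1)] by auto
    have "(u \<cdot> i') \<cdot> a = \<zero>(x,w)"
      using Cmp_assoc[OF a i' u(1)] sq Cmp_assoc[OF i b u(1)] u zero_comp[OF i] w by simp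
    then have "u \<cdot> i' = \<zero>(x',w)" using epi_zero[OF E(2) a Cmp_Hom[OF i' u(1)]] by simp
    then show "u = \<zero>(y',w)"
      using rows_joint_epi[OF u(1) zero_Hom] u w zero_comp[OF b] zero_comp[OF i'] by simp
  qed
  show "is_kernel A b (i \<cdot> k)"
  proof (rule is_kernelI[OF b Cmp_Hom[OF k i]])
    show "b \<cdot> (i \<cdot> k) = \<zero>(m,y')"
      using Cmp_assoc[OF k i b] sq Cmp_assoc[OF k a i'] E comp_zero[OF i'] Hom_Obj[OF k] by simp
    show "mono_arrow A (i \<cdot> k)"
      using comp_mono[OF E(1) _ k i] short_exactD[OF ses i p] by simp
    fix w h assume h: "h \<in> Hom A w y" "b \<cdot> h = \<zero>(w,y')"
    have w: "w \<in> Obj A" "x' \<in> Obj A" using Hom_Obj[OF h(1)] Hom_Obj[OF a] by auto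
    obtain v where v: "v \<in> Hom A w x" "i \<cdot> v = h" "a \<cdot> v = \<zero>(w,x')"
      using rows_pullback[OF h(1) zero_Hom] h w comp_zero[OF i'] by metis
    obtain u where "u \<in> Hom A w m" "k \<cdot> u = v" using short_exact_lift[OF sa k a v(1,3)] .
    then show "\<exists>u\<in>Hom A w m. (i \<cdot> k) \<cdot> u = h"
      using Cmp_assoc[OF _ k i] v by metis
  qed
qed

end

section \<open>Image factorizations; splicing and cutting exact sequences\<close>

lemma image_factorization:
  assumes c: "is_cokernel A a c" and m: "is_kernel A c m"
  obtains e where "e \<in> Hom A (Dom A a) (Dom A m)" "epi_arrow A e" "m \<cdot> e = a"
proof -
  note ac = is_cokernel_Hom[OF c] and cm = is_kernel_Hom[OF m]
  have cod: "Cod A m = Cod A a" using c m by (auto simp: is_cokernel_def is_kernel_def)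
  obtain e where e: "e \<in> Hom A (Dom A a) (Dom A m)" "m \<cdot> e = a"
    using is_kernel_lift[OF m cm(2), of a "Dom A a"] ac cod by metis
  \<comment> \<open>Minimality of the image: if \<open>u \<cdot> e = 0\<close>, then
    \<open>a\<close> factors through \<open>m \<cdot> k\<close>, where \<open>k\<close> is the
    kernel of \<open>u\<close>. The cokernel of the mono \<open>m \<cdot> k\<close> then kills
    \<open>m\<close>, so \<open>m\<close> factors through \<open>m \<cdot> k\<close>. Hence
    \<open>k\<close> has a right inverse \<open>s\<close>, and
    \<open>u = u \<cdot> k \<cdot> s = 0\<close>.\<close>
  have "epi_arrow A e"
  proof (rule epiI[OF e(1)])
    fix w u assume u: "u \<in> Hom A (Dom A m) w" "u \<cdot> e = \<zero>(Dom A a,w)"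
    have w: "w \<in> Obj A" using Hom_Obj[OF u(1)] by simp
    obtain K k where k: "k \<in> Hom A K (Dom A m)" "is_kernel A u k" using kernel_exists[OF u(1)] .
    obtain e' where e': "e' \<in> Hom A (Dom A a) K" "k \<cdot> e' = e"
      using is_kernel_lift[OF k(2,1) e(1)] u HomD[OF u(1)] by metis
    have mk: "m \<cdot> k \<in> Hom A K (Cod A m)" using Cmp_Hom k cm by blast
    have mkm: "mono_arrow A (m \<cdot> k)"
      using comp_mono[OF is_kernel_mono[OF k(2)] is_kernel_mono[OF m] k(1) cm(2)] .
    obtain z c' where c': "c' \<in> Hom A (Cod A m) z" "is_cokernel A (m \<cdot> k) c'"
      using cokernel_exists[OF mk] .
    have z: "z \<in> Obj A" "K \<in> Obj A" "Dom A m \<in> Obj A"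
      using Hom_Obj[OF c'(1)] Hom_Obj[OF k(1)] by auto
    have c'mk: "c' \<cdot> (m \<cdot> k) = \<zero>(K,z)"
      using is_cokernel_Hom[OF c'(2)] HomD[OF mk] HomD[OF c'(1)] by simp
    have "a = (m \<cdot> k) \<cdot> e'" using e e' Cmp_assoc[OF e'(1) k(1) cm(2)] by simp
    then have "c' \<cdot> a = \<zero>(Dom A a,z)"
      using Cmp_assoc[OF e'(1) mk c'(1)] c'mk zero_comp[OF e'(1)] z by simp
    then obtain t where t: "t \<in> Hom A (Cod A c) z" "t \<cdot> c = c'"
      using is_cokernel_desc[OF c ac(2)] c'(1) cod by metis
    have "c' \<cdot> m = \<zero>(Dom A m,z)"
      using Cmp_assoc[OF cm(2,1) t(1)] t cm comp_zero[OF t(1)] z by simp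
    then obtain s where s: "s \<in> Hom A (Dom A m) K" "(m \<cdot> k) \<cdot> s = m"
      using is_kernel_lift[OF mono_is_kernel_of_cokernel[OF mkm c'(2)] mk cm(2)] HomD[OF c'(1)]
      by metis
    have "m \<cdot> (k \<cdot> s) = m \<cdot> Ident A (Dom A m)"
      using s Cmp_assoc[OF s(1) k(1) cm(2)] Cmp_Ident_right[OF cm(2)] by simp
    then have ks: "k \<cdot> s = Ident A (Dom A m)"
      using mono_cancel[OF is_kernel_mono[OF m] cm(2) Cmp_Hom[OF s(1) k(1)] Ident_Hom] z by simp
    have "u \<cdot> k = \<zero>(K,w)"
      using is_kernel_Hom[OF k(2)] HomD[OF k(1)] HomD[OF u(1)] by simp
    then show "u = \<zero>(Dom A m,w)"
      using Cmp_assoc[OF s(1) k(1) u(1)] ks Cmp_Ident_right[OF u(1)] zero_comp[OF s(1)] w by simp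
  qed
  then show ?thesis using that e by blast
qed

text \<open>Exhibits the syzygy \<open>Dom A k\<close> at which a sequence is cut, with an epi onto
  it of the kind that BC1 carries along. For the converse, a cokernel of \<open>k\<close> is one of
  \<open>a\<close>, because \<open>e\<close> is epi.\<close>

lemma exact_pair_iff:
  "exact_pair A a b \<longleftrightarrow>
     (\<exists>k e. is_kernel A b k \<and> epi_arrow A e \<and> e \<in> Hom A (Dom A a) (Dom A k) \<and> k \<cdot> e = a)"
proof
  assume "exact_pair A a b"
  then obtain c m where "is_cokernel A a c" "is_kernel A c m" "is_kernel A b m"
    by (auto simp: exact_pair_def is_image_def)
  then show "\<exists>k e. is_kernel A b k \<and> epi_arrow A e \<and> e \<in> Hom A (Dom A a) (Dom A k) \<and> k \<cdot> e = a"
    using image_factorization by metis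
next
  assume "\<exists>k e. is_kernel A b k \<and> epi_arrow A e \<and> e \<in> Hom A (Dom A a) (Dom A k) \<and> k \<cdot> e = a"
  then obtain k e where k: "is_kernel A b k" and e: "epi_arrow A e" "e \<in> Hom A (Dom A a) (Dom A k)"
    and a: "k \<cdot> e = a" by blast
  note bk = is_kernel_Hom[OF k]
  have aH: "a \<in> Hom A (Dom A a) (Cod A k)" using Cmp_Hom[OF e(2) bk(2)] a by simp
  obtain z c where c: "c \<in> Hom A (Cod A k) z" "is_cokernel A k c"
    using cokernel_exists[OF bk(2)] .
  have ck: "c \<cdot> k = \<zero>(Dom A k,z)"
    using is_cokernel_Hom[OF c(2)] HomD[OF c(1)] by simp
  have "is_cokernel A a c"
  proof (rule is_cokernelI[OF aH c(1)])
    show "c \<cdot> a = \<zero>(Dom A a,z)"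
      using Cmp_assoc[OF e(2) bk(2) c(1)] a ck zero_comp[OF e(2)] Hom_Obj[OF c(1)] by simp
    show "epi_arrow A c" using is_cokernel_epi c by blast
    fix w h assume h: "h \<in> Hom A (Cod A k) w" "h \<cdot> a = \<zero>(Dom A a,w)"
    have "h \<cdot> k = \<zero>(Dom A k,w)"
      using epi_zero[OF e Cmp_Hom[OF bk(2) h(1)]] Cmp_assoc[OF e(2) bk(2) h(1)] a h by simp
    then show "\<exists>u\<in>Hom A z w. u \<cdot> c = h"
      using is_cokernel_desc[OF c(2,1) h(1)] by metis
  qed
  then have "is_image A a k"
    using mono_is_kernel_of_cokernel[OF is_kernel_mono[OF k] c(2)] by (auto simp: is_image_def)
  then show "exact_pair A a b"
    using k bk HomD[OF aH] HomD[OF bk(1)] by (auto simp: exact_pair_def)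
qed

lemma exact_pair_comp_zero:
  assumes "exact_pair A a b" shows "b \<cdot> a = \<zero>(Dom A a,Cod A b)"
proof -
  obtain k e where k: "is_kernel A b k" and e: "e \<in> Hom A (Dom A a) (Dom A k)" and a: "k \<cdot> e = a"
    using assms by (auto simp: exact_pair_iff)
  note bk = is_kernel_Hom[OF k]
  show ?thesis using Cmp_assoc[OF e bk(2,1)] a bk(3) zero_comp[OF e] Hom_Obj[OF bk(1)] by simp
qed

lemma is_kernel_mono_comp_iff:
  assumes k: "mono_arrow A k" "k \<in> Hom A y z" and e: "e \<in> Hom A x y"
  shows "is_kernel A (k \<cdot> e) m \<longleftrightarrow> is_kernel A e m"
proof -
  have ke: "k \<cdot> e \<in> Hom A x z" using Cmp_Hom e k by blast
  have 0: "(k \<cdot> e) \<cdot> h = \<zero>(Dom A h,z) \<longleftrightarrow> e \<cdot> h = \<zero>(Dom A h,y)"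
    if "h \<in> Arr A" "Cod A h = x" for h
  proof -
    have h: "h \<in> Hom A (Dom A h) x" using that by (simp add: Hom_def)
    show ?thesis
      unfolding Cmp_assoc[OF h e k(2)]
      using mono_zero[OF k Cmp_Hom[OF h e]] comp_zero[OF k(2)] Hom_Obj[OF h] by metis
  qed
  show ?thesis
    unfolding is_kernel_def HomD[OF ke] HomD[OF e]
    by (simp add: 0 HomD(1)[OF ke] HomD(1)[OF e] cong: conj_cong)
qed

text \<open>Leaves out only that the last arrow is epi. Thus it passes to initial segments and
  tolerates a mono composed after the last arrow.\<close>

definition left_exact :: "'a list \<Rightarrow> bool" where
  "left_exact as \<longleftrightarrow> chain A as \<and> mono_arrow A (hd as) \<and>
     (\<forall>i. Suc i < length as \<longrightarrow> exact_pair A (as ! i) (as ! Suc i))"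

lemma exact_sequence_snoc: "exact_sequence A (as @ [a]) \<longleftrightarrow> left_exact (as @ [a]) \<and> epi_arrow A a"
  by (auto simp: exact_sequence_def left_exact_def)

lemma left_exact_singleton: "left_exact [a] \<longleftrightarrow> mono_arrow A a"
  by (auto simp: left_exact_def chain_def mono_arrow_def)

lemma left_exact_snoc:
  "left_exact (as @ [a, b]) \<longleftrightarrow> left_exact (as @ [a]) \<and> exact_pair A a b"
proof -
  have *: "(\<forall>i. Suc i < length (as @ [a, b]) \<longrightarrow> P ((as @ [a, b]) ! i) ((as @ [a, b]) ! Suc i)) \<longleftrightarrow>
      (\<forall>i. Suc i < length (as @ [a]) \<longrightarrow> P ((as @ [a]) ! i) ((as @ [a]) ! Suc i)) \<and> P a b" for P
  proof -
    have "(as @ [a, b]) ! i = (as @ [a]) ! i" if "i < Suc (length as)" for i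
      using that by (auto simp: nth_append less_Suc_eq)
    moreover have "(as @ [a, b]) ! Suc (length as) = b" by (simp add: nth_append)
    ultimately show ?thesis by (auto simp: less_Suc_eq)
  qed
  have "hd (as @ [a, b]) = hd (as @ [a])" by (cases as) auto
  then show ?thesis
    unfolding left_exact_def chain_def *[of "exact_pair A"] *[of "\<lambda>a b. Cod A a = Dom A b"]
    by (auto simp: exact_pair_def)
qed

text \<open>The last arrow enters only through its kernel, which a mono after it does not change. So
  it may be traded for its factor through a syzygy.\<close>

lemma left_exact_mono_comp:
  assumes k: "mono_arrow A k" "k \<in> Hom A y z" and e: "e \<in> Hom A x y"
  shows "left_exact (as @ [k \<cdot> e]) \<longleftrightarrow> left_exact (as @ [e])"
proof (cases as rule: rev_cases)
  case Nil
  then show ?thesis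
    using comp_mono[OF _ k(1) e k(2)] mono_comp_mono[OF _ e k(2)]
    by (auto simp: left_exact_singleton)
next
  case (snoc ds d)
  have "exact_pair A d (k \<cdot> e) \<longleftrightarrow> exact_pair A d e"
    unfolding exact_pair_iff is_kernel_mono_comp_iff[OF k e] ..
  then show ?thesis using left_exact_snoc snoc by simp
qed

lemma exact_sequence_splice:
  assumes k: "k \<in> Hom A y z" and e: "e \<in> Hom A x y"
    and "exact_sequence A (as @ [e])" and ses: "short_exact A k p"
  shows "exact_sequence A (as @ [k \<cdot> e, p])"
proof -
  have p: "p \<in> Hom A z (Cod A p)" using short_exact_Hom[OF ses] HomD[OF k] by simp
  note E = short_exactD[OF ses k p]
  have "exact_pair A (k \<cdot> e) p"
    unfolding exact_pair_iff using assms(3) E e HomD[OF k] HomD[OF Cmp_Hom[OF e k]]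
    by (auto simp: exact_sequence_snoc)
  then show ?thesis
    using assms left_exact_mono_comp[OF E(1) k e] E exact_sequence_snoc[of "as @ [k \<cdot> e]" p]
    by (auto simp: exact_sequence_snoc left_exact_snoc)
qed

text \<open>\<open>e\<close> vanishes on the kernel of \<open>e'\<close>, and the epi
  \<open>e'\<close> is the cokernel of that kernel, so \<open>e\<close> factors back through
  \<open>e'\<close>. Cancelling the two epis shows that the factor is inverse to
  \<open>t\<close>.\<close>

lemma epi_same_kernel:
  assumes e: "epi_arrow A e" "e \<in> Hom A x y" and e': "epi_arrow A e'" "e' \<in> Hom A x y'"
    and t: "t \<in> Hom A y y'" "t \<cdot> e = e'"
    and ker: "\<And>w h. h \<in> Hom A w x \<Longrightarrow> e' \<cdot> h = \<zero>(w,y') \<Longrightarrow> e \<cdot> h = \<zero>(w,y)"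
  obtains s where "s \<in> Hom A y' y" "s \<cdot> t = Ident A y" "t \<cdot> s = Ident A y'"
proof -
  obtain K k where k: "k \<in> Hom A K x" "is_kernel A e' k" using kernel_exists[OF e'(2)] .
  have "e' \<cdot> k = \<zero>(K,y')"
    using is_kernel_Hom[OF k(2)] HomD[OF k(1)] HomD[OF e'(2)] by simp
  then have "e \<cdot> k = \<zero>(K,y)" using ker k by blast
  then obtain s where s: "s \<in> Hom A y' y" "s \<cdot> e' = e"
    using is_cokernel_desc[OF epi_is_cokernel_of_kernel[OF e'(1) k(2)] e'(2) e(2)] HomD[OF k(1)]
    by metis
  have y: "y \<in> Obj A" "y' \<in> Obj A" using Hom_Obj[OF t(1)] by auto
  have "s \<cdot> t \<cdot> e = Ident A y \<cdot> e"
    using Cmp_assoc[OF e(2) t(1) s(1)] t s Cmp_Ident_left[OF e(2)] by simp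
  then have "s \<cdot> t = Ident A y"
    using epi_cancel[OF e Cmp_Hom[OF t(1) s(1)] Ident_Hom] y by simp
  moreover have "t \<cdot> s \<cdot> e' = Ident A y' \<cdot> e'"
    using Cmp_assoc[OF e'(2) s(1) t(1)] t s Cmp_Ident_left[OF e'(2)] by simp
  then have "t \<cdot> s = Ident A y'"
    using epi_cancel[OF e' Cmp_Hom[OF s(1) t(1)] Ident_Hom] y by simp
  ultimately show ?thesis using that s by blast
qed

text \<open>The arrow \<open>k\<close> is not assumed to be mono: after a base change only \<open>e\<close> is known to
  be epi, and the mono property of \<open>k\<close> is recovered from the exactness at \<open>x\<close>.\<close>

lemma exact_sequence_cut:
  assumes e: "e \<in> Hom A x y" "epi_arrow A e" and k: "k \<in> Hom A y z" and p: "p \<in> Hom A z w"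
    and ex: "exact_sequence A (as @ [k \<cdot> e, p])"
    and z: "as \<noteq> [] \<Longrightarrow> e \<cdot> last as = \<zero>(Dom A (last as),y)"
  shows "exact_sequence A (as @ [e])" "short_exact A k p"
proof -
  have ke: "k \<cdot> e \<in> Hom A x z" using Cmp_Hom k e by blast
  have L: "left_exact (as @ [k \<cdot> e])" "exact_pair A (k \<cdot> e) p" "epi_arrow A p"
    using ex exact_sequence_snoc[of "as @ [k \<cdot> e]" p] left_exact_snoc by auto
  have obj: "x \<in> Obj A" "y \<in> Obj A" "z \<in> Obj A" "w \<in> Obj A"
    using Hom_Obj[OF e(1)] Hom_Obj[OF p] by auto
  \<comment> \<open>The kernel of \<open>k \<cdot> e\<close> is zero if nothing precedes it.
    Otherwise the preceding arrow covers it by an epi, and \<open>e\<close> vanishes on that arrow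
    by assumption.\<close>
  have ker: "e \<cdot> h = \<zero>(v,y)" if h: "h \<in> Hom A v x" "(k \<cdot> e) \<cdot> h = \<zero>(v,z)" for v h
  proof (cases as rule: rev_cases)
    case Nil
    then have "mono_arrow A (k \<cdot> e)" using L left_exact_singleton by simp
    then show ?thesis using mono_zero[OF _ ke h] comp_zero[OF e(1)] Hom_Obj[OF h(1)] by simp
  next
    case (snoc ds d)
    then have "exact_pair A d (k \<cdot> e)" using L left_exact_snoc by simp
    then obtain k' e' where k': "is_kernel A (k \<cdot> e) k'" and e': "epi_arrow A e'"
      "e' \<in> Hom A (Dom A d) (Dom A k')" and d: "k' \<cdot> e' = d" by (auto simp: exact_pair_iff)
    have k'H: "k' \<in> Hom A (Dom A k') x"
      using is_kernel_Hom[OF k'] HomD[OF ke] by (auto simp: Hom_def)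
    have "(e \<cdot> k') \<cdot> e' = \<zero>(Dom A d,y)"
      using Cmp_assoc[OF e'(2) k'H e(1)] d z snoc by simp
    then have ek: "e \<cdot> k' = \<zero>(Dom A k',y)"
      using epi_zero[OF e' Cmp_Hom[OF k'H e(1)]] by simp
    obtain u where u: "u \<in> Hom A v (Dom A k')" "k' \<cdot> u = h"
      using is_kernel_lift[OF k' k'H h(1)] h HomD[OF ke] by metis
    show ?thesis using Cmp_assoc[OF u(1) k'H e(1)] u ek zero_comp[OF u(1)] obj by simp
  qed
  \<comment> \<open>\<open>m\<close> is the true kernel of \<open>p\<close>. The candidate
    \<open>k\<close> is compared with it by \<open>t\<close>, which is invertible because
    \<open>e\<close> and \<open>e\<^sub>1\<close> are epis with the same kernel; so \<open>k\<close>
    inherits what \<open>m\<close> has.\<close>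
  obtain m e\<^sub>1 where m: "is_kernel A p m" and e\<^sub>1: "epi_arrow A e\<^sub>1" "e\<^sub>1 \<in> Hom A x (Dom A m)"
    and me: "m \<cdot> e\<^sub>1 = k \<cdot> e" using L HomD[OF ke] by (auto simp: exact_pair_iff)
  have mH: "m \<in> Hom A (Dom A m) z" using is_kernel_Hom[OF m] HomD[OF p] by (auto simp: Hom_def)
  have "(p \<cdot> k) \<cdot> e = \<zero>(x,w)"
    using Cmp_assoc[OF e(1) k p] exact_pair_comp_zero[OF L(2)] HomD[OF ke] HomD[OF p] by simp
  then have pk: "p \<cdot> k = \<zero>(y,w)" using epi_zero[OF e(2,1) Cmp_Hom[OF k p]] by simp
  then obtain t where t: "t \<in> Hom A y (Dom A m)" "m \<cdot> t = k"
    using is_kernel_lift[OF m mH k] HomD[OF p] by metis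
  have "m \<cdot> (t \<cdot> e) = m \<cdot> e\<^sub>1" using Cmp_assoc[OF e(1) t(1) mH] t me by simp
  then have te: "t \<cdot> e = e\<^sub>1"
    using mono_cancel[OF is_kernel_mono[OF m] mH Cmp_Hom[OF e(1) t(1)] e\<^sub>1(2)] by simp
  have "e \<cdot> h = \<zero>(v,y)" if h: "h \<in> Hom A v x" "e\<^sub>1 \<cdot> h = \<zero>(v,Dom A m)" for v h
    using ker[OF h(1)] Cmp_assoc[OF h(1) e\<^sub>1(2) mH] me h comp_zero[OF mH] Hom_Obj[OF h(1)] by simp
  then obtain s where s: "s \<in> Hom A (Dom A m) y" "s \<cdot> t = Ident A y" "t \<cdot> s = Ident A (Dom A m)"
    using epi_same_kernel[OF e(2,1) e\<^sub>1 t(1) te] by blast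
  have km: "mono_arrow A k"
  proof (rule monoI[OF k])
    fix v u assume u: "u \<in> Hom A v y" "k \<cdot> u = \<zero>(v,z)"
    then have "t \<cdot> u = \<zero>(v,Dom A m)"
      using mono_zero[OF is_kernel_mono[OF m] mH Cmp_Hom[OF u(1) t(1)]] Cmp_assoc[OF u(1) t(1) mH] t
      by simp
    then show "u = \<zero>(v,y)"
      using Cmp_assoc[OF u(1) t(1) s(1)] s Cmp_Ident_left[OF u(1)] comp_zero[OF s(1)]
        Hom_Obj[OF u(1)] by simp
  qed
  have "is_kernel A p k"
  proof (rule is_kernelI[OF p k pk km])
    fix v h assume h: "h \<in> Hom A v z" "p \<cdot> h = \<zero>(v,w)"
    obtain u where u: "u \<in> Hom A v (Dom A m)" "m \<cdot> u = h"
      using is_kernel_lift[OF m mH h(1)] h HomD[OF p] by metis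
    have "k \<cdot> (s \<cdot> u) = h"
      using Cmp_assoc[OF u(1) s(1) k] Cmp_assoc[OF s(1) t(1) mH] t s Cmp_Ident_right[OF mH] u by simp
    then show "\<exists>u\<in>Hom A v y. k \<cdot> u = h" using Cmp_Hom u s by blast
  qed
  then show "short_exact A k p" using short_exactI_epi L by blast
  show "exact_sequence A (as @ [e])"
    using exact_sequence_snoc e L left_exact_mono_comp[OF km k e(1)] by blast
qed

end

section \<open>Base change along a fixed arrow\<close>

lemma fibre_sel [simp]:
  "Dom (fibre C F T) = Dom F" "Cod (fibre C F T) = Cod F" "Ident (fibre C F T) = Ident F"
  "x \<in> Obj (fibre C F T) \<longleftrightarrow> x \<in> Obj F \<and> PObj F x = T"
  "a \<in> Arr (fibre C F T) \<longleftrightarrow> a \<in> Arr F \<and> PArr F a = Ident C T"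
  by (auto simp: fibre_def)

lemma fibre_Cmp: "b \<cdot>\<^bsub>fibre C F T\<^esub> a = b \<cdot>\<^bsub>F\<^esub> a"
  by (simp add: fibre_def)

lemma fibre_HomGrp: "HomGrp (fibre C F T) x y = HomOver F x y (Ident C T)"
  by (simp add: fibre_def)

lemma Hom_fibre: "a \<in> Hom (fibre C F T) x y \<longleftrightarrow> a \<in> Hom F x y \<and> PArr F a = Ident C T"
  by (auto simp: Hom_def)

lemma fibre_HomD:
  assumes "a \<in> Hom (fibre C F T) x y"
  shows "Dom F a = x" "Cod F a = y" "a \<in> Arr F" "PArr F a = Ident C T" "a \<in> Hom F x y"
  using assms by (auto simp: Hom_def)

lemma chain_Cons: "chain C (a # as) \<longleftrightarrow> a \<in> Arr C \<and> (as = [] \<or> chain C as \<and> Cod C a = Dom C (hd as))"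
  by (cases as) (auto simp: chain_def nth_Cons split: nat.splits)

locale fibred_abelian_cat =
  fixes C :: "('t, 'b) cat" and A :: "('o, 'a, 't, 'b) fcat"
  assumes cat_C: "category C" and fib_ab: "fibred_abelian C A"
begin

sublocale C: category C by (rule cat_C)

sublocale A: category A
  using fib_ab by (simp add: fibred_abelian_def fibred_def)

lemma proj: "cat_functor A C (PObj A) (PArr A)"
  using fib_ab by (simp add: fibred_abelian_def fibred_def)

lemma proj_Hom: "a \<in> Hom A x y \<Longrightarrow> PArr A a \<in> Hom C (PObj A x) (PObj A y)"
  using proj by (auto simp: cat_functor_def Hom_def)

lemma fibre_abelian: "T \<in> Obj C \<Longrightarrow> abelian (fibre C A T)"
  using fib_ab by unfold_locales (simp add: fibred_abelian_def)

end

locale base_change_arrow = fibred_abelian_cat C A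
  for C :: "('t, 'b) cat" and A :: "('o, 'a, 't, 'b) fcat" +
  fixes f :: 'b and T T' :: 't
  assumes f: "f \<in> Hom C T T'"
begin

abbreviation S where "S \<equiv> fibre C A T"
abbreviation S' where "S' \<equiv> fibre C A T'"

lemma T_Obj: "T \<in> Obj C" "T' \<in> Obj C"
  using C.Hom_Obj[OF f] by auto

sublocale S: abelian S using fibre_abelian T_Obj by blast
sublocale S': abelian S' using fibre_abelian T_Obj by blast

definition coc :: "'a \<Rightarrow> bool" where
  "coc c \<longleftrightarrow> cocartesian C A c \<and> PArr A c = f"

text \<open>\<open>b\<close> is the base change of \<open>a\<close> relative to the cocartesian
  arrows at its two ends. Keeping these arrows as arguments replaces the choice of a cleavage: for
  fixed \<open>c\<close> and \<open>c'\<close> the arrow \<open>b\<close> is determined by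
  \<open>a\<close>.\<close>

definition sq :: "'a \<Rightarrow> 'a \<Rightarrow> 'a \<Rightarrow> 'a \<Rightarrow> bool" where
  "sq a b c c' \<longleftrightarrow> coc c \<and> coc c' \<and> a \<in> Hom S (Dom A c) (Dom A c') \<and>
     b \<in> Hom S' (Cod A c) (Cod A c') \<and> b \<cdot>\<^bsub>A\<^esub> c = c' \<cdot>\<^bsub>A\<^esub> a"

lemma coc_Hom: "coc c \<Longrightarrow> c \<in> Hom A (Dom A c) (Cod A c)"
  by (auto simp: coc_def cocartesian_def Hom_def)

lemma coc_Obj:
  assumes "coc c" shows "Dom A c \<in> Obj S" "Cod A c \<in> Obj S'"
  using A.Hom_Obj[OF coc_Hom[OF assms]] proj_Hom[OF coc_Hom[OF assms]] f assms
  by (auto simp: coc_def Hom_def)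

lemma coc_exists:
  assumes "x \<in> Obj S" obtains c where "coc c" "Dom A c = x"
proof -
  have "\<forall>g\<in>Arr C. \<forall>x\<in>Obj A. PObj A x = Dom C g \<longrightarrow>
      (\<exists>a. cocartesian C A a \<and> Dom A a = x \<and> PArr A a = g)"
    using fib_ab by (simp add: fibred_abelian_def fibred_def)
  moreover have "x \<in> Obj A" "PObj A x = Dom C f" using assms HomD[OF f] by auto
  ultimately show ?thesis using that HomD(1)[OF f] unfolding coc_def by blast
qed

text \<open>The universal property is used only against arrows over \<open>f\<close> itself: the
  factor then lies over the identity of \<open>T'\<close>, that is, in the fibre.\<close>

lemma coc_factor:
  assumes c: "coc c" and g: "g \<in> Hom A (Dom A c) y" "PArr A g = f"
  shows "\<exists>!u. u \<in> Hom S' (Cod A c) y \<and> u \<cdot>\<^bsub>A\<^esub> c = g"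
proof -
  have y: "PObj A y = T'" "y \<in> Obj A"
    using proj_Hom[OF g(1)] g f A.Hom_Obj[OF g(1)] by (auto simp: Hom_def)
  have "Ident C T' \<in> Hom C (PObj A (Cod A c)) (PObj A (Cod A g))"
    using C.Ident_Hom T_Obj coc_Obj[OF c] y HomD[OF g(1)] by simp
  moreover have "Ident C T' \<cdot>\<^bsub>C\<^esub> PArr A c = PArr A g"
    using C.Cmp_Ident_left[OF f] c g by (simp add: coc_def)
  ultimately have "\<exists>!u. u \<in> Hom A (Cod A c) (Cod A g) \<and> PArr A u = Ident C T' \<and> u \<cdot>\<^bsub>A\<^esub> c = g"
    using c HomD[OF g(1)] unfolding coc_def cocartesian_def by blast
  then show ?thesis using HomD[OF g(1)] by (simp add: Hom_fibre conj_assoc)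
qed

lemma coc_comp:
  assumes c: "coc c" and a: "a \<in> Hom S x (Dom A c)"
  shows "c \<cdot>\<^bsub>A\<^esub> a \<in> Hom A x (Cod A c)" "PArr A (c \<cdot>\<^bsub>A\<^esub> a) = f"
  using A.Cmp_Hom[OF fibre_HomD(5)[OF a] coc_Hom[OF c]] fibre_HomD[OF a] coc_Hom[OF c] c
    proj C.Cmp_Ident_right[OF f] by (auto simp: cat_functor_def coc_def Hom_def)

lemma coc_cancel:
  assumes c: "coc c" and u: "u \<in> Hom S' (Cod A c) y" and v: "v \<in> Hom S' (Cod A c) y"
    and eq: "u \<cdot>\<^bsub>A\<^esub> c = v \<cdot>\<^bsub>A\<^esub> c"
  shows "u = v"
proof -
  have "u \<cdot>\<^bsub>A\<^esub> c \<in> Hom A (Dom A c) y"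
    using A.Cmp_Hom coc_Hom[OF c] fibre_HomD(5)[OF u] by blast
  moreover have "PArr A (u \<cdot>\<^bsub>A\<^esub> c) = f"
    using proj fibre_HomD[OF u] coc_Hom[OF c] C.Cmp_Ident_left[OF f] c
    by (auto simp: cat_functor_def coc_def Hom_def)
  ultimately show ?thesis using coc_factor[OF c] u v eq by metis
qed

lemma sq_exists:
  assumes "coc c" "coc c'" "a \<in> Hom S (Dom A c) (Dom A c')"
  obtains b where "sq a b c c'"
  using coc_factor[OF assms(1) coc_comp[OF assms(2,3)]] assms that by (auto simp: sq_def)

lemma sq_unique: "sq a b c c' \<Longrightarrow> sq a b' c c' \<Longrightarrow> b = b'"
  using coc_cancel[of c b "Cod A c'" b'] by (simp add: sq_def)

lemma sq_Hom:
  assumes "sq a b c c'"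
  shows "a \<in> Hom S (Dom A c) (Dom A c')" "b \<in> Hom S' (Cod A c) (Cod A c')" "coc c" "coc c'"
  using assms by (auto simp: sq_def)

lemma sq_comp:
  assumes "sq a b c c'" "sq a' b' c' c''"
  shows "sq (a' \<cdot>\<^bsub>S\<^esub> a) (b' \<cdot>\<^bsub>S'\<^esub> b) c c''"
proof -
  note h = sq_Hom[OF assms(1)] sq_Hom[OF assms(2)]
  note F = fibre_HomD(5)
  have "(b' \<cdot>\<^bsub>A\<^esub> b) \<cdot>\<^bsub>A\<^esub> c = c'' \<cdot>\<^bsub>A\<^esub> (a' \<cdot>\<^bsub>A\<^esub> a)"
    using A.Cmp_assoc[OF coc_Hom F F, OF h(3,2,6)] A.Cmp_assoc[OF F coc_Hom F, OF h(1,4,6)]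
      A.Cmp_assoc[OF F F coc_Hom, OF h(1,5,8)] assms by (simp add: sq_def)
  then show ?thesis
    using h S.Cmp_Hom[OF h(1,5)] S'.Cmp_Hom[OF h(2,6)] by (simp add: sq_def fibre_Cmp)
qed

lemma sq_comp_eq:
  assumes "sq a b c c'" "sq a' b' c' c''" "sq (a' \<cdot>\<^bsub>S\<^esub> a) d c c''"
  shows "d = b' \<cdot>\<^bsub>S'\<^esub> b"
  using sq_unique[OF assms(3) sq_comp[OF assms(1,2)]] .

text \<open>Both composites with \<open>c\<close> are the zero arrow over \<open>f\<close>.\<close>

lemma sq_zero:
  assumes "sq (zero_arrow S (Dom A c) (Dom A c')) b c c'"
  shows "b = zero_arrow S' (Cod A c) (Cod A c')"
proof -
  note h = sq_Hom[OF assms]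
  define x y x' y' where "x = Dom A c" "y = Dom A c'" "x' = Cod A c" "y' = Cod A c'"
  note xy = x_y_x'_y'_def
  have o: "x \<in> Obj A" "y \<in> Obj A" "x' \<in> Obj A" "y' \<in> Obj A"
    "PObj A x = T" "PObj A y = T" "PObj A x' = T'" "PObj A y' = T'"
    using coc_Obj[OF h(3)] coc_Obj[OF h(4)] xy by auto
  have bil: "bilinear_Hom C A" using fib_ab by (simp add: fibred_abelian_def)
  have grp: "group (HomOver A u v g)" "carrier (HomOver A u v g) = {a \<in> Hom A u v. PArr A a = g}"
    if "u \<in> Obj A" "v \<in> Obj A" "g \<in> Hom C (PObj A u) (PObj A v)" for u v g
    using bil that unfolding bilinear_Hom_def by (auto intro: comm_group.axioms(2))
  have bl: "(\<lambda>a. b \<cdot>\<^bsub>A\<^esub> a) \<in> hom (HomOver A u v g) (HomOver A u w (g' \<cdot>\<^bsub>C\<^esub> g))"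
    if "u \<in> Obj A" "v \<in> Obj A" "w \<in> Obj A" "g \<in> Hom C (PObj A u) (PObj A v)"
      "g' \<in> Hom C (PObj A v) (PObj A w)" "b \<in> carrier (HomOver A v w g')" for u v w g g' b
    using bil that unfolding bilinear_Hom_def by blast
  have br: "(\<lambda>b. b \<cdot>\<^bsub>A\<^esub> a) \<in> hom (HomOver A v w g') (HomOver A u w (g' \<cdot>\<^bsub>C\<^esub> g))"
    if "u \<in> Obj A" "v \<in> Obj A" "w \<in> Obj A" "g \<in> Hom C (PObj A u) (PObj A v)"
      "g' \<in> Hom C (PObj A v) (PObj A w)" "a \<in> carrier (HomOver A u v g)" for u v w g g' a
    using bil that unfolding bilinear_Hom_def by blast
  have I: "Ident C T \<in> Hom C T T" "Ident C T' \<in> Hom C T' T'" using C.Ident_Hom T_Obj by auto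
  have G: "group (HomOver A x y (Ident C T))" "group (HomOver A x' y' (Ident C T'))"
    "group (HomOver A x y' f)" using grp(1) o I f by auto
  have cc: "c \<in> carrier (HomOver A x x' f)" "c' \<in> carrier (HomOver A y y' f)"
    using grp(2)[OF o(1,3)] grp(2)[OF o(2,4)] o f h(3,4) coc_Hom xy by (auto simp: coc_def)
  \<comment> \<open>Bilinearity is needed across different base arrows here: composing with
    \<open>c'\<close> is a homomorphism from the arrows over the identity of \<open>T\<close> to
    those over \<open>f\<close>, so it preserves neutral elements.\<close>
  have "(\<lambda>a. c' \<cdot>\<^bsub>A\<^esub> a) \<in> hom (HomOver A x y (Ident C T)) (HomOver A x y' f)"
    using bl[OF o(1,2,4) _ _ cc(2), of "Ident C T"] o I f C.Cmp_Ident_right[OF f] by simp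
  then have 1: "c' \<cdot>\<^bsub>A\<^esub> zero_arrow S x y = \<one>\<^bsub>HomOver A x y' f\<^esub>"
    using group_hom.hom_one[of "HomOver A x y (Ident C T)" "HomOver A x y' f" "\<lambda>a. c' \<cdot>\<^bsub>A\<^esub> a"] G
    by (simp add: group_hom_def group_hom_axioms_def fibre_HomGrp)
  have "(\<lambda>b. b \<cdot>\<^bsub>A\<^esub> c) \<in> hom (HomOver A x' y' (Ident C T')) (HomOver A x y' f)"
    using br[OF o(1,3,4) _ _ cc(1), of "Ident C T'"] o I f C.Cmp_Ident_left[OF f] by simp
  then have 2: "zero_arrow S' x' y' \<cdot>\<^bsub>A\<^esub> c = \<one>\<^bsub>HomOver A x y' f\<^esub>"
    using group_hom.hom_one[of "HomOver A x' y' (Ident C T')" "HomOver A x y' f" "\<lambda>b. b \<cdot>\<^bsub>A\<^esub> c"] G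
    by (simp add: group_hom_def group_hom_axioms_def fibre_HomGrp)
  have "b \<cdot>\<^bsub>A\<^esub> c = zero_arrow S' x' y' \<cdot>\<^bsub>A\<^esub> c"
    using assms 1 2 by (simp add: sq_def xy)
  moreover have "zero_arrow S' x' y' \<in> Hom S' (Cod A c) (Cod A c')"
    using S'.zero_Hom o xy by simp
  ultimately show ?thesis using coc_cancel[OF h(3,2)] xy by simp
qed

lemma sq_comp_zero:
  assumes "sq a b c c'" "sq a' b' c' c''" "a' \<cdot>\<^bsub>S\<^esub> a = zero_arrow S (Dom A c) (Dom A c'')"
  shows "b' \<cdot>\<^bsub>S'\<^esub> b = zero_arrow S' (Cod A c) (Cod A c'')"
  using sq_zero sq_comp[OF assms(1,2)] assms(3) by simp

text \<open>The outer cocartesian arrows are arguments, so that base changes of two diagrams can be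
  joined, or one be split, at a common object. The empty diagram has one object, hence a single
  arrow \<open>c = c'\<close>.\<close>

fun bc_list :: "'a list \<Rightarrow> 'a list \<Rightarrow> 'a \<Rightarrow> 'a \<Rightarrow> bool" where
  "bc_list [] [] c c' \<longleftrightarrow> coc c \<and> c = c'"
| "bc_list (a # as) (b # bs) c c' \<longleftrightarrow> (\<exists>c\<^sub>1. sq a b c c\<^sub>1 \<and> bc_list as bs c\<^sub>1 c')"
| "bc_list _ _ c c' \<longleftrightarrow> False"

lemma bc_list_length: "bc_list as bs c c' \<Longrightarrow> length bs = length as"
  by (induction as bs c c' rule: bc_list.induct) auto

lemma bc_list_coc: "bc_list as bs c c' \<Longrightarrow> coc c \<and> coc c'"
  by (induction as bs c c' rule: bc_list.induct) (auto dest: sq_Hom)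

lemma bc_list_append:
  "length as = length bs \<Longrightarrow>
     bc_list (as @ as') (bs @ bs') c c' \<longleftrightarrow> (\<exists>c\<^sub>1. bc_list as bs c c\<^sub>1 \<and> bc_list as' bs' c\<^sub>1 c')"
proof (induction as bs arbitrary: c rule: list_induct2)
  case Nil
  then show ?case using bc_list_coc by auto
qed auto

lemma bc_list_append_left:
  "bc_list (as @ as') bs c c' \<longleftrightarrow>
     (\<exists>bs\<^sub>1 bs\<^sub>2 c\<^sub>1. bs = bs\<^sub>1 @ bs\<^sub>2 \<and> bc_list as bs\<^sub>1 c c\<^sub>1 \<and> bc_list as' bs\<^sub>2 c\<^sub>1 c')"
proof
  assume *: "bc_list (as @ as') bs c c'"
  then have "length as = length (take (length as) bs)" using bc_list_length by fastforce
  then show "\<exists>bs\<^sub>1 bs\<^sub>2 c\<^sub>1. bs = bs\<^sub>1 @ bs\<^sub>2 \<and> bc_list as bs\<^sub>1 c c\<^sub>1 \<and> bc_list as' bs\<^sub>2 c\<^sub>1 c'"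
    using * bc_list_append[of as "take (length as) bs" as' "drop (length as) bs"]
    by (metis append_take_drop_id)
qed (use bc_list_append bc_list_length in metis)

lemma bc_list_singleton: "bc_list [a] bs c c' \<longleftrightarrow> (\<exists>b. bs = [b] \<and> sq a b c c')"
proof (cases bs)
  case (Cons b bs')
  then show ?thesis by (cases bs') (auto dest: sq_Hom)
qed simp

lemma bc_list_pair:
  "bc_list [a\<^sub>1, a\<^sub>2] bs c c' \<longleftrightarrow> (\<exists>b\<^sub>1 b\<^sub>2 c\<^sub>1. bs = [b\<^sub>1, b\<^sub>2] \<and> sq a\<^sub>1 b\<^sub>1 c c\<^sub>1 \<and> sq a\<^sub>2 b\<^sub>2 c\<^sub>1 c')"
  by (cases bs) (auto simp: bc_list_singleton)

text \<open>The cocartesian arrow is prescribed at the right end and the construction runs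
  leftwards. This allows a given base change of the end of a sequence to be extended to all of
  it.\<close>

lemma bc_list_exists:
  assumes "chain S as" "coc c'" "Dom A c' = Cod A (last as)"
  shows "\<exists>bs c. bc_list as bs c c' \<and> Dom A c = Dom A (hd as)"
  using assms
proof (induction as)
  case (Cons a as)
  have a: "a \<in> Arr S" and as: "as = [] \<or> chain S as \<and> Cod A a = Dom A (hd as)"
    using Cons.prems by (auto simp: chain_Cons)
  obtain bs c\<^sub>1 where 1: "bc_list as bs c\<^sub>1 c'" "Dom A c\<^sub>1 = Cod A a"
  proof (cases "as = []")
    case True
    then show ?thesis using that[of "[]" c'] Cons.prems by simp
  next
    case False
    then show ?thesis using that Cons as by auto
  qed
  obtain c where c: "coc c" "Dom A c = Dom A a"
    using coc_exists S.Dom_closed[OF a] by auto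
  have "a \<in> Hom S (Dom A c) (Dom A c\<^sub>1)" using Arr_Hom[OF a] 1 c by simp
  then obtain b where "sq a b c c\<^sub>1"
    using sq_exists[OF c(1)] bc_list_coc[OF 1(1)] by blast
  then show ?case using 1 c by (intro exI[of _ "b # bs"] exI[of _ c]) auto
qed (simp add: chain_def)

lemma bc_list_iff:
  "bc_list as bs c c' \<longleftrightarrow>
     (\<exists>cs. length cs = Suc (length as) \<and> cs ! 0 = c \<and> last cs = c' \<and> length bs = length as \<and>
        (\<forall>c \<in> set cs. coc c) \<and> (\<forall>i < length as. sq (as ! i) (bs ! i) (cs ! i) (cs ! Suc i)))"
proof (induction as arbitrary: bs c)
  case Nil
  show ?case
    by (cases bs) (auto simp: length_Suc_conv)
next
  case (Cons a as)
  show ?case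
  proof (cases bs)
    case [simp]: (Cons b bs')
    show ?thesis
    proof
      assume "bc_list (a # as) bs c c'"
      then obtain c\<^sub>1 where c1: "sq a b c c\<^sub>1" "bc_list as bs' c\<^sub>1 c'" by auto
      then obtain cs where cs: "length cs = Suc (length as)" "cs ! 0 = c\<^sub>1" "last cs = c'"
        "length bs' = length as" "\<forall>c \<in> set cs. coc c"
        "\<forall>i < length as. sq (as ! i) (bs' ! i) (cs ! i) (cs ! Suc i)"
        using Cons.IH by blast
      show "\<exists>cs. length cs = Suc (length (a # as)) \<and> cs ! 0 = c \<and> last cs = c' \<and>
          length bs = length (a # as) \<and> (\<forall>c \<in> set cs. coc c) \<and>
          (\<forall>i < length (a # as). sq ((a # as) ! i) (bs ! i) (cs ! i) (cs ! Suc i))"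
        using cs c1 sq_Hom[OF c1(1)] by (intro exI[of _ "c # cs"]) (auto simp: less_Suc_eq_0_disj)
    next
      assume "\<exists>cs. length cs = Suc (length (a # as)) \<and> cs ! 0 = c \<and> last cs = c' \<and>
          length bs = length (a # as) \<and> (\<forall>c \<in> set cs. coc c) \<and>
          (\<forall>i < length (a # as). sq ((a # as) ! i) (bs ! i) (cs ! i) (cs ! Suc i))"
      then obtain cs where cs: "length cs = Suc (Suc (length as))" "cs ! 0 = c" "last cs = c'"
        "length bs' = length as" "\<forall>c \<in> set cs. coc c"
        "\<forall>i < Suc (length as). sq ((a # as) ! i) (bs ! i) (cs ! i) (cs ! Suc i)" by auto
      then obtain cs' where cs': "cs = c # cs'" by (cases cs) auto
      have "bc_list as bs' (cs' ! 0) c'"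
        unfolding Cons.IH
      proof (intro exI conjI allI impI)
        show "last cs' = c'" using cs cs' by (auto split: if_splits)
        fix i assume "i < length as"
        then show "sq (as ! i) (bs' ! i) (cs' ! i) (cs' ! Suc i)"
          using cs(6)[rule_format, of "Suc i"] cs' by simp
      qed (use cs cs' in auto)
      moreover have "sq a b c (cs' ! 0)" using cs(6)[rule_format, of 0] cs(2) cs' by simp
      ultimately show "bc_list (a # as) bs c c'" by auto
    qed
  qed simp
qed

lemma base_change_iff: "base_change C A f as bs \<longleftrightarrow> as \<noteq> [] \<and> (\<exists>c c'. bc_list as bs c c')"
proof
  assume *: "base_change C A f as bs"
  then obtain cs where cs: "length cs = Suc (length as)" "\<forall>c \<in> set cs. coc c"
    and l: "length bs = length as"
    and h: "\<forall>i < length as.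
           cs ! i \<in> Hom A (Dom A (as ! i)) (Dom A (bs ! i)) \<and>
           cs ! Suc i \<in> Hom A (Cod A (as ! i)) (Cod A (bs ! i)) \<and>
           bs ! i \<cdot>\<^bsub>A\<^esub> cs ! i = cs ! Suc i \<cdot>\<^bsub>A\<^esub> as ! i"
    by (auto simp: base_change_def coc_def)
  have ch: "chain S as" "chain S' bs" using * HomD[OF f] by (auto simp: base_change_def)
  have "sq (as ! i) (bs ! i) (cs ! i) (cs ! Suc i)" if i: "i < length as" for i
  proof -
    have "as ! i \<in> Arr S" "bs ! i \<in> Arr S'"
      using ch i l unfolding chain_def by (metis nth_mem subsetD)+
    moreover have "coc (cs ! i)" "coc (cs ! Suc i)" using cs i by auto
    ultimately show ?thesis using h[rule_format, OF i] by (simp add: sq_def Hom_def)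
  qed
  then have "bc_list as bs (cs ! 0) (last cs)"
    using cs l by (auto simp: bc_list_iff)
  then show "as \<noteq> [] \<and> (\<exists>c c'. bc_list as bs c c')"
    using ch by (auto simp: chain_def)
next
  assume "as \<noteq> [] \<and> (\<exists>c c'. bc_list as bs c c')"
  then obtain cs where as: "as \<noteq> []" and cs: "length cs = Suc (length as)" "\<forall>c \<in> set cs. coc c"
    "length bs = length as" and h: "\<forall>i < length as. sq (as ! i) (bs ! i) (cs ! i) (cs ! Suc i)"
    by (auto simp: bc_list_iff)
  have H: "as ! i \<in> Hom S (Dom A (cs ! i)) (Dom A (cs ! Suc i))"
    "bs ! i \<in> Hom S' (Cod A (cs ! i)) (Cod A (cs ! Suc i))" if "i < length as" for i
    using sq_Hom h that by blast+
  have "chain S as"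
    unfolding chain_def
  proof (intro conjI allI impI subsetI)
    fix i assume "Suc i < length as"
    then show "Cod S (as ! i) = Dom S (as ! Suc i)"
      using HomD(3)[OF H(1), of i] HomD(2)[OF H(1), of "Suc i"] by simp
  next
    fix a assume "a \<in> set as"
    then show "a \<in> Arr S" using HomD(1)[OF H(1)] by (metis in_set_conv_nth)
  qed (rule as)
  moreover have "chain S' bs"
    unfolding chain_def
  proof (intro conjI allI impI subsetI)
    fix i assume "Suc i < length bs"
    then show "Cod S' (bs ! i) = Dom S' (bs ! Suc i)"
      using HomD(3)[OF H(2), of i] HomD(2)[OF H(2), of "Suc i"] cs by simp
  next
    fix a assume "a \<in> set bs"
    then show "a \<in> Arr S'" using HomD(1)[OF H(2)] cs(3) by (metis in_set_conv_nth)
  qed (use as cs in auto)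
  moreover have "cs ! i \<in> Hom A (Dom A (as ! i)) (Dom A (bs ! i)) \<and>
           cs ! Suc i \<in> Hom A (Cod A (as ! i)) (Cod A (bs ! i)) \<and>
           bs ! i \<cdot>\<^bsub>A\<^esub> cs ! i = cs ! Suc i \<cdot>\<^bsub>A\<^esub> as ! i" if i: "i < length as" for i
  proof -
    have "coc (cs ! i)" "coc (cs ! Suc i)" using cs i by auto
    then show ?thesis
      using h[rule_format, OF i] coc_Hom[of "cs ! i"] coc_Hom[of "cs ! Suc i"]
      unfolding fibre_HomD[OF H(1)[OF i]] fibre_HomD[OF H(2)[OF i]] by (simp add: sq_def)
  qed
  ultimately show "base_change C A f as bs"
    using cs as HomD[OF f] unfolding base_change_def coc_def by blast
qed

end

section \<open>Isomorphisms and the trivial short exact sequence\<close>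

lemma (in abelian) mono_epi_inverse:
  assumes a: "mono_arrow A a" "epi_arrow A a" "a \<in> Hom A x y"
  obtains s where "s \<in> Hom A y x" "s \<cdot> a = Ident A x" "a \<cdot> s = Ident A y"
proof -
  have y: "y \<in> Obj A" "x \<in> Obj A" using Hom_Obj[OF a(3)] by auto
  \<comment> \<open>The cokernel arrow of an epi is zero, and the mono \<open>a\<close> is its
    kernel; so the identity of \<open>y\<close> lifts along \<open>a\<close>.\<close>
  obtain z b where b: "b \<in> Hom A y z" "is_cokernel A a b" using cokernel_exists[OF a(3)] .
  have ses: "is_kernel A b a" using mono_is_kernel_of_cokernel[OF a(1) b(2)] .
  have "b \<cdot> a = \<zero>(x,z)" using is_kernel_Hom[OF ses] HomD[OF a(3)] HomD[OF b(1)] by simp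
  then have "b \<cdot> Ident A y = \<zero>(y,z)"
    using epi_zero[OF a(2,3) b(1)] Cmp_Ident_right[OF b(1)] by simp
  then obtain s where s: "s \<in> Hom A y x" "a \<cdot> s = Ident A y"
    using is_kernel_lift[OF ses a(3) Ident_Hom[OF y(1)]] HomD[OF b(1)] by metis
  have "a \<cdot> (s \<cdot> a) = a \<cdot> Ident A x"
    using Cmp_assoc[OF a(3) s(1) a(3)] s Cmp_Ident_left[OF a(3)] Cmp_Ident_right[OF a(3)] by simp
  then have "s \<cdot> a = Ident A x"
    using mono_cancel[OF a(1,3) Cmp_Hom[OF a(3) s(1)] Ident_Hom] y by simp
  then show ?thesis using that s by blast
qed

lemma (in abelian) inverse_mono_epi:
  assumes a: "a \<in> Hom A x y" and s: "s \<in> Hom A y x"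
    and "s \<cdot> a = Ident A x" "a \<cdot> s = Ident A y"
  shows "mono_arrow A a" "epi_arrow A a"
proof -
  have "mono_arrow A (Ident A x)" "epi_arrow A (Ident A y)"
    using monoI[OF Ident_Hom[of x]] epiI[OF Ident_Hom[of y]] Hom_Obj[OF a]
      Cmp_Ident_left Cmp_Ident_right by auto
  then show "mono_arrow A a" "epi_arrow A a"
    using mono_comp_mono[OF _ a s] epi_comp_epi[OF _ s a] assms by auto
qed

lemma (in abelian) zero_Ident_short_exact:
  assumes "z \<in> Obj A" "x \<in> Obj A" and 0: "Ident A z = \<zero>(z,z)"
  shows "short_exact A (\<zero>(z,x)) (Ident A x)"
proof (rule short_exactI_epi)
  note I = Ident_Hom[OF assms(2)] and Z = zero_Hom[OF assms(1,2)]
  show "epi_arrow A (Ident A x)" using inverse_mono_epi(2)[OF I I] Cmp_Ident_left[OF I] by simp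
  show "is_kernel A (Ident A x) (\<zero>(z,x))"
  proof (rule is_kernelI[OF I Z])
    show "Ident A x \<cdot> \<zero>(z,x) = \<zero>(z,x)" using Cmp_Ident_left[OF Z] .
    show "mono_arrow A (\<zero>(z,x))"
    proof (rule monoI[OF Z])
      fix w u assume u: "u \<in> Hom A w z"
      show "u = \<zero>(w,z)" using Cmp_Ident_left[OF u] 0 zero_comp[OF u] assms by simp
    qed
    fix w h assume h: "h \<in> Hom A w x" "Ident A x \<cdot> h = \<zero>(w,x)"
    have w: "w \<in> Obj A" using Hom_Obj[OF h(1)] by simp
    have "\<zero>(z,x) \<cdot> \<zero>(w,z) = h"
      using comp_zero[OF Z] w h Cmp_Ident_left[OF h(1)] by simp
    then show "\<exists>u\<in>Hom A w z. \<zero>(z,x) \<cdot> u = h"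
      using zero_Hom[OF w assms(1)] by blast
  qed
qed

section \<open>Exact sequences under base change\<close>

context base_change_arrow
begin

lemma preserved_exactD:
  assumes "preserved_exact C A T as" "bc_list as bs c c'" "as \<noteq> []"
  shows "exact_sequence S' bs"
  using assms f T_Obj base_change_iff unfolding preserved_exact_def by blast

lemma preserved_short_exactD:
  assumes "preserved_exact C A T [a\<^sub>1, a\<^sub>2]" "sq a\<^sub>1 b\<^sub>1 c c\<^sub>1" "sq a\<^sub>2 b\<^sub>2 c\<^sub>1 c'"
  shows "short_exact S' b\<^sub>1 b\<^sub>2"
  using preserved_exactD[OF assms(1), of "[b\<^sub>1, b\<^sub>2]" c c'] assms(2,3) unfolding bc_list_pair by blast

lemma bc_list_appendI:
  "bc_list as bs c c\<^sub>1 \<Longrightarrow> bc_list as' bs' c\<^sub>1 c' \<Longrightarrow> bc_list (as @ as') (bs @ bs') c c'"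
  by (auto simp: bc_list_append_left)

lemma sq_epi:
  assumes "BC1 C A T" "epi_arrow S a" "sq a b c c'"
  shows "epi_arrow S' b"
proof -
  have "base_change C A f [a] [b]" 
    unfolding base_change_iff bc_list_singleton using assms(3) by blast
  then show ?thesis using assms f T_Obj unfolding BC1_def by blast
qed

lemma sq_exists_Hom:
  assumes "a \<in> Hom S x y" "coc c" "Dom A c = x" "coc c'" "Dom A c' = y"
  obtains b where "sq a b c c'"
  using sq_exists assms by metis

text \<open>The universal property of \<open>c'\<close> gives an arrow back. Both composites agree
  with identities after \<open>c\<close> or \<open>c'\<close>, where arrows of the fibre can be
  cancelled.\<close>

lemma coc_isomorphic:
  assumes c: "coc c" and c': "coc c'" and eq: "Dom A c = Dom A c'"
    and u: "u \<in> Hom S' (Cod A c) (Cod A c')" "u \<cdot>\<^bsub>A\<^esub> c = c'"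
  obtains v where "v \<in> Hom S' (Cod A c') (Cod A c)" "v \<cdot>\<^bsub>S'\<^esub> u = Ident S' (Cod A c)"
    "u \<cdot>\<^bsub>S'\<^esub> v = Ident S' (Cod A c')"
proof -
  note cH = coc_Hom[OF c] and c'H = coc_Hom[OF c']
  have fc: "PArr A c = f" "PArr A c' = f" using c c' by (auto simp: coc_def)
  obtain v where v: "v \<in> Hom S' (Cod A c') (Cod A c)" "v \<cdot>\<^bsub>A\<^esub> c' = c"
    using coc_factor[OF c', of c "Cod A c"] cH eq fc by auto
  note uH = fibre_HomD(5)[OF u(1)] and vH = fibre_HomD(5)[OF v(1)]
  have I: "Ident S' (Cod A c) \<in> Hom S' (Cod A c) (Cod A c)"
    "Ident S' (Cod A c') \<in> Hom S' (Cod A c') (Cod A c')"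
    using S'.Ident_Hom coc_Obj[OF c] coc_Obj[OF c'] by auto
  have "(v \<cdot>\<^bsub>S'\<^esub> u) \<cdot>\<^bsub>A\<^esub> c = Ident S' (Cod A c) \<cdot>\<^bsub>A\<^esub> c"
    using A.Cmp_assoc[OF cH uH vH] u v A.Cmp_Ident_left[OF cH] by (simp add: fibre_Cmp)
  then have "v \<cdot>\<^bsub>S'\<^esub> u = Ident S' (Cod A c)"
    using coc_cancel[OF c S'.Cmp_Hom[OF u(1) v(1)] I(1)] by simp
  moreover have "(u \<cdot>\<^bsub>S'\<^esub> v) \<cdot>\<^bsub>A\<^esub> c' = Ident S' (Cod A c') \<cdot>\<^bsub>A\<^esub> c'"
    using A.Cmp_assoc[OF _ vH uH, of c' "Dom A c'"] c'H u v A.Cmp_Ident_left[OF c'H]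
    by (simp add: fibre_Cmp)
  then have "u \<cdot>\<^bsub>S'\<^esub> v = Ident S' (Cod A c')"
    using coc_cancel[OF c' S'.Cmp_Hom[OF v(1) u(1)] I(2)] by simp
  ultimately show ?thesis using that v by blast
qed

text \<open>The two ends may carry different cocartesian arrows out of \<open>x\<close>, so a base
  change of an identity need not be an identity; it is the comparison isomorphism of the
  two.\<close>

lemma sq_Ident:
  assumes "sq (Ident A x) b c c'" "x \<in> Obj S"
  shows "mono_arrow S' b" "epi_arrow S' b"
proof -
  note h = sq_Hom[OF assms(1)]
  have I: "Ident A x \<in> Hom S x x" using S.Ident_Hom[OF assms(2)] by simp
  have x: "Dom A c = x" "Dom A c' = x"
    using fibre_HomD(1,2)[OF h(1)] fibre_HomD(1,2)[OF I] by simp_all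
  then have "b \<cdot>\<^bsub>A\<^esub> c = c'"
    using assms(1) A.Cmp_Ident_right[OF coc_Hom[OF h(4)]] by (simp add: sq_def)
  then obtain v where "v \<in> Hom S' (Cod A c') (Cod A c)" "v \<cdot>\<^bsub>S'\<^esub> b = Ident S' (Cod A c)"
    "b \<cdot>\<^bsub>S'\<^esub> v = Ident S' (Cod A c')"
      using coc_isomorphic[OF h(3,4) _ h(2)] x by metis
  then show "mono_arrow S' b" "epi_arrow S' b" using S'.inverse_mono_epi[OF h(2)] by auto
qed

context
  fixes x y z x' y' i p i' p' a b
  assumes ses: "short_exact S i p" and i: "i \<in> Hom S x y" and p: "p \<in> Hom S y z"
    and ses': "short_exact S i' p'" and i': "i' \<in> Hom S x' y'" and p': "p' \<in> Hom S y' z"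
    and a: "a \<in> Hom S x x'" and b: "b \<in> Hom S y y'"
    and sq: "b \<cdot>\<^bsub>S\<^esub> i = i' \<cdot>\<^bsub>S\<^esub> a" and tri: "p' \<cdot>\<^bsub>S\<^esub> b = p"
    and pre: "preserved_exact C A T [i, p]" and pre': "preserved_exact C A T [i', p']"
begin

lemma rows_base_change:
  assumes bb: "sq b bb cy cy'" and cx: "coc cx" "Dom A cx = x" and cx': "coc cx'" "Dom A cx' = x'"
  obtains ii pp ii' pp' aa w where "sq i ii cx cy" "sq i' ii' cx' cy'" "sq a aa cx cx'"
    "short_exact S' ii pp" "pp \<in> Hom S' (Cod A cy) w"
    "short_exact S' ii' pp'" "pp' \<in> Hom S' (Cod A cy') w"
    "bb \<cdot>\<^bsub>S'\<^esub> ii = ii' \<cdot>\<^bsub>S'\<^esub> aa" "pp' \<cdot>\<^bsub>S'\<^esub> bb = pp"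
proof -
  note h = sq_Hom[OF bb]
  have y: "Dom A cy = y" "Dom A cy' = y'"
    using fibre_HomD(1,2)[OF h(1)] fibre_HomD(1,2)[OF b] by simp_all
  \<comment> \<open>One cocartesian arrow at \<open>z\<close> serves both rows; this is what keeps
    the identity on the cokernel after base change.\<close>
  obtain cz where cz: "coc cz" "Dom A cz = z" using coc_exists S.Hom_Obj(2)[OF p] by blast
  obtain ii where ii: "sq i ii cx cy" using sq_exists_Hom[OF i cx h(3) y(1)] .
  obtain pp where pp: "sq p pp cy cz" using sq_exists_Hom[OF p h(3) y(1) cz] .
  obtain ii' where ii': "sq i' ii' cx' cy'" using sq_exists_Hom[OF i' cx' h(4) y(2)] .
  obtain pp' where pp': "sq p' pp' cy' cz" using sq_exists_Hom[OF p' h(4) y(2) cz] .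
  obtain aa where aa: "sq a aa cx cx'" using sq_exists_Hom[OF a cx cx'] .
  have "short_exact S' ii pp" using preserved_short_exactD[OF pre ii pp] .
  moreover have "short_exact S' ii' pp'"
    using preserved_short_exactD[OF pre' ii' pp'] .
  moreover have "bb \<cdot>\<^bsub>S'\<^esub> ii = ii' \<cdot>\<^bsub>S'\<^esub> aa"
    using sq_comp_eq[OF aa ii'] sq_comp[OF ii bb] sq by simp
  moreover have "pp' \<cdot>\<^bsub>S'\<^esub> bb = pp" using sq_comp_eq[OF bb pp'] pp tri by simp
  ultimately show ?thesis using that ii ii' aa sq_Hom[OF pp] sq_Hom[OF pp'] by blast
qed

text \<open>A base change of the column \<open>[b, q']\<close> extends to the whole diagram, by
  choosing cocartesian arrows at the other objects. The rows and the column \<open>[a, q]\<close>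
  stay exact by assumption, so \<open>rows_short_exact_mono\<close> applies again over
  \<open>T'\<close>.\<close>

lemma rows_mono_base_change:
  assumes q: "q \<in> Hom S x' n" and q': "q' \<in> Hom S y' n" "q' \<cdot>\<^bsub>S\<^esub> i' = q"
    "q' \<cdot>\<^bsub>S\<^esub> b = zero_arrow S y n"
    and prea: "preserved_exact C A T [a, q]" and bc: "bc_list [b, q'] bs c c'"
  shows "exact_sequence S' bs"
proof -
  obtain bb qq cy' where bs: "bs = [bb, qq]" and bb: "sq b bb c cy'" and qq: "sq q' qq cy' c'"
    using bc by (auto simp: bc_list_pair)
  note h = sq_Hom[OF bb] and hq = sq_Hom[OF qq]
  have y: "Dom A c = y" "Dom A cy' = y'" "Dom A c' = n"
    using fibre_HomD(1,2)[OF h(1)] fibre_HomD(1,2)[OF b] fibre_HomD(1,2)[OF hq(1)] fibre_HomD(1,2)[OF q'(1)] by simp_all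
  obtain cx where cx: "coc cx" "Dom A cx = x" using coc_exists S.Hom_Obj(1)[OF i] by blast
  obtain cx' where cx': "coc cx'" "Dom A cx' = x'" using coc_exists S.Hom_Obj(1)[OF i'] by blast
  obtain ii pp ii' pp' aa w where r: "sq i ii cx c" "sq i' ii' cx' cy'" "sq a aa cx cx'"
    "short_exact S' ii pp" "pp \<in> Hom S' (Cod A c) w"
    "short_exact S' ii' pp'" "pp' \<in> Hom S' (Cod A cy') w"
    "bb \<cdot>\<^bsub>S'\<^esub> ii = ii' \<cdot>\<^bsub>S'\<^esub> aa" "pp' \<cdot>\<^bsub>S'\<^esub> bb = pp"
    using rows_base_change[OF bb cx cx'] .
  obtain q0 where q0: "sq q q0 cx' c'" using sq_exists_Hom[OF q cx' hq(4) y(3)] .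
  have "short_exact S' aa q0" using preserved_short_exactD[OF prea r(3) q0] .
  moreover have "qq \<cdot>\<^bsub>S'\<^esub> ii' = q0" using sq_comp_eq[OF r(2) qq] q0 q' by simp
  moreover have "qq \<cdot>\<^bsub>S'\<^esub> bb = zero_arrow S' (Cod A c) (Cod A c')"
    using sq_comp_zero[OF bb qq] q' y by simp
  ultimately show ?thesis
    using S'.rows_short_exact_mono[OF r(4) sq_Hom(2)[OF r(1)] r(5,6) sq_Hom(2)[OF r(2)] r(7)
        sq_Hom(2)[OF r(3)] h(2) r(8,9) _ sq_Hom(2)[OF q0] hq(2)] bs by simp
qed

text \<open>Same extension to the whole diagram. The given base change of \<open>i \<cdot> k\<close>
  is the composite of those of \<open>k\<close> and \<open>i\<close>, by uniqueness.\<close>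

lemma rows_epi_base_change:
  assumes k: "k \<in> Hom S m x" and prea: "preserved_exact C A T [k, a]"
    and bc: "bc_list [i \<cdot>\<^bsub>S\<^esub> k, b] bs c c'"
  shows "exact_sequence S' bs"
proof -
  obtain kk bb cy where bs: "bs = [kk, bb]" and kk: "sq (i \<cdot>\<^bsub>S\<^esub> k) kk c cy" and bb: "sq b bb cy c'"
    using bc by (auto simp: bc_list_pair)
  note h = sq_Hom[OF bb] and hk = sq_Hom[OF kk]
  have y: "Dom A c = m"
    using fibre_HomD(1,2)[OF hk(1)] fibre_HomD(1,2)[OF S.Cmp_Hom[OF k i]] by simp_all
  obtain cx where cx: "coc cx" "Dom A cx = x" using coc_exists S.Hom_Obj(1)[OF i] by blast
  obtain cx' where cx': "coc cx'" "Dom A cx' = x'" using coc_exists S.Hom_Obj(1)[OF i'] by blast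
  obtain ii pp ii' pp' aa w where r: "sq i ii cx cy" "sq i' ii' cx' c'" "sq a aa cx cx'"
    "short_exact S' ii pp" "pp \<in> Hom S' (Cod A cy) w"
    "short_exact S' ii' pp'" "pp' \<in> Hom S' (Cod A c') w"
    "bb \<cdot>\<^bsub>S'\<^esub> ii = ii' \<cdot>\<^bsub>S'\<^esub> aa" "pp' \<cdot>\<^bsub>S'\<^esub> bb = pp"
    using rows_base_change[OF bb cx cx'] .
  obtain k0 where k0: "sq k k0 c cx" using sq_exists_Hom[OF k hk(3) y cx] .
  have "short_exact S' k0 aa" using preserved_short_exactD[OF prea k0 r(3)] .
  moreover have "kk = ii \<cdot>\<^bsub>S'\<^esub> k0" using sq_comp_eq[OF k0 r(1) kk] .
  ultimately show ?thesis
    using S'.rows_short_exact_epi[OF r(4) sq_Hom(2)[OF r(1)] r(5,6) sq_Hom(2)[OF r(2)] r(7)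
        sq_Hom(2)[OF r(3)] h(2) r(8,9) _ sq_Hom(2)[OF k0]] bs by simp
qed

end

text \<open>A cocartesian arrow at the syzygy \<open>y\<close> splits a base change of the spliced
  sequence into base changes of the two pieces, which are spliced again over
  \<open>T'\<close>.\<close>

lemma splice_base_change:
  assumes k: "k \<in> Hom S y z" and e: "e \<in> Hom S x y"
    and pe: "preserved_exact C A T (as @ [e])" and pk: "preserved_exact C A T [k, p]"
    and bc: "bc_list (as @ [k \<cdot>\<^bsub>S\<^esub> e, p]) bs c c'"
  shows "exact_sequence S' bs"
proof -
  obtain bs\<^sub>1 h pp cx cz where bs: "bs = bs\<^sub>1 @ [h, pp]" and b1: "bc_list as bs\<^sub>1 c cx"
    and h: "sq (k \<cdot>\<^bsub>S\<^esub> e) h cx cz" and pp: "sq p pp cz c'"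
    using bc unfolding bc_list_append_left bc_list_pair by blast
  note hh = sq_Hom[OF h]
  have xz: "Dom A cx = x" "Dom A cz = z"
    using fibre_HomD(1,2)[OF hh(1)] fibre_HomD(1,2)[OF S.Cmp_Hom[OF e k]] by simp_all
  obtain cy where cy: "coc cy" "Dom A cy = y" using coc_exists S.Hom_Obj(1)[OF k] by blast
  obtain ee where ee: "sq e ee cx cy" using sq_exists_Hom[OF e hh(3) xz(1) cy] .
  obtain kk where kk: "sq k kk cy cz" using sq_exists_Hom[OF k cy hh(4) xz(2)] .
  have "bc_list (as @ [e]) (bs\<^sub>1 @ [ee]) c cy"
    by (rule bc_list_appendI[OF b1]) (use ee in \<open>unfold bc_list_singleton, blast\<close>)
  then have "exact_sequence S' (bs\<^sub>1 @ [ee])" using preserved_exactD[OF pe] by blast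
  moreover have "short_exact S' kk pp" using preserved_short_exactD[OF pk kk pp] .
  moreover have "h = kk \<cdot>\<^bsub>S'\<^esub> ee" using sq_comp_eq[OF ee kk h] .
  ultimately show ?thesis
    using S'.exact_sequence_splice[OF sq_Hom(2)[OF kk] sq_Hom(2)[OF ee]] bs by simp
qed

context
  fixes as e k p x y z w
  assumes BC1: "BC1 C A T"
    and e: "e \<in> Hom S x y" "epi_arrow S e" and k: "k \<in> Hom S y z" and p: "p \<in> Hom S z w"
    and ex: "exact_sequence S (as @ [e])"
    and pre: "preserved_exact C A T (as @ [k \<cdot>\<^bsub>S\<^esub> e, p])"
begin

text \<open>\<open>kk\<close> is not known to be mono, so the pieces cannot be compared with a
  resolution directly. BC1 makes \<open>ee\<close> epi, and its composite with the preceding arrow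
  is a base change of zero; these are the inputs of \<open>exact_sequence_cut\<close>.\<close>

lemma cut_base_change:
  assumes bs: "bc_list as bs c cx" and ee: "sq e ee cx cy" and kk: "sq k kk cy cz" and pp: "sq p pp cz cw"
  shows "exact_sequence S' (bs @ [ee])" "short_exact S' kk pp"
proof -
  have "bc_list (as @ [k \<cdot>\<^bsub>S\<^esub> e, p]) (bs @ [kk \<cdot>\<^bsub>S'\<^esub> ee, pp]) c cw"
    by (rule bc_list_appendI[OF bs]) (use sq_comp[OF ee kk] pp in \<open>unfold bc_list_pair, blast\<close>)
  then have ex': "exact_sequence S' (bs @ [kk \<cdot>\<^bsub>S'\<^esub> ee, pp])"
    using preserved_exactD[OF pre] by blast
  have z: "ee \<cdot>\<^bsub>S'\<^esub> last bs = zero_arrow S' (Dom S' (last bs)) (Cod A cy)" if "bs \<noteq> []"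
  proof -
    have "as \<noteq> []" using that bc_list_length[OF bs] by auto
    then obtain as\<^sub>0 d where as: "as = as\<^sub>0 @ [d]" by (metis rev_exhaust)
    then obtain bs\<^sub>0 dd cd where b: "bs = bs\<^sub>0 @ [dd]" and dd: "sq d dd cd cx"
      using bs by (auto simp: bc_list_append_left bc_list_singleton)
    have "S.left_exact (as\<^sub>0 @ [d, e])" using ex as S.exact_sequence_snoc[of "as\<^sub>0 @ [d]" e] by simp
    then have "e \<cdot>\<^bsub>S\<^esub> d = zero_arrow S (Dom S d) (Cod S e)"
      using S.exact_pair_comp_zero S.left_exact_snoc by blast
    then have "e \<cdot>\<^bsub>S\<^esub> d = zero_arrow S (Dom A cd) (Dom A cy)"
      unfolding HomD(2)[OF sq_Hom(1)[OF dd]] HomD(3)[OF sq_Hom(1)[OF ee]] .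
    then show ?thesis
      using sq_comp_zero[OF dd ee] b HomD(2)[OF sq_Hom(2)[OF dd]] by (simp del: fibre_sel)
  qed
  show "exact_sequence S' (bs @ [ee])" "short_exact S' kk pp"
    using S'.exact_sequence_cut[OF sq_Hom(2)[OF ee] sq_epi[OF BC1 e(2) ee] sq_Hom(2)[OF kk]
        sq_Hom(2)[OF pp] ex' z] by auto
qed

text \<open>A base change of the left piece is continued to the right by arbitrary cocartesian
  arrows at \<open>z\<close> and \<open>w\<close>.\<close>

lemma cut_left_base_change:
  assumes "bc_list (as @ [e]) bs c cy" shows "exact_sequence S' bs"
proof -
  obtain bs\<^sub>1 ee cx where bs: "bs = bs\<^sub>1 @ [ee]" and b1: "bc_list as bs\<^sub>1 c cx" and ee: "sq e ee cx cy"
    using assms unfolding bc_list_append_left bc_list_singleton by blast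
  note h = sq_Hom[OF ee]
  have y: "Dom A cy = y" using fibre_HomD(1,2)[OF h(1)] fibre_HomD(1,2)[OF e(1)] by simp_all
  obtain cz where cz: "coc cz" "Dom A cz = z" using coc_exists S.Hom_Obj(1)[OF p] by blast
  obtain cw where cw: "coc cw" "Dom A cw = w" using coc_exists S.Hom_Obj(2)[OF p] by blast
  obtain kk where kk: "sq k kk cy cz" using sq_exists_Hom[OF k h(4) y cz] .
  obtain pp where pp: "sq p pp cz cw" using sq_exists_Hom[OF p cz cw] .
  show ?thesis using cut_base_change(1)[OF b1 ee kk pp] bs by simp
qed

text \<open>Here the continuation goes to the left and must end in the given \<open>cy\<close>;
  \<open>bc_list_exists\<close> provides it.\<close>

lemma cut_right_base_change:
  assumes "bc_list [k, p] bs cy cw" shows "exact_sequence S' bs"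
proof -
  obtain kk pp cz where bs: "bs = [kk, pp]" and kk: "sq k kk cy cz" and pp: "sq p pp cz cw"
    using assms by (auto simp: bc_list_pair)
  note h = sq_Hom[OF kk]
  have y: "Dom A cy = y" using fibre_HomD(1,2)[OF h(1)] fibre_HomD(1,2)[OF k] by simp_all
  have "chain S (as @ [e])" using ex by (simp add: exact_sequence_def)
  then obtain bs\<^sub>1 c where "bc_list (as @ [e]) bs\<^sub>1 c cy"
    using bc_list_exists[OF _ h(3), of "as @ [e]"] y fibre_HomD(2)[OF e(1)] by auto
  then obtain bs\<^sub>2 ee cx where "bc_list as bs\<^sub>2 c cx" "sq e ee cx cy"
    unfolding bc_list_append_left bc_list_singleton by blast
  then show ?thesis using cut_base_change(2)[OF _ _ kk pp] bs by blast
qed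

end

end

section \<open>Preserved resolutions and approximations\<close>

context fibred_abelian_cat
begin

lemma preserved_exactI:
  assumes "as \<noteq> []"
    and "\<And>T' f bs c c'. base_change_arrow C A f T T' \<Longrightarrow>
      base_change_arrow.bc_list C A f T T' as bs c c' \<Longrightarrow> exact_sequence (fibre C A T') bs"
  shows "preserved_exact C A T as"
  unfolding preserved_exact_def
proof (intro ballI allI impI)
  fix T' f bs assume f: "f \<in> Hom C T T'" and bc: "base_change C A f as bs"
  interpret base_change_arrow C A f T T' by unfold_locales (rule f)
  obtain c c' where "bc_list as bs c c'" using bc unfolding base_change_iff by auto
  then show "exact_sequence (fibre C A T') bs" by (rule assms(2)[OF base_change_arrow_axioms])
qed

text \<open>Finite preserved resolutions by objects in \<open>X\<close>, built up one syzygy at a time.\<close>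

inductive_set res :: "'t \<Rightarrow> 'o set \<Rightarrow> 'o set" for T X where
  base: "x \<in> X \<Longrightarrow> x \<in> res T X"
| step: "short_exact (fibre C A T) k p \<Longrightarrow> preserved_exact C A T [k, p] \<Longrightarrow> Dom A k \<in> res T X \<Longrightarrow>
    Cod A k \<in> X \<Longrightarrow> Cod A p \<in> res T X"

text \<open>The first syzygy \<open>Dom A k\<close> has the shorter sequence
  \<open>ds @ [e]\<close>. BC1, through the two cut lemmas, makes both pieces preserved, so the
  induction hypothesis and \<open>res.step\<close> apply.\<close>

lemma exact_sequence_res:
  assumes T: "T \<in> Obj C" and BC1: "BC1 C A T"
    and iso: "\<And>a. iso_arrow A a \<Longrightarrow> Dom A a \<in> X \<Longrightarrow> a \<in> Arr (fibre C A T) \<Longrightarrow> Cod A a \<in> X"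
    and "exact_sequence (fibre C A T) as" "preserved_exact C A T as" "\<forall>a \<in> set as. Dom A a \<in> X"
  shows "Cod A (last as) \<in> res T X"
  using assms(4-6)
proof (induction "length as" arbitrary: as)
  case 0
  then show ?case by (simp add: exact_sequence_def chain_def)
next
  case (Suc n)
  interpret S: abelian "fibre C A T" using fibre_abelian[OF T] .
  show ?case
  proof (cases n)
    \<comment> \<open>A resolution with one term is an arrow that is mono and epi, hence an
      isomorphism out of an object of \<open>X\<close>; closure under isomorphism is used
      here.\<close>
    case 0
    then obtain a where as: "as = [a]" using Suc.hyps(2) by (metis length_0_conv length_Suc_conv)
    then have a: "mono_arrow (fibre C A T) a" "epi_arrow (fibre C A T) a" "a \<in> Arr (fibre C A T)"
      using Suc.prems(1) by (auto simp: exact_sequence_def chain_def)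
    obtain s where s: "s \<in> Hom (fibre C A T) (Cod A a) (Dom A a)"
      "s \<cdot>\<^bsub>A\<^esub> a = Ident A (Dom A a)" "a \<cdot>\<^bsub>A\<^esub> s = Ident A (Cod A a)"
      using S.mono_epi_inverse[OF a(1,2) Arr_Hom[OF a(3)]] by (auto simp: fibre_Cmp)
    then have "iso_arrow A a" unfolding iso_arrow_def using a(3) fibre_HomD(5)[OF s(1)] s by auto
    then show ?thesis using iso a(3) as Suc.prems(3) res.base by simp
  next
    case (Suc m)
    then obtain ds a p where as: "as = ds @ [a, p]"
      using Suc.hyps(2) by (cases as rule: rev_cases; cases "butlast as" rule: rev_cases) auto
    note ex = Suc.prems(1)[unfolded as]
    have L: "S.left_exact (ds @ [a])" "exact_pair (fibre C A T) a p" "epi_arrow (fibre C A T) p"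
      using ex S.exact_sequence_snoc[of "ds @ [a]" p] S.left_exact_snoc by auto
    then obtain k e where k: "is_kernel (fibre C A T) p k" and e: "epi_arrow (fibre C A T) e"
      and eH: "e \<in> Hom (fibre C A T) (Dom A a) (Dom A k)" and a: "k \<cdot>\<^bsub>fibre C A T\<^esub> e = a"
      by (auto simp: S.exact_pair_iff)
    have ses: "short_exact (fibre C A T) k p" using S.short_exactI_epi L(3) k .
    note kH = S.short_exact_Hom[OF ses, simplified fibre_sel]
    note km = S.short_exactD(1)[OF ses kH]
    have ex_e: "exact_sequence (fibre C A T) (ds @ [e])"
      using S.exact_sequence_snoc L(1) e S.left_exact_mono_comp[OF km kH(1) eH] a by blast
    have pre: "preserved_exact C A T (ds @ [k \<cdot>\<^bsub>fibre C A T\<^esub> e, p])"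
      using Suc.prems(2) as a by simp
    have "preserved_exact C A T (ds @ [e])"
      by (rule preserved_exactI[rotated])
        (rule base_change_arrow.cut_left_base_change[OF _ BC1 eH e kH ex_e pre], assumption+, simp)
    moreover have "Dom A e = Dom A a" using fibre_HomD[OF eH] by simp
    ultimately have "Cod A (last (ds @ [e])) \<in> res T X"
      using Suc.hyps(1)[of "ds @ [e]"] ex_e Suc.hyps(2) Suc.prems(3) as by simp
    then have "Dom A k \<in> res T X" using fibre_HomD[OF eH] by simp
    moreover have "preserved_exact C A T [k, p]"
      by (rule preserved_exactI[rotated])
        (rule base_change_arrow.cut_right_base_change[OF _ BC1 eH e kH ex_e pre], assumption+, simp)
    moreover have "Cod A k \<in> X"
      using Suc.prems(3) as k by (auto simp: is_kernel_def)
    ultimately show ?thesis using res.step ses as by simp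
  qed
qed

text \<open>An object of \<open>X\<close> is resolved by its identity, whose base changes are
  isomorphisms; a further syzygy is spliced on, and splicing commutes with base change.\<close>

lemma res_exact_sequence:
  assumes T: "T \<in> Obj C" and X: "X \<subseteq> Obj (fibre C A T)" and "N \<in> res T X"
  shows "\<exists>as. exact_sequence (fibre C A T) as \<and> preserved_exact C A T as \<and> Cod A (last as) = N \<and>
    (\<forall>a \<in> set as. Dom A a \<in> X)"
  using assms(3)
proof induction
  case (base x)
  interpret S: abelian "fibre C A T" using fibre_abelian[OF T] .
  have x: "x \<in> Obj (fibre C A T)" using base X by blast
  have I: "Ident A x \<in> Hom (fibre C A T) x x" using S.Ident_Hom[OF x] by simp
  have "exact_sequence (fibre C A T) [Ident A x]"
    using S.exact_sequence_snoc[of "[]"] S.left_exact_singleton S.inverse_mono_epi[OF I I]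
      S.Cmp_Ident_left[OF I] by simp
  moreover have "preserved_exact C A T [Ident A x]"
  proof (rule preserved_exactI)
    fix T' f bs c c' assume "base_change_arrow C A f T T'"
    then interpret base_change_arrow C A f T T' .
    assume "bc_list [Ident A x] bs c c'"
    then obtain b where b: "bs = [b]" "sq (Ident A x) b c c'" unfolding bc_list_singleton by blast
    then show "exact_sequence (fibre C A T') bs"
      using S'.exact_sequence_snoc[of "[]"] S'.left_exact_singleton sq_Ident[OF b(2) x] by simp
  qed simp
  ultimately show ?case using base fibre_HomD[OF I] by (intro exI[of _ "[Ident A x]"]) simp
next
  case (step k p)
  interpret S: abelian "fibre C A T" using fibre_abelian[OF T] .
  obtain as where as: "exact_sequence (fibre C A T) as" "preserved_exact C A T as"
    "Cod A (last as) = Dom A k" "\<forall>a \<in> set as. Dom A a \<in> X" using step.IH by blast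
  then have "as \<noteq> []" by (simp add: exact_sequence_def chain_def)
  then obtain ds e where ds: "as = ds @ [e]" by (metis rev_exhaust)
  note kH = S.short_exact_Hom[OF step.hyps(1), simplified fibre_sel]
  have e: "e \<in> Hom (fibre C A T) (Dom A e) (Dom A k)"
    using as ds by (auto simp: exact_sequence_def chain_def Hom_def)
  have "exact_sequence (fibre C A T) (ds @ [k \<cdot>\<^bsub>fibre C A T\<^esub> e, p])"
    using S.exact_sequence_splice[OF kH(1) e _ step.hyps(1)] as ds by simp
  moreover have "preserved_exact C A T (ds @ [k \<cdot>\<^bsub>fibre C A T\<^esub> e, p])"
    by (rule preserved_exactI[rotated])
      (rule base_change_arrow.splice_base_change[OF _ kH(1) e as(2)[unfolded ds] step.hyps(2)], assumption+, simp)
  moreover have "Dom A p = Cod A k" using fibre_HomD[OF kH(2)] by simp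
  ultimately show ?case
    using as ds step.hyps fibre_HomD[OF S.Cmp_Hom[OF e kH(1)]]
    by (intro exI[of _ "ds @ [k \<cdot>\<^bsub>fibre C A T\<^esub> e, p]"]) auto
qed

lemma approximation_hull:
  fixes X D :: "('o, 'a, 't, 'b) fcat"
  assumes T: "T \<in> Obj C" and BC2: "BC2 C A X T"
    and AB2: "AB2 (fibre C A T) (fibre C X T) (fibre C D T)"
    and ses: "short_exact (fibre C A T) l m" and pre: "preserved_exact C A T [l, m]"
    and l: "Dom A l \<in> res T (Obj (fibre C D T))" "Cod A l \<in> Obj (fibre C X T)"
  obtains j q where "short_exact (fibre C A T) j q" "preserved_exact C A T [j, q]"
    "Dom A j = Cod A m" "Cod A j \<in> res T (Obj (fibre C D T))" "Cod A q \<in> Obj (fibre C X T)"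
proof -
  interpret S: abelian "fibre C A T" using fibre_abelian[OF T] .
  let ?S = "fibre C A T"
  note lH = S.short_exact_Hom[OF ses, simplified fibre_sel]
  obtain i p where ip: "short_exact ?S i p" "Dom A i = Cod A l" "Cod A i \<in> Obj (fibre C D T)"
    "Cod A p \<in> Obj (fibre C X T)"
    using AB2 l(2) unfolding AB2_def fibre_sel(1,2) by blast
  note iH = S.short_exact_Hom[OF ip(1), simplified fibre_sel ip(2)]
  obtain y i' p' b where s: "short_exact ?S i' p'" "i' \<in> Hom ?S (Cod A m) y" "p' \<in> Hom ?S y (Cod A p)"
    "b \<in> Hom ?S (Cod A i) y" "b \<cdot>\<^bsub>?S\<^esub> i = i' \<cdot>\<^bsub>?S\<^esub> m" "p' \<cdot>\<^bsub>?S\<^esub> b = p"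
    using S.pushout_short_exact[OF ip(1) iH lH(2)] .
  \<comment> \<open>Both rows end in \<open>Cod A p\<close>, which lies in \<open>X\<close>, so BC2
    covers the pushed out row as well.\<close>
  have pre_i: "preserved_exact C A T [i, p]" "preserved_exact C A T [i', p']"
    using BC2 ip s(1) fibre_HomD(2)[OF s(3)] unfolding BC2_def by auto
  have "short_exact ?S (i \<cdot>\<^bsub>?S\<^esub> l) b"
    using S.rows_short_exact_epi[OF ip(1) iH s(1-3) lH(2) s(4-6) ses lH(1)] .
  moreover have "preserved_exact C A T [i \<cdot>\<^bsub>?S\<^esub> l, b]"
    by (rule preserved_exactI[rotated])
      (rule base_change_arrow.rows_epi_base_change[OF _ ip(1) iH s(1-3) lH(2) s(4-6) pre_i lH(1) pre], assumption+, simp)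
  moreover note fibre_HomD(1,2)[OF S.Cmp_Hom[OF lH(1) iH(1)]]
  \<comment> \<open>The kernel of \<open>b\<close> is \<open>Dom A l\<close>, whose preserved
    resolution is lengthened by the object \<open>Cod A i\<close> of \<open>D\<close>.\<close>
  ultimately have "Cod A b \<in> res T (Obj (fibre C D T))" using res.step l(1) ip(3) by metis
  then show ?thesis
    using that[OF s(1) pre_i(2)] fibre_HomD(1,2)[OF s(2)] fibre_HomD(2)[OF s(3)] fibre_HomD(2)[OF s(4)] ip(4)
    by simp
qed

lemma res_approximation:
  fixes X D :: "('o, 'a, 't, 'b) fcat"
  assumes T: "T \<in> Obj C" and BC2: "BC2 C A X T" and AB1: "AB1 (fibre C A T) (fibre C X T)"
    and AB2: "AB2 (fibre C A T) (fibre C X T) (fibre C D T)"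
    and XA: "Obj (fibre C X T) \<subseteq> Obj (fibre C A T)"
    and z: "z \<in> Obj (fibre C D T)" "z \<in> Obj (fibre C A T)" "Ident A z = zero_arrow (fibre C A T) z z"
    and "N \<in> res T (Obj (fibre C X T))"
  shows "\<exists>i p. short_exact (fibre C A T) i p \<and> preserved_exact C A T [i, p] \<and>
    Dom A i \<in> res T (Obj (fibre C D T)) \<and> Cod A i \<in> Obj (fibre C X T) \<and> Cod A p = N"
  using assms(9)
proof induction
  case (base x)
  interpret S: abelian "fibre C A T" using fibre_abelian[OF T] .
  have x: "x \<in> Obj (fibre C A T)" using base XA by blast
  \<comment> \<open>An object of \<open>X\<close> approximates itself. The kernel is taken to be a
    zero object from \<open>D\<close>, so that it has a resolution by objects of
    \<open>D\<close>.\<close>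
  let ?i = "zero_arrow (fibre C A T) z x"
  have ses: "short_exact (fibre C A T) ?i (Ident A x)"
    using S.zero_Ident_short_exact[OF z(2) x] z(3) by simp
  note i = fibre_HomD(1,2)[OF S.zero_Hom[OF z(2) x]]
  have "Ident A x \<in> Hom (fibre C A T) x x" using S.Ident_Hom[OF x] by simp
  note I = fibre_HomD(1,2)[OF this]
  have "preserved_exact C A T [?i, Ident A x]"
    using BC2 ses I base unfolding BC2_def by metis
  then show ?case using ses i I base z(1) res.base by metis
next
  case (step k p)
  interpret S: abelian "fibre C A T" using fibre_abelian[OF T] .
  let ?S = "fibre C A T"
  note kH = S.short_exact_Hom[OF step.hyps(1), simplified fibre_sel]
  \<comment> \<open>The induction hypothesis is an approximation of the syzygy; it is converted into
    the hull that gets pushed out.\<close>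
  obtain j q where j: "short_exact ?S j q" "preserved_exact C A T [j, q]" "Dom A j = Dom A k"
    "Cod A j \<in> res T (Obj (fibre C D T))" "Cod A q \<in> Obj (fibre C X T)"
    using step.IH approximation_hull[OF T BC2 AB2] by metis
  note jH = S.short_exact_Hom[OF j(1), simplified fibre_sel j(3)]
  obtain y i' p' b where s: "short_exact ?S i' p'" "i' \<in> Hom ?S (Cod A k) y" "p' \<in> Hom ?S y (Cod A q)"
    "b \<in> Hom ?S (Cod A j) y" "b \<cdot>\<^bsub>?S\<^esub> j = i' \<cdot>\<^bsub>?S\<^esub> k" "p' \<cdot>\<^bsub>?S\<^esub> b = q"
    using S.pushout_short_exact[OF j(1) jH kH(1)] .
  have d: "Dom ?S i' = Cod A k" "Cod ?S i' = y" "Cod ?S p' = Cod A q"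
    using HomD[OF s(2)] HomD[OF s(3)] by auto
  \<comment> \<open>\<open>y\<close> is an extension of \<open>Cod A q\<close> by
    \<open>Cod A k\<close>, both in \<open>X\<close>.\<close>
  have y: "y \<in> Obj (fibre C X T)"
    using AB1 s(1) d step.hyps(4) j(5) unfolding AB1_def by metis
  have pre: "preserved_exact C A T [i', p']" using BC2 s(1) d(3) j(5) unfolding BC2_def by simp
  have o: "Cod A j \<in> Obj ?S" "Cod A p \<in> Obj ?S"
    using S.Hom_Obj[OF jH(1)] S.Hom_Obj[OF kH(2)] by auto
  \<comment> \<open>The arrow from \<open>y\<close> to \<open>Cod A p\<close> is glued from zero on
    the hull and \<open>p\<close> on \<open>Cod A k\<close>; they agree on the syzygy because
    \<open>p \<cdot> k = 0\<close>.\<close>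
  have "zero_arrow ?S (Cod A j) (Cod A p) \<cdot>\<^bsub>?S\<^esub> j = p \<cdot>\<^bsub>?S\<^esub> k"
    using S.zero_comp[OF jH(1) o(2)] S.short_exactD(5)[OF step.hyps(1) kH] by simp
  then obtain q' where q': "q' \<in> Hom ?S y (Cod A p)" "q' \<cdot>\<^bsub>?S\<^esub> b = zero_arrow ?S (Cod A j) (Cod A p)"
    "q' \<cdot>\<^bsub>?S\<^esub> i' = p"
    using S.rows_pushout[OF j(1) jH s(1-3) kH(1) s(4-6) S.zero_Hom[OF o] kH(2)] by blast
  have "short_exact ?S b q'"
    using S.rows_short_exact_mono[OF j(1) jH s(1-3) kH(1) s(4-6) step.hyps(1) kH(2) q'(1,3,2)] .
  moreover have "preserved_exact C A T [b, q']"
    by (rule preserved_exactI[rotated])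
      (rule base_change_arrow.rows_mono_base_change[OF _ j(1) jH s(1-3) kH(1) s(4-6) j(2) pre kH(2)
          q'(1,3,2) step.hyps(2)], assumption+, simp)
  moreover note fibre_HomD(1,2)[OF s(4)] fibre_HomD(2)[OF q'(1)]
  ultimately show ?case using y j(4) by metis
qed

end

section \<open>Subcategories and their preserved resolutions\<close>

lemma inclusion_morphism_trans:
  fixes D X A :: "('o, 'a, 't, 'b) fcat"
  assumes DX: "inclusion_morphism C D X" and XA: "inclusion_morphism C X A"
  shows "inclusion_morphism C D A"
proof -
  have f1: "cat_functor D X (\<lambda>x. x) (\<lambda>a. a)" "cat_functor X A (\<lambda>x. x) (\<lambda>a. a)"
    using DX XA by (auto simp: inclusion_morphism_def fibred_morphism_def)
  have o1: "Obj D \<subseteq> Obj X" "Obj X \<subseteq> Obj A"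
    using f1 by (auto simp: cat_functor_def)
  have a1: "a \<in> Arr X \<and> Dom X a = Dom D a \<and> Cod X a = Cod D a" if "a \<in> Arr D" for a
    using f1(1) that by (auto simp: cat_functor_def Hom_def)
  have a2: "a \<in> Arr A \<and> Dom A a = Dom X a \<and> Cod A a = Cod X a" if "a \<in> Arr X" for a
    using f1(2) that by (auto simp: cat_functor_def Hom_def)
  have "cat_functor D A (\<lambda>x. x) (\<lambda>a. a)"
    unfolding cat_functor_def
  proof (intro conjI ballI impI)
    fix a b assume ab: "a \<in> Arr D" "b \<in> Arr D" "Cod D a = Dom D b"
    then have "b \<cdot>\<^bsub>D\<^esub> a = b \<cdot>\<^bsub>X\<^esub> a"
      using f1(1) by (simp add: cat_functor_def)
    also have "\<dots> = b \<cdot>\<^bsub>A\<^esub> a"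
      using f1(2) a1[OF ab(1)] a1[OF ab(2)] ab(3) by (simp add: cat_functor_def)
    finally show "b \<cdot>\<^bsub>D\<^esub> a = b \<cdot>\<^bsub>A\<^esub> a" .
  next
    fix x assume "x \<in> Obj D"
    then show "Ident D x = Ident A x" using f1 o1 by (auto simp: cat_functor_def)
  next
    fix a assume "a \<in> Arr D"
    then show "a \<in> Hom A (Dom D a) (Cod D a)" using a1 a2 by (simp add: Hom_def)
  qed (use o1 in blast)
  moreover have "PObj A x = PObj D x" if "x \<in> Obj D" for x
    using DX XA o1 that by (auto simp: inclusion_morphism_def fibred_morphism_def)
  moreover have "PArr A a = PArr D a" if "a \<in> Arr D" for a
    using DX XA a1[OF that] that by (auto simp: inclusion_morphism_def fibred_morphism_def)
  moreover have "cocartesian C A a" if "cocartesian C D a" for a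
    using DX XA that by (auto simp: inclusion_morphism_def fibred_morphism_def)
  moreover have "(\<lambda>a. a) \<in> hom (HomOver D x y f) (HomOver A x y f)"
    if xy: "x \<in> Obj D" "y \<in> Obj D" and f: "f \<in> Hom C (PObj D x) (PObj D y)" for x y f
  proof -
    have "PObj X x = PObj D x" "PObj X y = PObj D y"
      using DX xy by (auto simp: inclusion_morphism_def fibred_morphism_def)
    then have "(\<lambda>a. a) \<in> hom (HomOver X x y f) (HomOver A x y f)"
      using XA xy o1 f unfolding inclusion_morphism_def fibred_morphism_def by (metis subsetD)
    moreover have "(\<lambda>a. a) \<in> hom (HomOver D x y f) (HomOver X x y f)"
      using DX xy f unfolding inclusion_morphism_def fibred_morphism_def by blast
    ultimately show ?thesis by (auto simp: hom_def)
  qed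
  moreover have "Hom A x y \<subseteq> Hom D x y" if "x \<in> Obj D" "y \<in> Obj D" for x y
    using DX XA o1 that unfolding inclusion_morphism_def by (meson order_trans subsetD)
  \<comment> \<open>Both ends lie in \<open>X\<close>, so by fullness the inverse does too and
    \<open>a\<close> is an isomorphism of \<open>X\<close>, where closure of \<open>D\<close>
    applies.\<close>
  moreover have "Cod A a \<in> Obj D" if iso: "iso_arrow A a" and dom: "Dom A a \<in> Obj D" for a
  proof -
    have X: "Dom A a \<in> Obj X" "Cod A a \<in> Obj X"
      using XA o1 iso dom unfolding inclusion_morphism_def by blast+
    obtain b where a: "a \<in> Arr A" and b: "b \<in> Hom A (Cod A a) (Dom A a)"
      "b \<cdot>\<^bsub>A\<^esub> a = Ident A (Dom A a)" "a \<cdot>\<^bsub>A\<^esub> b = Ident A (Cod A a)"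
      using iso by (auto simp: iso_arrow_def)
    have aX: "a \<in> Hom X (Dom A a) (Cod A a)" and bX: "b \<in> Hom X (Cod A a) (Dom A a)"
      using XA X Arr_Hom[OF a] b(1) unfolding inclusion_morphism_def by blast+
    have "b \<cdot>\<^bsub>X\<^esub> a = Ident X (Dom A a)" "a \<cdot>\<^bsub>X\<^esub> b = Ident X (Cod A a)"
      using f1(2) X HomD[OF aX] HomD[OF bX] b by (auto simp: cat_functor_def)
    then have "iso_arrow X a" using aX bX HomD[OF aX] by (auto simp: iso_arrow_def)
    then show ?thesis using DX dom HomD[OF aX] unfolding inclusion_morphism_def by metis
  qed
  ultimately show ?thesis unfolding inclusion_morphism_def fibred_morphism_def by blast
qed

context fibred_abelian_cat
begin

context
  fixes F :: "('o, 'a, 't, 'b) fcat"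
  assumes incl: "inclusion_morphism C F A" and fib: "fibred_additive C F"
begin

lemma incl_Obj: "Obj (fibre C F T) \<subseteq> Obj (fibre C A T)"
  using incl by (auto simp: inclusion_morphism_def fibred_morphism_def cat_functor_def)

lemma incl_Arr:
  assumes "a \<in> Arr F"
  shows "a \<in> Arr A" "Dom A a = Dom F a" "Cod A a = Cod F a" "PArr A a = PArr F a"
  using incl assms by (auto simp: inclusion_morphism_def fibred_morphism_def cat_functor_def Hom_def)

lemma incl_iso:
  assumes "iso_arrow A a" "a \<in> Arr (fibre C A T)" "Dom A a \<in> Obj (fibre C F T)"
  shows "Cod A a \<in> Obj (fibre C F T)"
proof -
  have F: "Cod A a \<in> Obj F" using incl assms by (auto simp: inclusion_morphism_def)
  have T: "PObj A (Dom A a) = T" using subsetD[OF incl_Obj assms(3)] by simp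
  then have "T \<in> Obj C"
    using proj A.Dom_closed assms(2) by (auto simp: cat_functor_def)
  then have "Ident C T \<in> Hom C T T" using C.Ident_Hom by blast
  then have "PObj A (Cod A a) = T"
    using proj assms(2) by (auto simp: cat_functor_def Hom_def)
  moreover have "PObj A (Cod A a) = PObj F (Cod A a)"
    using incl F by (auto simp: inclusion_morphism_def fibred_morphism_def)
  ultimately show ?thesis using F by simp
qed

text \<open>A zero object of the subcategory has one endomorphism there, hence by fullness only one
  in the fibre of \<open>A\<close>; so its identity is the zero arrow.\<close>

lemma incl_zero:
  assumes T: "T \<in> Obj C"
  obtains z where "z \<in> Obj (fibre C F T)" "z \<in> Obj (fibre C A T)"
    "Ident A z = zero_arrow (fibre C A T) z z"
proof -
  interpret S: abelian "fibre C A T" using fibre_abelian[OF T] .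
  have "additive_category (fibre C F T)" using fib T by (simp add: fibred_additive_def)
  then obtain z where z: "zero_object (fibre C F T) z" unfolding additive_category_def by blast
  then have zF: "z \<in> Obj (fibre C F T)" by (simp only: zero_object_def)
  then have zA: "z \<in> Obj (fibre C A T)" using incl_Obj by blast
  have "Hom A z z \<subseteq> Hom F z z" using incl zF by (auto simp: inclusion_morphism_def)
  then have sub: "Hom (fibre C A T) z z \<subseteq> Hom (fibre C F T) z z"
    using incl_Arr(4) by (force simp: Hom_fibre Hom_def)
  have "\<exists>!a. a \<in> Hom (fibre C F T) z z" using z zF unfolding zero_object_def by blast
  moreover have "Ident A z \<in> Hom (fibre C A T) z z" using S.Ident_Hom[OF zA] by simp
  moreover have "zero_arrow (fibre C A T) z z \<in> Hom (fibre C A T) z z"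
    using S.zero_Hom zA by blast
  ultimately have "Ident A z = zero_arrow (fibre C A T) z z" using sub by blast
  then show ?thesis using that zF zA by blast
qed

text \<open>\<open>F\<close> has a cocartesian arrow of its own out of the same object, and it stays
  cocartesian in \<open>A\<close>. Its target is therefore isomorphic to that of \<open>c\<close>,
  and \<open>F\<close> is closed under isomorphism.\<close>

lemma incl_base_change:
  assumes "base_change_arrow C A f T T'" "base_change_arrow.coc C A f c"
    "Dom A c \<in> Obj (fibre C F T)"
  shows "Cod A c \<in> Obj (fibre C F T')"
proof -
  interpret base_change_arrow C A f T T' by fact
  have ff: "f \<in> Arr C" "Dom C f = T" using HomD[OF f] by auto
  have "fibred C F" using fib by (simp add: fibred_additive_def)
  then obtain a where a: "cocartesian C F a" "Dom F a = Dom A c" "PArr F a = f"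
    using ff assms(3) unfolding fibred_def fibre_sel by blast
  then have aF: "a \<in> Arr F" by (simp add: cocartesian_def)
  note aA = incl_Arr[OF aF]
  have ca: "coc a"
    using incl a aA by (auto simp: coc_def inclusion_morphism_def fibred_morphism_def)
  have "category F" using fib by (simp add: fibred_additive_def fibred_def)
  then have "Cod A a \<in> Obj F" using category.Cod_closed aF aA by fastforce
  moreover have "PObj F (Cod A a) = T'"
    using coc_Obj(2)[OF ca] incl calculation
    by (auto simp: inclusion_morphism_def fibred_morphism_def)
  ultimately have aT: "Cod A a \<in> Obj (fibre C F T')" by simp
  have cH: "c \<in> Hom A (Dom A a) (Cod A c)" "PArr A c = f"
    using coc_Hom[OF assms(2)] a aA assms(2) by (auto simp: coc_def)
  obtain u where u: "u \<in> Hom S' (Cod A a) (Cod A c)" "u \<cdot>\<^bsub>A\<^esub> a = c"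
    using coc_factor[OF ca cH] by blast
  obtain v where v: "v \<in> Hom S' (Cod A c) (Cod A a)" "v \<cdot>\<^bsub>S'\<^esub> u = Ident S' (Cod A a)"
    "u \<cdot>\<^bsub>S'\<^esub> v = Ident S' (Cod A c)"
    using coc_isomorphic[OF ca assms(2) _ u] a aA by metis
  have "iso_arrow A u"
    unfolding iso_arrow_def fibre_HomD(1,2)[OF u(1)]
    using fibre_HomD[OF u(1)] fibre_HomD[OF v(1)] v by (auto simp: fibre_Cmp)
  moreover have "u \<in> Arr S'" using HomD(1)[OF u(1)] .
  ultimately show ?thesis using incl_iso[of u T'] fibre_HomD(1,2)[OF u(1)] aT by metis
qed

text \<open>By \<open>incl_base_change\<close> the terms of a base change lie in \<open>F\<close>
  automatically, so preserving a resolution amounts to preserving its exactness.\<close>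

lemma hat_fl_iff_res:
  assumes T: "T \<in> Obj C" and BC1: "BC1 C A T"
  shows "N \<in> hat_fl C A F T \<longleftrightarrow> N \<in> res T (Obj (fibre C F T))"
proof
  assume "N \<in> hat_fl C A F T"
  then obtain as where as: "resolution (fibre C A T) (fibre C F T) as N"
    and bc: "\<forall>T' \<in> Obj C. \<forall>f \<in> Hom C T T'. \<forall>bs. base_change C A f as bs \<longrightarrow>
           resolution (fibre C A T') (fibre C F T') bs (Cod A (last bs))"
    unfolding hat_fl_def by blast
  have pre: "preserved_exact C A T as"
    unfolding preserved_exact_def using bc by (simp add: resolution_def)
  have ex: "exact_sequence (fibre C A T) as" "Cod A (last as) = N"
    and dom: "\<forall>a\<in>set as. Dom A a \<in> Obj (fibre C F T)"
    using as unfolding resolution_def fibre_sel(1,2) by blast+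
  have "Cod A (last as) \<in> res T (Obj (fibre C F T))"
    by (rule exact_sequence_res[OF T BC1 _ ex(1) pre dom]) (rule incl_iso)
  then show "N \<in> res T (Obj (fibre C F T))" using ex(2) by simp
next
  assume "N \<in> res T (Obj (fibre C F T))"
  then obtain as where as: "exact_sequence (fibre C A T) as" "preserved_exact C A T as"
    "Cod A (last as) = N" "\<forall>a \<in> set as. Dom A a \<in> Obj (fibre C F T)"
    using res_exact_sequence[OF T incl_Obj] by blast
  interpret S: abelian "fibre C A T" using fibre_abelian[OF T] .
  have ch: "chain (fibre C A T) as" using as(1) by (simp add: exact_sequence_def)
  have "last as \<in> Arr (fibre C A T)" using ch last_in_set[of as] unfolding chain_def by blast
  from S.Cod_closed[OF this] have N: "N \<in> Obj (fibre C A T)" unfolding fibre_sel(2) as(3) .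
  have "resolution (fibre C A T') (fibre C F T') bs (Cod A (last bs))"
    if T': "T' \<in> Obj C" and f: "f \<in> Hom C T T'" and bc: "base_change C A f as bs" for T' f bs
  proof -
    interpret base_change_arrow C A f T T' by unfold_locales (rule f)
    obtain c c' where "bc_list as bs c c'" using bc unfolding base_change_iff by auto
    then obtain cs where cs: "length bs = length as"
      and sq: "\<forall>i < length as. sq (as ! i) (bs ! i) (cs ! i) (cs ! Suc i)"
      unfolding bc_list_iff by (elim exE conjE)
    have "Dom A b \<in> Obj (fibre C F T')" if b: "b \<in> set bs" for b
    proof -
      obtain i where i: "i < length as" "b = bs ! i" using b cs by (metis in_set_conv_nth)
      note h = sq_Hom[OF sq[rule_format, OF i(1)]]
      have "Dom A (as ! i) \<in> Obj (fibre C F T)" using as(4) i(1) nth_mem by blast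
      then have "Dom A (cs ! i) \<in> Obj (fibre C F T)" unfolding fibre_HomD(1)[OF h(1)] .
      then have "Cod A (cs ! i) \<in> Obj (fibre C F T')"
        by (rule incl_base_change[OF base_change_arrow_axioms h(3)])
      then show ?thesis unfolding i(2) fibre_HomD(1)[OF h(2)] .
    qed
    moreover have "exact_sequence S' bs"
      using as(2)[unfolded preserved_exact_def, rule_format, OF T' f bc] .
    ultimately show ?thesis unfolding resolution_def fibre_sel(1,2) by blast
  qed
  moreover have "resolution (fibre C A T) (fibre C F T) as N"
    using as unfolding resolution_def fibre_sel(1,2) by blast
  ultimately show "N \<in> hat_fl C A F T" using N unfolding hat_fl_def by blast
qed

end

end

lemma hat_fl_subset_hat: "hat_fl C A F T \<subseteq> hat (fibre C A T) (fibre C F T)"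
  unfolding hat_fl_def hat_def by blast

theorem theorem4p4:
  fixes C :: "('t, 'b) cat"
    and A X D :: "('o, 'a, 't, 'b) fcat"
    and T :: 't and N :: 'o
  assumes "category C"
    and "fibred_abelian C A"
    and "fibred_additive C X"
    and "fibred_additive C D"
    and "inclusion_morphism C D X"
    and "inclusion_morphism C X A"
    and "T \<in> Obj C"
    and "BC1 C A T"
    and "BC2 C A X T"
    and "AB1 (fibre C A T) (fibre C X T)"
    and "AB2 (fibre C A T) (fibre C X T) (fibre C D T)"
    and "N \<in> hat_fl C A X T"
  shows "(\<exists>i p. approximation (fibre C A T) (fibre C X T) (fibre C D T) N i p \<and>
            Dom A i \<in> hat_fl C A D T \<and>
            preserved_exact C A T [i, p]) \<and>
         (\<exists>j q. hull (fibre C A T) (fibre C X T) (fibre C D T) N j q \<and>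
            Cod A j \<in> hat_fl C A D T \<and>
            preserved_exact C A T [j, q])"
proof -
  interpret fibred_abelian_cat C A by (rule fibred_abelian_cat.intro[OF assms(1,2)])
  \<comment> \<open>Resolutions by objects of \<open>D\<close> are formed in the fibre of
    \<open>A\<close>, so \<open>D\<close> is regarded as a subcategory of \<open>A\<close>
    directly.\<close>
  note DA = inclusion_morphism_trans[OF assms(5,6)]
  note D = hat_fl_iff_res[OF DA assms(4) assms(7,8)]
  have N: "N \<in> res T (Obj (fibre C X T))"
    using hat_fl_iff_res[OF assms(6,3,7,8)] assms(12) by blast
  obtain z where z: "z \<in> Obj (fibre C D T)" "z \<in> Obj (fibre C A T)"
    "Ident A z = zero_arrow (fibre C A T) z z"
    using incl_zero[OF DA assms(4,7)] .
  obtain i p where i: "short_exact (fibre C A T) i p" "preserved_exact C A T [i, p]"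
    "Dom A i \<in> res T (Obj (fibre C D T))" "Cod A i \<in> Obj (fibre C X T)" "Cod A p = N"
    using res_approximation[OF assms(7,9-11) incl_Obj[OF assms(6,3)] z N] by blast
  obtain j q where j: "short_exact (fibre C A T) j q" "preserved_exact C A T [j, q]"
    "Dom A j = N" "Cod A j \<in> res T (Obj (fibre C D T))" "Cod A q \<in> Obj (fibre C X T)"
    using approximation_hull[OF assms(7,9,11) i(1-4)] i(5) by metis
  have fl: "Dom A i \<in> hat_fl C A D T" "Cod A j \<in> hat_fl C A D T" using D i(3) j(4) by blast+
  have "approximation (fibre C A T) (fibre C X T) (fibre C D T) N i p"
    unfolding approximation_def fibre_sel(1,2) using i subsetD[OF hat_fl_subset_hat fl(1)] by simp
  moreover have "hull (fibre C A T) (fibre C X T) (fibre C D T) N j q"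
    unfolding hull_def fibre_sel(1,2) using j subsetD[OF hat_fl_subset_hat fl(2)] by simp
  ultimately show ?thesis using fl i(2) j(2) by blast
qed

end
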